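(* Let $s\in\mathbb{R}$ and $q\in(0,\infty]$. (i) Let $p\in(0,\infty)$. If $q\in(0,\infty)$ and $\tau\in(1/p,\infty)$, or if $q=\infty$ and $\tau\in[1/p,\infty)$, then $$\dot{F}^{s,\tau}_{p,q}(\mathbb{R}^n)=\dot{F}^{s+n(\tau-1/p)}_{\infty,\infty}(\mathbb{R}^n)$$ with equivalent norms. (ii) Let $p\in(0,\infty]$. If $q\in(0,\infty)$ and $\tau\in(1/p,\infty)$, or if $q=\infty$ and $\tau\in[1/p,\infty)$, then $$\dot{B}^{s,\tau}_{p,q}(\mathbb{R}^n)=\dot{B}^{s+n(\tau-1/p)}_{\infty,\infty}(\mathbb{R}^n)$$ with equivalent norms.
   Context: $\mathcal{S}(\mathbb{R}^n)$ is the Schwartz space; $\mathcal{S}_\infty(\mathbb{R}^n)$ is the subspace of all $\varphi\in\mathcal{S}(\mathbb{R}^n)$ with $\int_{\mathbb{R}^n}\varphi(x)x^\gamma\,dx=0$ for all multi-indices $\gamma$, with the topology inherited from $\mathcal{S}(\mathbb{R}^n)$; $\mathcal{S}'_\infty(\mathbb{R}^n)$ is its topological dual (equivalently, $\mathcal{S}'(\mathbb{R}^n)$ modulo polynomials). $\mathcal{Q}$ is the set of all dyadic cubes $Q_{jk}=2^{-j}([0,1)^n+k)$, $j\in\mathbb{Z}$, $k\in\mathbb{Z}^n$. For $P\in\mathcal{Q}$, $|P|$ is its Lebesgue measure, $\ell(P)$ its side-length and $j_P=-\log_2\ell(P)$. Convention: $1/p=0$ if $p=\infty$. Fix $\varphi\in\mathcal{S}(\mathbb{R}^n)$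 with $\mathrm{supp}\,\widehat{\varphi}\subset\{\xi:1/2\le|\xi|\le2\}$ and $|\widehat{\varphi}(\xi)|\ge C>0$ when $3/5\le|\xi|\le5/3$. Put $\varphi_j(x)=2^{jn}\varphi(2^jx)$, $j\in\mathbb{Z}$. For $s\in\mathbb{R}$, $\tau\in[0,\infty)$, $q\in(0,\infty]$: Triebel-Lizorkin-type space ($p\in(0,\infty)$): $\dot{F}^{s,\tau}_{p,q}(\mathbb{R}^n)$ is the set of $f\in\mathcal{S}'_\infty(\mathbb{R}^n)$ with $$\|f\|_{\dot{F}^{s,\tau}_{p,q}(\mathbb{R}^n)}=\sup_{P\in\mathcal{Q}}\frac1{|P|^{\tau}}\left\{\int_P\left[\sum_{j=j_P}^\infty 2^{jsq}|\varphi_j\ast f(x)|^q\right]^{p/q}dx\right\}^{1/p}<\infty.$$ Besov-type space ($p\in(0,\infty]$): $\dot{B}^{s,\tau}_{p,q}(\mathbb{R}^n)$ is the set of $f\in\mathcal{S}'_\infty(\mathbb{R}^n)$ with $$\|f\|_{\dot{B}^{s,\tau}_{p,q}(\mathbb{R}^n)}=\sup_{P\in\mathcal{Q}}\frac1{|P|^{\tau}}\left\{\sum_{j=j_P}^\infty 2^{jsq}\left[\int_P|\varphi_j\ast f(x)|^p\,dx\right]^{q/p}\right\}^{1/q}<\infty.$$ When $p=\infty$ or $q=\infty$ the usual modifications are made (the $L^p(P)$ quasi-norm becomes the essential supremum over $P$; the $\ell^q$ quasi-norm becomes a supremum over $j\ge j_P$). For $\sigma\in\mathbb{R}$, the classical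 homogeneous spaces $\dot{F}^{\sigma}_{\infty,\infty}(\mathbb{R}^n)=\dot{B}^{\sigma}_{\infty,\infty}(\mathbb{R}^n)$ consist of all $f\in\mathcal{S}'_\infty(\mathbb{R}^n)$ with $\sup_{j\in\mathbb{Z}}2^{j\sigma}\|\varphi_j\ast f\|_{L^\infty(\mathbb{R}^n)}<\infty$, this quantity being the norm. *)

theory Defs
  imports "HOL-Analysis.Analysis" "HOL-Probability.Essential_Supremum"
begin

subsection \<open>The space of Schwartz functions and its subspace with vanishing moments\<close>

definition partial_deriv :: "'n \<Rightarrow> (real^'n::finite \<Rightarrow> complex) \<Rightarrow> (real^'n \<Rightarrow> complex)" where
  "partial_deriv i f = (\<lambda>x. frechet_derivative f (at x) (axis i 1))"

text \<open>Iterated partial derivatives are indexed by lists of directions instead of multi-indices.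
  For smooth functions the order of differentiation is irrelevant, so this is only a redundant
  enumeration of the same derivatives. Smoothness is differentiability of all of them.\<close>

abbreviation partial_derivs :: "'n list \<Rightarrow> (real^'n::finite \<Rightarrow> complex) \<Rightarrow> (real^'n \<Rightarrow> complex)" where
  "partial_derivs is f \<equiv> foldr partial_deriv is f"

definition smooth :: "(real^'n::finite \<Rightarrow> complex) \<Rightarrow> bool" where
  "smooth f \<longleftrightarrow> (\<forall>is. partial_derivs is f differentiable_on UNIV)"

definition monomial :: "('n \<Rightarrow> nat) \<Rightarrow> real^'n::finite \<Rightarrow> real" where
  "monomial \<gamma> x = (\<Prod>i\<in>UNIV. (x $ i) ^ \<gamma> i)"

definition schwartz :: "(real^'n::finite \<Rightarrow> complex) set" where
  "schwartz = {f. smooth f \<and>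
     (\<forall>\<gamma> is. bounded (range (\<lambda>x. monomial \<gamma> x *\<^sub>R partial_derivs is f x)))}"

definition schwartz_seminorm ::
  "('n \<Rightarrow> nat) \<Rightarrow> 'n list \<Rightarrow> (real^'n::finite \<Rightarrow> complex) \<Rightarrow> real" where
  "schwartz_seminorm \<gamma> is f = (SUP x. norm (monomial \<gamma> x *\<^sub>R partial_derivs is f x))"

definition schwartz_topology :: "(real^'n::finite \<Rightarrow> complex) topology" where
  "schwartz_topology = topology_generated_by
     {{g \<in> schwartz. schwartz_seminorm \<gamma> is (\<lambda>x. g x - f x) < e} | f \<gamma> is e.
        f \<in> schwartz \<and> 0 < e}"

definition schwartz_inf :: "(real^'n::finite \<Rightarrow> complex) set" where
  "schwartz_inf = {f \<in> schwartz. \<forall>\<gamma>. (LINT x|lborel. f x * of_real (monomial \<gamma> x)) = 0}"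

text \<open>Functionals on \<open>schwartz_inf\<close> are total functions in HOL; \<open>extensional\<close> normalises their
  irrelevant values outside \<open>schwartz_inf\<close>.\<close>

definition schwartz_inf_dual :: "((real^'n::finite \<Rightarrow> complex) \<Rightarrow> complex) set" where
  "schwartz_inf_dual = {f \<in> extensional schwartz_inf.
     (\<forall>g\<in>schwartz_inf. \<forall>h\<in>schwartz_inf. \<forall>a b. f (\<lambda>x. a * g x + b * h x) = a * f g + b * f h) \<and>
     continuous_map (subtopology schwartz_topology schwartz_inf) euclidean f}"

definition fourier :: "(real^'n::finite \<Rightarrow> complex) \<Rightarrow> (real^'n \<Rightarrow> complex)" where
  "fourier f \<xi> = (LINT x|lborel. exp (- (\<i> * of_real (x \<bullet> \<xi>))) * f x)"

definition dilate :: "(real^'n::finite \<Rightarrow> complex) \<Rightarrow> int \<Rightarrow> (real^'n \<Rightarrow> complex)" where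
  "dilate \<phi> j x = (2 powi (j * int CARD('n))) *\<^sub>R \<phi> ((2 powi j) *\<^sub>R x)"

definition conv :: "(real^'n::finite \<Rightarrow> complex) \<Rightarrow> ((real^'n \<Rightarrow> complex) \<Rightarrow> complex) \<Rightarrow> (real^'n \<Rightarrow> complex)" where
  "conv \<psi> f x = f (\<lambda>y. \<psi> (x - y))"


subsection \<open>Extended-valued quasi-norms\<close>

text \<open>Intended for a positive exponent only.\<close>

definition ennreal_powr :: "ennreal \<Rightarrow> real \<Rightarrow> ennreal" where
  "ennreal_powr a r = (if a = \<infinity> then \<infinity> else ennreal (enn2real a powr r))"

definition recip :: "ennreal \<Rightarrow> real" where
  "recip p = (if p = \<infinity> then 0 else 1 / enn2real p)"

definition Lp_qnorm :: "ennreal \<Rightarrow> (real^'n::finite) set \<Rightarrow> (real^'n \<Rightarrow> ennreal) \<Rightarrow> ennreal" where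
  "Lp_qnorm p A g =
     (if p = \<infinity> then esssup (restrict_space lborel A) g
      else ennreal_powr (\<integral>\<^sup>+x\<in>A. ennreal_powr (g x) (enn2real p) \<partial>lborel) (1 / enn2real p))"

definition lq_qnorm :: "ennreal \<Rightarrow> int set \<Rightarrow> (int \<Rightarrow> ennreal) \<Rightarrow> ennreal" where
  "lq_qnorm q J a =
     (if q = \<infinity> then (SUP j\<in>J. a j)
      else ennreal_powr (\<Sum>\<^sub>\<infinity>j\<in>J. ennreal_powr (a j) (enn2real q)) (1 / enn2real q))"

definition dyadic_cube :: "int \<Rightarrow> int^'n \<Rightarrow> (real^'n::finite) set" where
  "dyadic_cube j k = (\<lambda>x. (2 powi (- j)) *\<^sub>R (x + (\<chi> i. of_int (k $ i)))) ` {x. \<forall>i. 0 \<le> x $ i \<and> x $ i < 1}"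


subsection \<open>The function spaces\<close>

text \<open>The supremum over all dyadic cubes \<open>P\<close> is taken over the indices \<open>i\<close>, \<open>k\<close> with
  \<open>P = dyadic_cube i k\<close>; then \<open>j\<^sub>P = i\<close>, as \<open>P\<close> has side length \<open>2 powi (- i)\<close>.\<close>

definition F_norm :: "(real^'n::finite \<Rightarrow> complex) \<Rightarrow> real \<Rightarrow> real \<Rightarrow> ennreal \<Rightarrow> ennreal \<Rightarrow>
    ((real^'n \<Rightarrow> complex) \<Rightarrow> complex) \<Rightarrow> ennreal" where
  "F_norm \<phi> s \<tau> p q f = (SUP i. SUP k.
     Lp_qnorm p (dyadic_cube i k)
       (\<lambda>x. lq_qnorm q {i..} (\<lambda>j. ennreal (2 powr (of_int j * s) * norm (conv (dilate \<phi> j) f x))))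
     / ennreal (measure lborel (dyadic_cube i k :: (real^'n) set) powr \<tau>))"

definition B_norm :: "(real^'n::finite \<Rightarrow> complex) \<Rightarrow> real \<Rightarrow> real \<Rightarrow> ennreal \<Rightarrow> ennreal \<Rightarrow>
    ((real^'n \<Rightarrow> complex) \<Rightarrow> complex) \<Rightarrow> ennreal" where
  "B_norm \<phi> s \<tau> p q f = (SUP i. SUP k.
     lq_qnorm q {i..} (\<lambda>j. ennreal (2 powr (of_int j * s)) *
       Lp_qnorm p (dyadic_cube i k) (\<lambda>x. ennreal (norm (conv (dilate \<phi> j) f x))))
     / ennreal (measure lborel (dyadic_cube i k :: (real^'n) set) powr \<tau>))"

text \<open>The common quasi-norm of the classical homogeneous Besov and Triebel-Lizorkin spaces with both
  integrability indices infinite; by definition these are the same space.\<close>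

definition inf_inf_norm :: "(real^'n::finite \<Rightarrow> complex) \<Rightarrow> real \<Rightarrow>
    ((real^'n \<Rightarrow> complex) \<Rightarrow> complex) \<Rightarrow> ennreal" where
  "inf_inf_norm \<phi> \<sigma> f = (SUP j. ennreal (2 powr (of_int j * \<sigma>)) *
     Lp_qnorm \<infinity> UNIV (\<lambda>x. ennreal (norm (conv (dilate \<phi> j) f x))))"

definition space_of :: "(((real^'n::finite \<Rightarrow> complex) \<Rightarrow> complex) \<Rightarrow> ennreal) \<Rightarrow>
    ((real^'n \<Rightarrow> complex) \<Rightarrow> complex) set" where
  "space_of N = {f \<in> schwartz_inf_dual. N f < \<infinity>}"

definition equivalent_on :: "'a set \<Rightarrow> ('a \<Rightarrow> ennreal) \<Rightarrow> ('a \<Rightarrow> ennreal) \<Rightarrow> bool" where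
  "equivalent_on X N M \<longleftrightarrow>
     (\<exists>c C :: real. 0 < c \<and> 0 < C \<and> (\<forall>f\<in>X. ennreal c * N f \<le> M f \<and> M f \<le> ennreal C * N f))"

definition equal_with_equivalent_norms ::
  "(((real^'n::finite \<Rightarrow> complex) \<Rightarrow> complex) \<Rightarrow> ennreal) \<Rightarrow>
   (((real^'n \<Rightarrow> complex) \<Rightarrow> complex) \<Rightarrow> ennreal) \<Rightarrow> bool" where
  "equal_with_equivalent_norms N M \<longleftrightarrow>
     space_of N = space_of M \<and> equivalent_on (space_of N) N M"

end

theory Submission
  imports Defs "HOL-Probability.Characteristic_Functions" "HOL-Probability.Sinc_Integral"
begin

text \<open>The embedding of \<open>B\<^sup>\<sigma>\<^sub>\<infinity>\<^sub>\<infinity>\<close>, \<open>\<sigma> = s + n (\<tau> - 1/p)\<close>, into the other spaces is a geometric series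
  over \<open>j \<ge> j\<^sub>P\<close>, followed by integration over \<open>P\<close>.

  Conversely, keep only the term \<open>j = j\<^sub>P\<close>. It must be shown that the band-limited function
  \<open>U z = f (\<phi> (z - c \<cdot>))\<close>, \<open>c = 2\<^sup>j\<close>, satisfies \<open>\<bar>U\<bar> \<ge> \<kappa> \<bar>U z\<^sub>0\<bar>\<close> on some box of fixed size, with
  constants depending only on \<open>\<phi>\<close>; this bounds every \<open>L\<^sup>p\<close> quasi-norm, \<open>p < 1\<close> included, over a dyadic
  cube from below. Since \<open>U\<close> may grow polynomially, it is multiplied by \<open>\<phi> (a + \<epsilon> z)\<close>, where
  \<open>\<phi> a \<noteq> 0\<close>: the product \<open>V\<close> is bounded, still band-limited, and comparable to \<open>U\<close> at \<open>z\<^sub>0\<close> for small \<open>\<epsilon>\<close>.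
  A Bernstein inequality bounds the modulus of continuity of \<open>V\<close> by its supremum, so that \<open>\<bar>V\<bar>\<close> stays
  large on a box around any point where it nearly attains its supremum.

  The Bernstein inequality rests on the expansion of \<open>sin (\<beta> \<theta>)\<close>, \<open>0 \<le> \<beta> \<le> 1\<close>, in powers of \<open>sin \<theta>\<close>, whose
  coefficients are nonnegative with sum at most \<open>\<beta> \<pi> / 2\<close>. Applied to frequencies, it writes the difference
  \<open>V (x + \<beta> v) - V (x - \<beta> v)\<close> as a convergent series of finite difference operators in the direction
  \<open>v\<close>, each a finite combination of translates, so \<open>f\<close> has to be interchanged with limits of finite sums only,
  never with integrals.\<close>

subsection \<open>Powers of the sine\<close>

text \<open>The lower bound has to be uniform in \<open>f\<close>, whereas everything that
  continuity of \<open>f\<close> provides (a finite set of seminorms, the growth order of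
  \<open>U\<close>) depends on \<open>f\<close>. Two devices remove this dependence. The constant of
  the sampling series is multiplied by a tail of the coefficient sum that tends to 0, so it can be
  replaced by the supremum of \<open>V\<close>, however large it was. The box sits where
  \<open>V\<close> is nearly maximal, possibly far from \<open>z\<^sub>0\<close>; but the
  quasi-norms take the supremum over all cubes of a given side length, so only the size of the box
  counts and not its place. The exponents come from scaling: a cube P of side 2^(-j) satisfies
  |P|^(1/p - \<tau>) = 2^(j n (\<tau> - 1/p)), which is the shift from s to \<sigma>. At \<tau> =
  1/p the geometric series has ratio 1, and only its supremum, the case q = \<infinity>, stays
  finite.\<close>

fun sin_mult_coeff :: "real \<Rightarrow> nat \<Rightarrow> real" where
  "sin_mult_coeff \<beta> 0 = 0"
| "sin_mult_coeff \<beta> (Suc 0) = \<beta>"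
| "sin_mult_coeff \<beta> (Suc (Suc n)) =
     sin_mult_coeff \<beta> n * ((real n)\<^sup>2 - \<beta>\<^sup>2) / ((real n + 1) * (real n + 2))"

text \<open>The coefficients are the Taylor coefficients at 0 of the odd function x \<mapsto> sin
  (\<beta> arcsin x); the recursion starts with 0 and preserves parity.\<close>

lemma sin_mult_coeff_even: "even n \<Longrightarrow> sin_mult_coeff \<beta> n = 0"
  by (induction \<beta> n rule: sin_mult_coeff.induct) auto

text \<open>For odd n one has \<beta> \<le> 1 \<le> n, so the factor n^2 - \<beta>^2 is nonnegative
  and below the denominator. The one index where it can be negative is n = 0, where the coefficient
  is 0.\<close>

lemma sin_mult_coeff_bounds:
  assumes "0 \<le> \<beta>" "\<beta> \<le> 1"
  shows "0 \<le> sin_mult_coeff \<beta> n \<and> sin_mult_coeff \<beta> n \<le> 1"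
  using assms
proof (induction \<beta> n rule: sin_mult_coeff.induct)
  case (3 \<beta> n)
  show ?case
  proof (cases "even n")
    case True
    then show ?thesis by (simp add: sin_mult_coeff_even)
  next
    case False
    then have n: "real n \<ge> 1" by (cases n) auto
    have "\<beta>\<^sup>2 \<le> 1\<^sup>2" using 3 by (intro power_mono) auto
    moreover have "1\<^sup>2 \<le> (real n)\<^sup>2" using n by (intro power_mono) auto
    ultimately have b: "\<beta>\<^sup>2 \<le> (real n)\<^sup>2" by simp
    have d: "0 < (real n + 1) * (real n + 2)" by (simp add: add_pos_pos)
    have e: "(real n)\<^sup>2 - \<beta>\<^sup>2 \<le> (real n + 1) * (real n + 2)"
      by (simp add: algebra_simps power2_eq_square)
    have "sin_mult_coeff \<beta> n * ((real n)\<^sup>2 - \<beta>\<^sup>2) \<le> 1 * ((real n + 1) * (real n + 2))"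
      using 3 b e by (intro mult_mono) auto
    then have "sin_mult_coeff \<beta> n * ((real n)\<^sup>2 - \<beta>\<^sup>2) / ((real n + 1) * (real n + 2)) \<le> 1"
      using d by (simp only: pos_divide_le_eq)
    moreover have "0 \<le> sin_mult_coeff \<beta> n * ((real n)\<^sup>2 - \<beta>\<^sup>2) / ((real n + 1) * (real n + 2))"
      using 3 b d by (intro divide_nonneg_pos mult_nonneg_nonneg) auto
    ultimately show ?thesis by simp
  qed
qed auto

lemma sin_mult_coeff_summable:
  fixes x :: real
  assumes "0 \<le> \<beta>" "\<beta> \<le> 1" "\<bar>x\<bar> < 1"
  shows "summable (\<lambda>n. sin_mult_coeff \<beta> n * x ^ n)"
proof (rule summable_comparison_test[OF _ summable_geometric])
  show "norm \<bar>x\<bar> < 1" using assms by simp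
  show "\<exists>N. \<forall>n\<ge>N. norm (sin_mult_coeff \<beta> n * x ^ n) \<le> \<bar>x\<bar> ^ n"
    using sin_mult_coeff_bounds[OF assms(1,2)]
    by (intro exI[of _ 0]) (auto simp: abs_mult power_abs intro!: mult_left_le_one_le)
qed

text \<open>The generating function \<open>y\<close> of the coefficients solves
  \<open>(1 - x\<^sup>2) y'' - x y' + \<beta>\<^sup>2 y = 0\<close>, so that \<open>y (sin t)\<close> solves \<open>u'' = - \<beta>\<^sup>2 u\<close>.\<close>

lemma sin_mult_coeff_sums:
  assumes \<beta>: "0 \<le> \<beta>" "\<beta> \<le> 1" and \<theta>: "\<bar>\<theta>\<bar> < pi / 2"
  shows "(\<lambda>n. sin_mult_coeff \<beta> n * sin \<theta> ^ n) sums sin (\<beta> * \<theta>)"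
proof -
  define c where "c = sin_mult_coeff \<beta>"
  define y y1 y2 where "y x = (\<Sum>n. c n * x ^ n)" "y1 x = (\<Sum>n. diffs c n * x ^ n)"
    "y2 x = (\<Sum>n. diffs (diffs c) n * x ^ n)" for x
  have s0: "summable (\<lambda>n. c n * x ^ n)" if "norm x < 1" for x
    unfolding c_def using that \<beta> by (intro sin_mult_coeff_summable) auto
  have s1: "summable (\<lambda>n. diffs c n * x ^ n)" if "norm x < 1" for x
    by (rule termdiff_converges[OF that s0])
  have s2: "summable (\<lambda>n. diffs (diffs c) n * x ^ n)" if "norm x < 1" for x
    by (rule termdiff_converges[OF that s1])
  have d0: "(y has_field_derivative y1 x) (at x)" if "norm x < 1" for x
    unfolding y_y1_y2_def using s0 that by (rule termdiffs_strong')
  have d1: "(y1 has_field_derivative y2 x) (at x)" if "norm x < 1" for x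
    unfolding y_y1_y2_def using s1 that by (rule termdiffs_strong')
  have ode: "(1 - x\<^sup>2) * y2 x - x * y1 x + \<beta>\<^sup>2 * y x = 0" if x: "norm x < 1" for x
  proof -
    have a: "(\<lambda>n. diffs (diffs c) n * x ^ n) sums y2 x"
      unfolding y_y1_y2_def using s2[OF x] by (rule summable_sums)
    have b: "(\<lambda>n. real n * c n * x ^ n) sums (x * y1 x)"
    proof -
      have "(\<lambda>n. x * (diffs c n * x ^ n)) sums (x * y1 x)"
        unfolding y_y1_y2_def using s1[OF x] by (intro sums_mult summable_sums)
      then have "(\<lambda>n. real (Suc n) * c (Suc n) * x ^ Suc n) sums (x * y1 x)"
        by (simp add: diffs_def mult_ac)
      from sums_Suc[OF this] show ?thesis by simp
    qed
    have d: "(\<lambda>n. real n * (real n - 1) * c n * x ^ n) sums (x\<^sup>2 * y2 x)"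
    proof -
      have "(\<lambda>n. x\<^sup>2 * (diffs (diffs c) n * x ^ n)) sums (x\<^sup>2 * y2 x)"
        using a by (rule sums_mult)
      then have "(\<lambda>n. real (Suc (Suc n)) * (real (Suc (Suc n)) - 1) * c (Suc (Suc n)) * x ^ Suc (Suc n))
          sums (x\<^sup>2 * y2 x)"
        by (simp add: diffs_def mult_ac power2_eq_square)
      from sums_Suc[OF sums_Suc[OF this]] show ?thesis by simp
    qed
    have e: "(\<lambda>n. c n * x ^ n) sums y x"
      unfolding y_y1_y2_def using s0[OF x] by (rule summable_sums)
    have "(\<lambda>n. diffs (diffs c) n * x ^ n - (real n * (real n - 1) * c n * x ^ n)
        - real n * c n * x ^ n + \<beta>\<^sup>2 * (c n * x ^ n))
        sums (y2 x - x\<^sup>2 * y2 x - x * y1 x + \<beta>\<^sup>2 * y x)"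
      by (intro sums_add sums_diff sums_mult a b d e)
    \<comment> \<open>Coefficientwise the differential equation is the recursion (n + 1) (n + 2) c(n
      + 2) = (n^2 - \<beta>^2) c(n).\<close>
    moreover have "diffs (diffs c) n * x ^ n - (real n * (real n - 1) * c n * x ^ n)
        - real n * c n * x ^ n + \<beta>\<^sup>2 * (c n * x ^ n) = 0" for n
    proof -
      have "diffs (diffs c) n = c n * ((real n)\<^sup>2 - \<beta>\<^sup>2)"
        unfolding diffs_def c_def by (simp add: field_simps add_nonneg_eq_0_iff)
      then show ?thesis
        unfolding \<open>diffs (diffs c) n = _\<close> by (simp add: algebra_simps power2_eq_square)
    qed
    ultimately have "(\<lambda>n. 0::real) sums (y2 x - x\<^sup>2 * y2 x - x * y1 x + \<beta>\<^sup>2 * y x)" by simp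
    from sums_unique2[OF this sums_zero] show ?thesis by (simp add: algebra_simps)
  qed
  have sinlt: "norm (sin t) < 1" if "\<bar>t\<bar> < pi / 2" for t :: real
  proof -
    have "0 < cos t" using that by (intro cos_gt_zero_pi) auto
    then have "(sin t)\<^sup>2 < 1" using sin_cos_squared_add[of t] zero_less_power[of "cos t" 2] by linarith
    then show ?thesis by (simp add: abs_square_less_1)
  qed
  \<comment> \<open>The conserved energy u'^2 + \<beta>^2 u^2 of u = y (sin t) - sin (\<beta> t), a
    solution of u'' = - \<beta>^2 u with vanishing initial data.\<close>
  define E where "E t = (y1 (sin t) * cos t - \<beta> * cos (\<beta> * t))\<^sup>2
    + \<beta>\<^sup>2 * (y (sin t) - sin (\<beta> * t))\<^sup>2" for t
  have "(E has_field_derivative 0) (at t)" if t: "t \<in> {-(pi/2)<..<pi/2}" for t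
  proof -
    have n: "norm (sin t) < 1" using t sinlt[of t] by auto
    have o: "y2 (sin t) * (cos t)\<^sup>2 - sin t * y1 (sin t) + \<beta>\<^sup>2 * y (sin t) = 0"
      using ode[OF n] by (simp add: cos_squared_eq mult.commute)
    note dy = DERIV_chain2[where f=y and g=sin, OF d0[OF n] DERIV_sin]
    note dy1 = DERIV_chain2[where f=y1 and g=sin, OF d1[OF n] DERIV_sin]
    have "(E has_field_derivative
      2 * (y1 (sin t) * cos t - \<beta> * cos (\<beta> * t)) *
        ((y2 (sin t) * cos t) * cos t + y1 (sin t) * (- sin t) + \<beta> * (sin (\<beta> * t) * \<beta>))
      + \<beta>\<^sup>2 * (2 * (y (sin t) - sin (\<beta> * t)) * (y1 (sin t) * cos t - cos (\<beta> * t) * \<beta>))) (at t)"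
      unfolding E_def
      by (rule dy dy1 derivative_eq_intros refl)+ (simp add: algebra_simps)
    also have "(y2 (sin t) * cos t) * cos t + y1 (sin t) * (- sin t) = - \<beta>\<^sup>2 * y (sin t)"
      using o by (simp add: algebra_simps power2_eq_square)
    also have "2 * (y1 (sin t) * cos t - \<beta> * cos (\<beta> * t)) * (- \<beta>\<^sup>2 * y (sin t) + \<beta> * (sin (\<beta> * t) * \<beta>))
      + \<beta>\<^sup>2 * (2 * (y (sin t) - sin (\<beta> * t)) * (y1 (sin t) * cos t - cos (\<beta> * t) * \<beta>)) = 0"
      by (simp add: algebra_simps power2_eq_square)
    finally show ?thesis .
  qed
  then have "E \<theta> = E 0"
    using \<theta> by (intro has_derivative_zero_unique_connected[where s="{-(pi/2)<..<pi/2}"])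
       (auto simp: has_field_derivative_def mult_zero_left[abs_def])
  moreover have "E 0 = 0"
  proof -
    have "y 0 = 0" "y1 0 = \<beta>"
      unfolding y_y1_y2_def by (simp_all add: c_def diffs_def)
    then show ?thesis by (simp add: E_def)
  qed
  ultimately have "\<beta>\<^sup>2 * (y (sin \<theta>) - sin (\<beta> * \<theta>))\<^sup>2 = 0"
    unfolding E_def by (metis add_nonneg_eq_0_iff zero_le_power2 mult_nonneg_nonneg)
  then have "y (sin \<theta>) = sin (\<beta> * \<theta>)"
  \<comment> \<open>For \<beta> = 0 the energy does not control u, but then all coefficients are
    0.\<close>
  proof (cases "\<beta> = 0")
    case True
    have "c n = 0" for n
      unfolding c_def True by (induction n rule: induct_nat_012) auto
    then show ?thesis by (simp add: y_y1_y2_def True)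
  qed simp
  then show ?thesis
    using summable_sums[OF s0[OF sinlt[OF \<theta>]]] unfolding y_y1_y2_def c_def by simp
qed

text \<open>The expansion at \<theta> = pi/2, where the sine is 1, would give the sum sin (\<beta>
  pi/2). That endpoint is excluded from the expansion, so partial sums are bounded for \<theta> <
  pi/2 and then passed to the limit. The bound is linear in \<beta>, which later makes the modulus
  of continuity linear in the step.\<close>

lemma sin_mult_coeff_sum_le:
  assumes \<beta>: "0 \<le> \<beta>" "\<beta> \<le> 1"
  shows "(\<Sum>n<M. sin_mult_coeff \<beta> n) \<le> \<beta> * (pi / 2)"
proof -
  have le: "(\<Sum>n<M. sin_mult_coeff \<beta> n * sin t ^ n) \<le> \<beta> * (pi / 2)" if "t \<in> {0<..<pi/2}" for t
  proof -
    have s: "(\<lambda>n. sin_mult_coeff \<beta> n * sin t ^ n) sums sin (\<beta> * t)"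
      using that by (intro sin_mult_coeff_sums \<beta>) auto
    have "sin t \<ge> 0" using that by (intro sin_ge_zero) auto
    then have "(\<Sum>n<M. sin_mult_coeff \<beta> n * sin t ^ n) \<le> sin (\<beta> * t)"
      using sin_mult_coeff_bounds[OF \<beta>] s
      by (intro sum_le_suminf[of _ "{..<M}", THEN order_trans]) (auto simp: sums_iff)
    also have "\<dots> \<le> \<beta> * t" using that \<beta> by (intro sin_x_le_x) auto
    also have "\<dots> \<le> \<beta> * (pi / 2)" using that \<beta> by (intro mult_left_mono) auto
    finally show ?thesis .
  qed
  have "((\<lambda>t. \<Sum>n<M. sin_mult_coeff \<beta> n * sin t ^ n) \<longlongrightarrow>
      (\<Sum>n<M. sin_mult_coeff \<beta> n * sin (pi/2) ^ n)) (at_left (pi/2))"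
    by (intro tendsto_intros)
  moreover have "\<forall>\<^sub>F t in at_left (pi/2). (\<Sum>n<M. sin_mult_coeff \<beta> n * sin t ^ n) \<le> \<beta> * (pi / 2)"
    using eventually_at_left_real[of 0 "pi/2"] le pi_gt_zero by (auto elim!: eventually_mono)
  ultimately have "(\<Sum>n<M. sin_mult_coeff \<beta> n * sin (pi/2) ^ n) \<le> \<beta> * (pi / 2)"
    by (intro tendsto_upperbound) auto
  then show ?thesis by simp
qed

lemma sin_mult_coeff_abs_summable:
  assumes "0 \<le> \<beta>" "\<beta> \<le> 1"
  shows "summable (sin_mult_coeff \<beta>)"
  using sin_mult_coeff_bounds[OF assms] sin_mult_coeff_sum_le[OF assms]
  by (intro summableI_nonneg_bounded[of _ "\<beta> * (pi/2)"]) auto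

subsection \<open>Gaussians and Fourier inversion\<close>

lemma integral_lborel_affine:
  fixes f :: "'a::euclidean_space \<Rightarrow> 'b::{banach,second_countable_topology}"
  assumes [measurable]: "f \<in> borel_measurable borel" and c: "c \<noteq> 0"
  shows "(LINT x|lborel. f x) = \<bar>c\<bar> ^ DIM('a) *\<^sub>R (LINT x|lborel. f (t + c *\<^sub>R x))"
  by (subst lborel_affine[OF c, of t])
     (subst integral_density, auto simp: integral_distr)

lemma integrable_lborel_affine:
  fixes f :: "'a::euclidean_space \<Rightarrow> 'b::{banach,second_countable_topology}"
  assumes f: "integrable lborel f" and c: "c \<noteq> 0"
  shows "integrable lborel (\<lambda>x. f (t + c *\<^sub>R x))"
proof -
  have [measurable]: "f \<in> borel_measurable borel" using f by auto
  have "integrable (density (distr lborel borel (\<lambda>x. t + c *\<^sub>R x)) (\<lambda>_. ennreal (\<bar>c\<bar> ^ DIM('a)))) f"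
    using f by (subst (asm) lborel_affine[OF c, of t])
  then have "integrable (distr lborel borel (\<lambda>x. t + c *\<^sub>R x)) (\<lambda>x. \<bar>c\<bar> ^ DIM('a) *\<^sub>R f x)"
    by (subst (asm) integrable_density) auto
  from integrable_scaleR_right[OF this, of "1 / \<bar>c\<bar> ^ DIM('a)"]
  have "integrable (distr lborel borel (\<lambda>x. t + c *\<^sub>R x))
      (\<lambda>x. (1 / \<bar>c\<bar> ^ DIM('a)) *\<^sub>R (\<bar>c\<bar> ^ DIM('a) *\<^sub>R f x))" .
  moreover have "1 / \<bar>c\<bar> ^ DIM('a) * \<bar>c\<bar> ^ DIM('a) = 1" using c by simp
  ultimately have "integrable (distr lborel borel (\<lambda>x. t + c *\<^sub>R x)) f"
    by (simp only: scaleR_scaleR scaleR_one)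
  then show ?thesis by (subst (asm) integrable_distr_eq) auto
qed

lemma integrable_lborel_prod:
  fixes f :: "'a::euclidean_space \<Rightarrow> real \<Rightarrow> 'b::{real_normed_field,banach,second_countable_topology}"
  assumes f: "\<And>b. b \<in> Basis \<Longrightarrow> integrable lborel (f b)"
  shows "integrable lborel (\<lambda>x::'a. \<Prod>b\<in>Basis. f b (x \<bullet> b))"
    and "(LINT x|lborel. (\<Prod>b\<in>Basis. f b (x \<bullet> b))) = (\<Prod>b\<in>Basis. LINT t|lborel. f b t)"
proof -
  interpret product_sigma_finite "\<lambda>_::'a. lborel :: real measure" ..
  have [measurable]: "\<And>b. b \<in> Basis \<Longrightarrow> f b \<in> borel_measurable borel" using f by auto
  have *: "(\<Prod>b\<in>Basis. f b ((\<Sum>c\<in>Basis. x c *\<^sub>R c) \<bullet> b)) = (\<Prod>b\<in>Basis. f b (x b))" for x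
    by (intro prod.cong) (auto simp: inner_sum_left inner_Basis if_distrib cong: if_cong)
  show "integrable lborel (\<lambda>x::'a. \<Prod>b\<in>Basis. f b (x \<bullet> b))"
    by (subst lborel_eq, subst integrable_distr_eq)
       (auto simp: * intro!: product_integrable_prod f)
  show "(LINT x|lborel. (\<Prod>b\<in>Basis. f b (x \<bullet> b))) = (\<Prod>b\<in>Basis. LINT t|lborel. f b t)"
    by (subst lborel_eq, subst integral_distr)
       (auto simp: * intro!: product_integral_prod f)
qed

text \<open>Up to the normalising constant of the density, this is the characteristic function of
  the standard normal distribution.\<close>

lemma
  shows integrable_iexp_gauss: "integrable lborel (\<lambda>x. iexp (t * x) * complex_of_real (exp (- x\<^sup>2 / 2)))" (is ?A)
    and integral_iexp_gauss: "(LINT x|lborel. iexp (t * x) * complex_of_real (exp (- x\<^sup>2 / 2)))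
      = complex_of_real (sqrt (2 * pi)) * complex_of_real (exp (- t\<^sup>2 / 2))" (is ?B)
proof -
  have "integrable lborel (\<lambda>x. sqrt (2 * pi) * std_normal_density x)"
    by (intro integrable_mult_right integrable_normal_density) simp
  then have i: "integrable lborel (\<lambda>x::real. exp (- x\<^sup>2 / 2))"
    by (simp add: std_normal_density_def)
  have i2: "integrable lborel (\<lambda>x::real. complex_of_real (exp (- x\<^sup>2 / 2)))"
    using i by (rule integrable_of_real)
  show ?A
    by (rule Bochner_Integration.integrable_bound[OF i2]) (auto simp: norm_mult)
  have "complex_of_real (exp (- t\<^sup>2 / 2)) = char std_normal_distribution t"
    by (simp add: char_std_normal_distribution)
  also have "\<dots> = (LINT x|lborel. std_normal_density x *\<^sub>R iexp (t * x))"
    unfolding char_def by (subst integral_density) (auto simp: normal_density_nonneg)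
  also have "\<dots> = (LINT x|lborel. complex_of_real (1 / sqrt (2 * pi)) *
      (iexp (t * x) * complex_of_real (exp (- x\<^sup>2 / 2))))"
    by (intro Bochner_Integration.integral_cong)
       (auto simp: std_normal_density_def scaleR_conv_of_real mult_ac)
  also have "\<dots> = complex_of_real (1 / sqrt (2 * pi)) *
      (LINT x|lborel. iexp (t * x) * complex_of_real (exp (- x\<^sup>2 / 2)))"
    by simp
  finally show ?B by (simp add: field_simps)
qed

definition gauss :: "'a::euclidean_space \<Rightarrow> real" where
  "gauss x = exp (- (norm x)\<^sup>2 / 2)"

lemma gauss_bounds: "0 \<le> gauss x" "gauss x \<le> 1" "gauss 0 = 1" "gauss (- x) = gauss x"
  by (auto simp: gauss_def)

lemma gauss_measurable [measurable]: "gauss \<in> borel_measurable borel"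
  unfolding gauss_def by measurable

lemma gauss_exponent:
  fixes x :: "'a::euclidean_space"
  shows "- (norm x)\<^sup>2 / 2 = (\<Sum>b\<in>Basis. - (x \<bullet> b)\<^sup>2 / 2)"
proof -
  have "(norm x)\<^sup>2 = (\<Sum>b\<in>Basis. (x \<bullet> b)\<^sup>2)"
    unfolding power2_norm_eq_inner by (subst euclidean_inner) (simp add: power2_eq_square)
  then show ?thesis by (simp add: sum_negf sum_divide_distrib)
qed

lemma gauss_prod:
  fixes x \<xi> :: "'a::euclidean_space"
  shows "iexp (x \<bullet> \<xi>) * complex_of_real (gauss x) =
    (\<Prod>b\<in>Basis. iexp ((\<xi> \<bullet> b) * (x \<bullet> b)) * complex_of_real (exp (- (x \<bullet> b)\<^sup>2 / 2)))"
proof -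
  have "x \<bullet> \<xi> = (\<Sum>b\<in>Basis. (\<xi> \<bullet> b) * (x \<bullet> b))"
    by (simp add: euclidean_inner[of x \<xi>] mult_ac)
  then have "iexp (x \<bullet> \<xi>) = (\<Prod>b\<in>Basis. iexp ((\<xi> \<bullet> b) * (x \<bullet> b)))"
    by (simp add: exp_sum sum_distrib_left)
  then show ?thesis
    by (simp only: gauss_def gauss_exponent exp_sum[OF finite_Basis] prod.distrib of_real_prod)
qed

lemma
  fixes \<xi> :: "'a::euclidean_space"
  shows integrable_fourier_gauss: "integrable lborel (\<lambda>x::'a. iexp (x \<bullet> \<xi>) * complex_of_real (gauss x))"
    and integral_fourier_gauss: "(LINT x|lborel. iexp (x \<bullet> \<xi>) * complex_of_real (gauss x)) =
      complex_of_real (sqrt (2 * pi) ^ DIM('a) * gauss \<xi>)"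
proof -
  show "integrable lborel (\<lambda>x::'a. iexp (x \<bullet> \<xi>) * complex_of_real (gauss x))"
    unfolding gauss_prod by (intro integrable_lborel_prod integrable_iexp_gauss)
  show "(LINT x|lborel. iexp (x \<bullet> \<xi>) * complex_of_real (gauss x)) =
      complex_of_real (sqrt (2 * pi) ^ DIM('a) * gauss \<xi>)"
    unfolding gauss_prod
    by (subst integrable_lborel_prod, rule integrable_iexp_gauss, simp only: integral_iexp_gauss,
        simp only: gauss_def gauss_exponent exp_sum[OF finite_Basis]
          prod.distrib of_real_prod of_real_mult prod_constant of_real_power)
qed

lemma integrable_gauss: "integrable lborel (gauss :: 'a::euclidean_space \<Rightarrow> real)"
  using integrable_norm[OF integrable_fourier_gauss[of "0::'a"]] by (simp add: gauss_bounds)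

text \<open>Substituting \<xi> = w / t in the transform of the Gaussian turns a damping factor that
  spreads out as t \<rightarrow> 0 into an approximate identity of width t.\<close>

lemma integral_gauss_scaled:
  fixes z :: "'a::euclidean_space"
  assumes t: "0 < t"
  shows "(LINT \<xi>|lborel. iexp (\<xi> \<bullet> z) * complex_of_real (gauss (t *\<^sub>R \<xi>))) =
    complex_of_real (sqrt (2 * pi) ^ DIM('a) / t ^ DIM('a) * gauss (z /\<^sub>R t))"
proof -
  have "(LINT \<xi>|lborel. iexp (\<xi> \<bullet> z) * complex_of_real (gauss (t *\<^sub>R \<xi>))) =
    (1 / t) ^ DIM('a) *\<^sub>R (LINT \<xi>|lborel. iexp (\<xi> \<bullet> (z /\<^sub>R t)) * complex_of_real (gauss \<xi>))"
    using t by (subst integral_lborel_affine[where c="1/t" and t=0]) (auto simp: field_simps)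
  then show ?thesis
    unfolding integral_fourier_gauss using t
    by (simp add: scaleR_conv_of_real field_simps)
qed

lemma integrable_lborel_prod_mult:
  fixes f g :: "'a::euclidean_space \<Rightarrow> complex"
  assumes f: "integrable lborel f" and g: "integrable lborel g"
  shows "integrable (lborel \<Otimes>\<^sub>M lborel) (\<lambda>(x, y). f x * g y)"
proof -
  have [measurable]: "f \<in> borel_measurable borel" "g \<in> borel_measurable borel" using f g by auto
  have "integrable lborel (\<lambda>x. norm (f x) * (LINT y|lborel. norm (g y)))"
    using f by (intro integrable_mult_left integrable_norm)
  then show ?thesis
    using g by (intro lborel_pair.Fubini_integrable) (auto simp: norm_mult)
qed

text \<open>The inversion integral is regularised by the factor
  \<open>gauss (t *\<^sub>R \<xi>)\<close>. For t > 0 it equals a Gaussian average of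
  \<open>f\<close> around \<open>x\<close> at scale t; as t \<rightarrow> 0 one side converges
  because \<open>fourier f\<close> is integrable, the other because \<open>f\<close> is bounded and
  continuous.\<close>

lemma fourier_inversion:
  fixes f :: "real^'n::finite \<Rightarrow> complex"
  assumes f: "integrable lborel f" and cont: "continuous_on UNIV f" and bdd: "\<And>x. norm (f x) \<le> B"
    and F: "integrable lborel (fourier f)"
  shows "complex_of_real ((2 * pi) ^ CARD('n)) * f x = (LINT \<xi>|lborel. iexp (x \<bullet> \<xi>) * fourier f \<xi>)"
proof -
  define \<kappa> where "\<kappa> = sqrt (2 * pi) ^ CARD('n)"
  have [measurable]: "f \<in> borel_measurable borel" "fourier f \<in> borel_measurable borel"
    using f F by auto
  have gauss_int: "integrable lborel (\<lambda>\<xi>::real^'n. complex_of_real (gauss (t *\<^sub>R \<xi>)))" if "0 < t" for t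
    using integrable_lborel_affine[OF integrable_gauss, of t 0] that by (intro integrable_of_real) auto
  have key: "(LINT \<xi>|lborel. iexp (x \<bullet> \<xi>) * fourier f \<xi> * complex_of_real (gauss (t *\<^sub>R \<xi>))) =
      complex_of_real \<kappa> * (LINT w|lborel. f (x + t *\<^sub>R w) * complex_of_real (gauss w))"
    if t: "0 < t" for t
  proof -
    have "(LINT \<xi>|lborel. iexp (x \<bullet> \<xi>) * fourier f \<xi> * complex_of_real (gauss (t *\<^sub>R \<xi>))) =
      (LINT \<xi>|lborel. LINT y|lborel. iexp (\<xi> \<bullet> (x - y)) * complex_of_real (gauss (t *\<^sub>R \<xi>)) * f y)"
    proof (intro Bochner_Integration.integral_cong refl)
      fix \<xi> :: "real^'n"
      have "iexp (x \<bullet> \<xi>) * fourier f \<xi> * complex_of_real (gauss (t *\<^sub>R \<xi>)) =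
        (LINT y|lborel. (iexp (x \<bullet> \<xi>) * complex_of_real (gauss (t *\<^sub>R \<xi>))) * (exp (- (\<i> * of_real (y \<bullet> \<xi>))) * f y))"
        unfolding fourier_def by (subst integral_mult_right_zero) (simp only: mult_ac)
      also have "\<dots> = (LINT y|lborel. iexp (\<xi> \<bullet> (x - y)) * complex_of_real (gauss (t *\<^sub>R \<xi>)) * f y)"
        by (intro Bochner_Integration.integral_cong)
           (auto simp: inner_diff_right inner_commute exp_diff exp_minus algebra_simps divide_inverse)
      finally show "iexp (x \<bullet> \<xi>) * fourier f \<xi> * complex_of_real (gauss (t *\<^sub>R \<xi>)) = \<dots>" .
    qed
    also have "\<dots> = (LINT y|lborel. LINT \<xi>|lborel. iexp (\<xi> \<bullet> (x - y)) * complex_of_real (gauss (t *\<^sub>R \<xi>)) * f y)"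
    \<comment> \<open>Integrability in \<open>\<xi>\<close> comes from the Gaussian factor,
      integrability in \<open>y\<close> from \<open>f\<close>.\<close>
    proof (rule lborel_pair.Fubini_integral)
      show "integrable (lborel \<Otimes>\<^sub>M lborel)
        (\<lambda>(y, \<xi>). iexp (\<xi> \<bullet> (x - y)) * complex_of_real (gauss (t *\<^sub>R \<xi>)) * f y)"
        by (rule Bochner_Integration.integrable_bound[OF integrable_lborel_prod_mult[OF f gauss_int[OF t]]])
           (auto simp: norm_mult mult_ac)
    qed
    also have "\<dots> = (LINT y|lborel. complex_of_real (\<kappa> / t ^ CARD('n) * gauss ((x - y) /\<^sub>R t)) * f y)"
      by (simp add: integral_gauss_scaled[OF t] \<kappa>_def)
    also have "\<dots> = t ^ CARD('n) *\<^sub>R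
        (LINT w|lborel. complex_of_real (\<kappa> / t ^ CARD('n) * gauss w) * f (x + t *\<^sub>R w))"
      using t by (subst integral_lborel_affine[where c=t and t=x]) (auto simp: gauss_bounds)
    also have "\<dots> = (LINT w|lborel. t ^ CARD('n) *\<^sub>R
        (complex_of_real (\<kappa> / t ^ CARD('n) * gauss w) * f (x + t *\<^sub>R w)))"
      by simp
    also have "\<dots> = (LINT w|lborel. complex_of_real \<kappa> * (f (x + t *\<^sub>R w) * complex_of_real (gauss w)))"
      using t by (intro Bochner_Integration.integral_cong) (auto simp: scaleR_conv_of_real)
    finally show ?thesis by simp
  qed
  define T where "T m = inverse (real (Suc m))" for m
  have T: "T \<longlonglongrightarrow> 0" "\<And>m. 0 < T m"
    unfolding T_def using LIMSEQ_inverse_real_of_nat by auto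
  have contg: "isCont gauss (0::real^'n)" unfolding gauss_def by (intro continuous_intros) auto
  have "(\<lambda>m. LINT \<xi>|lborel. iexp (x \<bullet> \<xi>) * fourier f \<xi> * complex_of_real (gauss (T m *\<^sub>R \<xi>)))
     \<longlonglongrightarrow> (LINT \<xi>|lborel. iexp (x \<bullet> \<xi>) * fourier f \<xi>)"
  proof (rule integral_dominated_convergence[where w="\<lambda>\<xi>. norm (fourier f \<xi>)"])
    show "AE \<xi> in lborel. (\<lambda>m. iexp (x \<bullet> \<xi>) * fourier f \<xi> * complex_of_real (gauss (T m *\<^sub>R \<xi>)))
      \<longlonglongrightarrow> iexp (x \<bullet> \<xi>) * fourier f \<xi>"
    proof (rule AE_I2)
      fix \<xi> :: "real^'n"
      have "(\<lambda>m. T m *\<^sub>R \<xi>) \<longlonglongrightarrow> 0 *\<^sub>R \<xi>" by (intro tendsto_intros T)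
      then have "(\<lambda>m. gauss (T m *\<^sub>R \<xi>)) \<longlonglongrightarrow> gauss (0::real^'n)"
        using contg by (intro isCont_tendsto_compose[of 0 gauss]) auto
      then have "(\<lambda>m. iexp (x \<bullet> \<xi>) * fourier f \<xi> * complex_of_real (gauss (T m *\<^sub>R \<xi>)))
        \<longlonglongrightarrow> iexp (x \<bullet> \<xi>) * fourier f \<xi> * complex_of_real (gauss (0::real^'n))"
        by (intro tendsto_intros)
      then show "(\<lambda>m. iexp (x \<bullet> \<xi>) * fourier f \<xi> * complex_of_real (gauss (T m *\<^sub>R \<xi>)))
        \<longlonglongrightarrow> iexp (x \<bullet> \<xi>) * fourier f \<xi>" by (simp add: gauss_bounds)
    qed
    show "AE \<xi> in lborel. norm (iexp (x \<bullet> \<xi>) * fourier f \<xi> * complex_of_real (gauss (T m *\<^sub>R \<xi>)))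
      \<le> norm (fourier f \<xi>)" for m
      by (intro AE_I2) (auto simp: norm_mult gauss_bounds intro!: mult_right_le_one_le)
  qed (use F in auto)
  moreover have "(\<lambda>m. complex_of_real \<kappa> * (LINT w|lborel. f (x + T m *\<^sub>R w) * complex_of_real (gauss w)))
     \<longlonglongrightarrow> complex_of_real \<kappa> * (LINT w|lborel. f x * complex_of_real (gauss (w::real^'n)))"
  proof (intro tendsto_mult tendsto_const integral_dominated_convergence[where w="\<lambda>w. B * gauss w"])
    show "AE w in lborel. (\<lambda>m. f (x + T m *\<^sub>R w) * complex_of_real (gauss w)) \<longlonglongrightarrow> f x * complex_of_real (gauss w)"
    proof (rule AE_I2)
      fix w :: "real^'n"
      have "(\<lambda>m. x + T m *\<^sub>R w) \<longlonglongrightarrow> x + 0 *\<^sub>R w" by (intro tendsto_intros T)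
      then have "(\<lambda>m. f (x + T m *\<^sub>R w)) \<longlonglongrightarrow> f x"
        using cont by (intro isCont_tendsto_compose[of x f]) (auto simp: continuous_on_eq_continuous_at)
      then show "(\<lambda>m. f (x + T m *\<^sub>R w) * complex_of_real (gauss w)) \<longlonglongrightarrow> f x * complex_of_real (gauss w)"
        by (intro tendsto_intros)
    qed
    show "AE w in lborel. norm (f (x + T m *\<^sub>R w) * complex_of_real (gauss w)) \<le> B * gauss w" for m
      by (intro AE_I2) (auto simp: norm_mult gauss_bounds bdd intro!: mult_right_mono)
  qed (use integrable_gauss in auto)
  ultimately have "(LINT \<xi>|lborel. iexp (x \<bullet> \<xi>) * fourier f \<xi>) =
      complex_of_real \<kappa> * (LINT w|lborel. f x * complex_of_real (gauss (w::real^'n)))"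
    unfolding key[OF T(2)] by (rule LIMSEQ_unique)
  also have "(LINT w|lborel. f x * complex_of_real (gauss (w::real^'n))) = f x * complex_of_real \<kappa>"
    using integral_fourier_gauss[of "0::real^'n"] by (simp add: gauss_bounds \<kappa>_def)
  also have "complex_of_real \<kappa> * (f x * complex_of_real \<kappa>) = complex_of_real (\<kappa> * \<kappa>) * f x" by simp
  \<comment> \<open>One factor \<open>\<kappa>\<close> is the constant in the transform of the
    Gaussian, the other its total mass.\<close>
  also have "\<kappa> * \<kappa> = (2 * pi) ^ CARD('n)"
    unfolding \<kappa>_def by (subst power_mult_distrib[symmetric]) simp
  finally show ?thesis by simp
qed

subsection \<open>Schwartz functions\<close>

text \<open>Derivatives are approached along a sequence of difference quotients, so that dominated
  convergence applies under the integral sign and two expressions for a derivative can be identified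
  by uniqueness of limits.\<close>

lemma directional_difference_quotient:
  fixes g :: "'a::real_normed_vector \<Rightarrow> 'b::real_normed_vector"
  assumes g: "(g has_derivative g') (at x)"
  shows "(\<lambda>k. real (Suc k) *\<^sub>R (g (x + (1 / real (Suc k)) *\<^sub>R v) - g x)) \<longlonglongrightarrow> g' v"
proof (cases "v = 0")
  case True
  then show ?thesis using g by (simp add: has_derivative_def bounded_linear.linear linear_0)
next
  case False
  interpret bounded_linear g' using g by (rule has_derivative_bounded_linear)
  have T: "(\<lambda>k. 1 / real (Suc k)) \<longlonglongrightarrow> 0"
    using LIMSEQ_inverse_real_of_nat by (simp add: divide_inverse)
  have "((\<lambda>y. norm ((g y - g x) - g' (y - x)) / norm (y - x)) \<longlongrightarrow> 0) (at x)"
    using g by (simp add: has_derivative_iff_norm)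
  moreover have "filterlim (\<lambda>k. x + (1 / real (Suc k)) *\<^sub>R v) (at x) sequentially"
  proof (rule filterlim_atI)
    have "(\<lambda>k. x + (1 / real (Suc k)) *\<^sub>R v) \<longlonglongrightarrow> x + 0 *\<^sub>R v"
      by (intro tendsto_intros T)
    then show "(\<lambda>k. x + (1 / real (Suc k)) *\<^sub>R v) \<longlonglongrightarrow> x" by simp
  qed (use False in auto)
  ultimately have "(\<lambda>k. norm ((g (x + (1 / real (Suc k)) *\<^sub>R v) - g x)
      - g' ((1 / real (Suc k)) *\<^sub>R v)) / norm ((1 / real (Suc k)) *\<^sub>R v)) \<longlonglongrightarrow> 0"
    by (auto dest: filterlim_compose)
  from tendsto_mult[OF this tendsto_const[of "norm v"]]
  have "(\<lambda>k. norm ((g (x + (1 / real (Suc k)) *\<^sub>R v) - g x)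
      - g' ((1 / real (Suc k)) *\<^sub>R v)) / norm ((1 / real (Suc k)) *\<^sub>R v) * norm v) \<longlonglongrightarrow> 0" by simp
  moreover have "norm ((g (x + (1 / real (Suc k)) *\<^sub>R v) - g x)
      - g' ((1 / real (Suc k)) *\<^sub>R v)) / norm ((1 / real (Suc k)) *\<^sub>R v) * norm v
    = norm (real (Suc k) *\<^sub>R (g (x + (1 / real (Suc k)) *\<^sub>R v) - g x) - g' v)" for k
  proof -
    have "real (Suc k) *\<^sub>R (g (x + (1 / real (Suc k)) *\<^sub>R v) - g x) - g' v
      = real (Suc k) *\<^sub>R ((g (x + (1 / real (Suc k)) *\<^sub>R v) - g x) - g' ((1 / real (Suc k)) *\<^sub>R v))"
      by (simp add: scaleR scaleR_diff_right del: of_nat_Suc)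
    then show ?thesis using False by (simp del: of_nat_Suc)
  qed
  ultimately show ?thesis
    by (simp only: tendsto_norm_zero_iff Lim_null[of _ "g' v"])
qed

section \<open>Iterated partial derivatives under linear combinations and affine
  substitutions\<close>

lemma smooth_has_derivative:
  assumes "smooth g"
  shows "(partial_derivs is g has_derivative frechet_derivative (partial_derivs is g) (at x)) (at x)"
  using assms unfolding smooth_def differentiable_on_def
  by (simp add: frechet_derivative_works)

lemma partial_deriv_eqI:
  assumes "(g has_derivative g') (at x)"
  shows "partial_deriv i g x = g' (axis i 1)"
  using frechet_derivative_at[OF assms] by (simp add: partial_deriv_def)

lemma partial_deriv_apply: "partial_deriv i g x = frechet_derivative g (at x) (axis i 1)"
  by (simp add: partial_deriv_def)

lemma partial_derivs_Cons: "partial_derivs (i # is) g = partial_deriv i (partial_derivs is g)"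
  by simp

lemma partial_derivs_lincomb:
  assumes g: "smooth g" and h: "smooth h"
  shows "partial_derivs is (\<lambda>y. a * g y + b * h y) =
    (\<lambda>y. a * partial_derivs is g y + b * partial_derivs is h y)"
proof (induction "is")
  case (Cons i "is")
  show ?case
  proof
    fix x
    have "((\<lambda>y. a * partial_derivs is g y + b * partial_derivs is h y) has_derivative
      (\<lambda>v. a * frechet_derivative (partial_derivs is g) (at x) v
         + b * frechet_derivative (partial_derivs is h) (at x) v)) (at x)"
      by (intro derivative_intros smooth_has_derivative g h)
    from partial_deriv_eqI[OF this, of i, folded partial_deriv_apply]
    show "partial_derivs (i # is) (\<lambda>y. a * g y + b * h y) x =
      a * partial_derivs (i # is) g x + b * partial_derivs (i # is) h x"
      by (simp only: partial_derivs_Cons Cons.IH)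
  qed
qed simp

lemma smooth_lincomb:
  assumes g: "smooth g" and h: "smooth h"
  shows "smooth (\<lambda>y. a * g y + b * h y)"
  unfolding smooth_def partial_derivs_lincomb[OF assms]
  using g h unfolding smooth_def by (auto intro!: derivative_intros)

text \<open>The substitution has the form z - c y because a dilated convolution kernel, evaluated at
  x - y, is \<open>\<phi>\<close> at this point with z = 2^j x and c = 2^j; each differentiation in
  y contributes a factor -c.\<close>

lemma partial_derivs_affine:
  assumes g: "smooth g"
  shows "partial_derivs is (\<lambda>y. g (z - c *\<^sub>R y)) =
    (\<lambda>y. of_real ((- c) ^ length is) * partial_derivs is g (z - c *\<^sub>R y))"
proof (induction "is")
  case (Cons i "is")
  show ?case
  proof
    fix x
    let ?D = "frechet_derivative (partial_derivs is g) (at (z - c *\<^sub>R x))"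
    have "((\<lambda>y. z - c *\<^sub>R y) has_derivative (\<lambda>v. - (c *\<^sub>R v))) (at x)"
      by (auto intro!: derivative_eq_intros)
    from has_derivative_compose[OF this smooth_has_derivative[OF g]]
    have "((\<lambda>y. of_real ((- c) ^ length is) * partial_derivs is g (z - c *\<^sub>R y)) has_derivative
      (\<lambda>v. of_real ((- c) ^ length is) * ?D (- (c *\<^sub>R v)))) (at x)"
      by (intro derivative_intros)
    from partial_deriv_eqI[OF this, of i]
    have "partial_derivs (i # is) (\<lambda>y. g (z - c *\<^sub>R y)) x =
      of_real ((- c) ^ length is) * ?D (- (c *\<^sub>R axis i 1))"
      by (simp only: partial_derivs_Cons Cons.IH)
    also have "- (c *\<^sub>R axis i 1) = (- c) *\<^sub>R axis i (1::real)" by simp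
    also have "?D ((- c) *\<^sub>R axis i 1) = (- c) *\<^sub>R ?D (axis i 1)"
      by (rule linear_scale[OF bounded_linear.linear[OF
            has_derivative_bounded_linear[OF smooth_has_derivative[OF g]]]])
    also have "?D (axis i 1) = partial_derivs (i # is) g (z - c *\<^sub>R x)"
      by (simp only: partial_derivs_Cons partial_deriv_apply[symmetric])
    finally show "partial_derivs (i # is) (\<lambda>y. g (z - c *\<^sub>R y)) x =
      of_real ((- c) ^ length (i # is)) * partial_derivs (i # is) g (z - c *\<^sub>R x)"
      by (simp only: scaleR_conv_of_real of_real_mult of_real_minus of_real_power length_Cons
          power_Suc mult_ac)
  qed
qed simp

lemma smooth_affine:
  assumes g: "smooth g"
  shows "smooth (\<lambda>y. g (z - c *\<^sub>R y))"
proof -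
  have "(\<lambda>y. partial_derivs is g (z - c *\<^sub>R y)) differentiable_on UNIV" for "is"
  proof -
    have "(\<lambda>y. partial_derivs is g (z - c *\<^sub>R y)) differentiable (at x)" for x
    proof -
      have "((\<lambda>y. z - c *\<^sub>R y) has_derivative (\<lambda>v. - (c *\<^sub>R v))) (at x)"
        by (auto intro!: derivative_eq_intros)
      from has_derivative_compose[OF this smooth_has_derivative[OF g]]
      show ?thesis unfolding differentiable_def by blast
    qed
    then show ?thesis by (simp add: differentiable_on_def)
  qed
  then show ?thesis
    unfolding smooth_def partial_derivs_affine[OF g] by (auto intro!: derivative_intros)
qed

lemma smooth_continuous: "smooth g \<Longrightarrow> continuous_on UNIV (partial_derivs is g)"
  unfolding smooth_def by (auto intro: differentiable_imp_continuous_on)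

lemma abs_monomial_le: "\<bar>monomial \<gamma> x\<bar> \<le> norm x ^ sum \<gamma> UNIV"
proof -
  have "\<bar>monomial \<gamma> x\<bar> = (\<Prod>i\<in>UNIV. \<bar>x $ i\<bar> ^ \<gamma> i)"
    by (simp add: monomial_def abs_prod power_abs)
  also have "\<dots> \<le> (\<Prod>i\<in>UNIV. norm x ^ \<gamma> i)"
    by (intro prod_mono) (auto intro: power_mono component_le_norm_cart)
  finally show ?thesis by (simp add: power_sum)
qed

lemma monomial_measurable [measurable]: "monomial \<gamma> \<in> borel_measurable borel"
  unfolding monomial_def by measurable

text \<open>Of all monomials only the constant and the pure powers of one coordinate are used: if
  x_i has the largest modulus among the n coordinates, then 1 + |x| \<le> 2 n max(1, |x_i|).\<close>

lemma schwartz_decay: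
  fixes f :: "real^'n::finite \<Rightarrow> complex"
  assumes f: "f \<in> schwartz"
  obtains K where "0 \<le> K" "\<And>x. (1 + norm x) ^ N * norm (partial_derivs is f x) \<le> K"
proof -
  define n where "n = real CARD('n)"
  have n: "n \<ge> 1" unfolding n_def by (simp add: Suc_leI)
  have "\<exists>K. \<forall>x. \<bar>monomial \<gamma> x\<bar> * norm (partial_derivs is f x) \<le> K" for \<gamma>
    using f by (auto simp: schwartz_def bounded_iff)
  then obtain B where B: "\<And>\<gamma> x. \<bar>monomial \<gamma> x\<bar> * norm (partial_derivs is f x) \<le> B \<gamma>"
    by metis
  have B0: "norm (partial_derivs is f x) \<le> B (\<lambda>_. 0)" for x
    using B[where \<gamma> = "\<lambda>_. 0" and x = x] by (simp add: monomial_def)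
  have Bi: "\<bar>x $ i\<bar> ^ N * norm (partial_derivs is f x) \<le> B (\<lambda>j. if j = i then N else 0)" for x i
  proof -
    have "monomial (\<lambda>j. if j = i then N else 0) x = (\<Prod>j\<in>UNIV. if j = i then (x $ i) ^ N else 1)"
      unfolding monomial_def by (intro prod.cong) auto
    then have "monomial (\<lambda>j. if j = i then N else 0) x = (x $ i) ^ N" by (simp add: prod.delta)
    then show ?thesis using B[where \<gamma>="\<lambda>j. if j = i then N else 0" and x=x] by (simp add: power_abs)
  qed
  \<comment> \<open>The sum over i is needed because the largest coordinate varies with x.\<close>
  define K where "K = (2 * n) ^ N * (B (\<lambda>_. 0) + (\<Sum>i\<in>UNIV. B (\<lambda>j. if j = i then N else 0)))"
  have nonneg: "0 \<le> B (\<lambda>_. 0)" "0 \<le> B (\<lambda>j. if j = i then N else 0)" for i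
    using B0[of 0] Bi[of 0 i] by (auto intro: order_trans[rotated])
  have "(1 + norm x) ^ N * norm (partial_derivs is f x) \<le> K" for x
  proof -
    obtain i where i: "\<And>j. \<bar>x $ j\<bar> \<le> \<bar>x $ i\<bar>"
    proof -
      have "Max (range (\<lambda>j. \<bar>x $ j\<bar>)) \<in> range (\<lambda>j. \<bar>x $ j\<bar>)" by (intro Max_in) auto
      then obtain i where "Max (range (\<lambda>j. \<bar>x $ j\<bar>)) = \<bar>x $ i\<bar>" by (rule imageE)
      then show thesis using that by (metis Max_ge finite finite_imageI rangeI)
    qed
    have "norm x \<le> (\<Sum>j\<in>UNIV. \<bar>x $ j\<bar>)" by (rule norm_le_l1_cart)
    also have "\<dots> \<le> n * \<bar>x $ i\<bar>" using sum_bounded_above[of UNIV "\<lambda>j. \<bar>x $ j\<bar>" "\<bar>x $ i\<bar>"] i by (simp add: n_def)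
    finally have nx: "norm x \<le> n * \<bar>x $ i\<bar>" .
    have "1 + norm x \<le> (2 * n) * max 1 \<bar>x $ i\<bar>"
    proof -
      have "1 * 1 \<le> n * max 1 \<bar>x $ i\<bar>" using n by (intro mult_mono) auto
      moreover have "n * \<bar>x $ i\<bar> \<le> n * max 1 \<bar>x $ i\<bar>" using n by (intro mult_left_mono) auto
      ultimately show ?thesis using nx by linarith
    qed
    then have "(1 + norm x) ^ N \<le> ((2 * n) * max 1 \<bar>x $ i\<bar>) ^ N"
      by (intro power_mono) auto
    also have "\<dots> = (2 * n) ^ N * (max 1 \<bar>x $ i\<bar>) ^ N" by (simp add: power_mult_distrib)
    also have "(max 1 \<bar>x $ i\<bar>) ^ N \<le> 1 + \<bar>x $ i\<bar> ^ N" by (auto simp: max_def)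
    finally have "(1 + norm x) ^ N \<le> (2 * n) ^ N * (1 + \<bar>x $ i\<bar> ^ N)"
      using n by (simp add: mult_left_mono)
    then have "(1 + norm x) ^ N * norm (partial_derivs is f x)
        \<le> (2 * n) ^ N * (1 + \<bar>x $ i\<bar> ^ N) * norm (partial_derivs is f x)"
      by (intro mult_right_mono) auto
    also have "\<dots> = (2 * n) ^ N * (norm (partial_derivs is f x) + \<bar>x $ i\<bar> ^ N * norm (partial_derivs is f x))"
      by (simp add: algebra_simps)
    also have "\<dots> \<le> (2 * n) ^ N * (B (\<lambda>_. 0) + B (\<lambda>j. if j = i then N else 0))"
      using n by (intro mult_left_mono add_mono B0 Bi) auto
    also have "\<dots> \<le> K"
      unfolding K_def using n nonneg
      by (intro mult_left_mono add_left_mono member_le_sum) auto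
    finally show ?thesis .
  qed
  moreover have "0 \<le> K" unfolding K_def using n nonneg by (intro mult_nonneg_nonneg add_nonneg_nonneg sum_nonneg) auto
  ultimately show thesis using that by blast
qed

lemma schwartzI_decay:
  assumes "smooth f"
    and "\<And>is N. \<exists>K. \<forall>x. (1 + norm x) ^ N * norm (partial_derivs is f x) \<le> K"
  shows "f \<in> schwartz"
  unfolding schwartz_def
proof (intro CollectI conjI allI assms(1))
  fix \<gamma> :: "'a \<Rightarrow> nat" and "is" :: "'a list"
  obtain K where K: "\<And>x. (1 + norm x) ^ sum \<gamma> UNIV * norm (partial_derivs is f x) \<le> K"
    using assms(2) by blast
  have "norm (monomial \<gamma> x *\<^sub>R partial_derivs is f x) \<le> K" for x
  proof -
    have "\<bar>monomial \<gamma> x\<bar> \<le> (1 + norm x) ^ sum \<gamma> UNIV"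
      by (rule order_trans[OF abs_monomial_le]) (auto intro: power_mono)
    then have "norm (monomial \<gamma> x *\<^sub>R partial_derivs is f x)
      \<le> (1 + norm x) ^ sum \<gamma> UNIV * norm (partial_derivs is f x)"
      by (simp add: mult_right_mono)
    then show ?thesis using K[of x] by linarith
  qed
  then show "bounded (range (\<lambda>x. monomial \<gamma> x *\<^sub>R partial_derivs is f x))"
    by (auto simp: bounded_iff)
qed

text \<open>With w = z - c y one has 1 + |y| \<le> (1 + 1/c) (1 + |z|) (1 + |w|). What matters is
  the explicit dependence on z: decay of order N in y costs the factor (1 + |z|)^N and nothing
  else.\<close>

lemma affine_decay:
  fixes f :: "real^'n::finite \<Rightarrow> complex"
  assumes f: "f \<in> schwartz" and c: "0 < c"
  obtains K where "0 \<le> K" "\<And>z y. (1 + norm y) ^ N * norm (partial_derivs is f (z - c *\<^sub>R y)) \<le> K * (1 + norm z) ^ N"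
proof -
  obtain K where K: "0 \<le> K" "\<And>x. (1 + norm x) ^ N * norm (partial_derivs is f x) \<le> K"
    using schwartz_decay[OF f] by metis
  show thesis
  proof (rule that[of "(1 + 1 / c) ^ N * K"])
    fix z y :: "real^'n"
    define w where "w = z - c *\<^sub>R y"
    have "c * norm y = norm (z - w)" using c by (simp add: w_def)
    also have "\<dots> \<le> norm z + norm w" by (rule norm_triangle_ineq4)
    finally have "norm y \<le> (1 / c) * (norm z + norm w)" using c by (simp add: field_simps)
    then have "1 + norm y \<le> 1 + (1 / c) * (norm z + norm w)" by simp
    also have "\<dots> \<le> (1 + 1 / c) * ((1 + norm z) * (1 + norm w))"
    proof -
      have "1 \<le> (1 + norm z) * (1 + norm w)" "norm z + norm w \<le> (1 + norm z) * (1 + norm w)"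
        by (simp_all add: algebra_simps)
      moreover from this have "(1 / c) * (norm z + norm w) \<le> (1 / c) * ((1 + norm z) * (1 + norm w))"
        using c by (intro mult_left_mono) auto
      ultimately show ?thesis unfolding ring_distribs(2)[of 1 "1/c"] by linarith
    qed
    finally have "(1 + norm y) ^ N \<le> ((1 + 1 / c) * ((1 + norm z) * (1 + norm w))) ^ N"
      by (intro power_mono) auto
    then have "(1 + norm y) ^ N * norm (partial_derivs is f w) \<le>
      ((1 + 1 / c) * ((1 + norm z) * (1 + norm w))) ^ N * norm (partial_derivs is f w)"
      by (intro mult_right_mono) auto
    also have "\<dots> = (1 + 1 / c) ^ N * (1 + norm z) ^ N * ((1 + norm w) ^ N * norm (partial_derivs is f w))"
      by (simp add: power_mult_distrib mult_ac)
    also have "\<dots> \<le> (1 + 1 / c) ^ N * (1 + norm z) ^ N * K"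
      using c K by (intro mult_left_mono) auto
    finally show "(1 + norm y) ^ N * norm (partial_derivs is f (z - c *\<^sub>R y)) \<le> (1 + 1 / c) ^ N * K * (1 + norm z) ^ N"
      by (simp add: w_def mult_ac)
  qed (use K c in auto)
qed

lemma schwartz_affine:
  fixes f :: "real^'n::finite \<Rightarrow> complex"
  assumes f: "f \<in> schwartz" and c: "0 < c"
  shows "(\<lambda>y. f (z - c *\<^sub>R y)) \<in> schwartz"
proof (rule schwartzI_decay)
  have sm: "smooth f" using f by (simp add: schwartz_def)
  show "smooth (\<lambda>y. f (z - c *\<^sub>R y))" using sm by (rule smooth_affine)
  fix "is" :: "'n list" and N
  obtain K where K: "0 \<le> K" "\<And>y. (1 + norm y) ^ N * norm (partial_derivs is f (z - c *\<^sub>R y)) \<le> K * (1 + norm z) ^ N"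
    using affine_decay[OF f c] by metis
  show "\<exists>K. \<forall>y. (1 + norm y) ^ N * norm (partial_derivs is (\<lambda>y. f (z - c *\<^sub>R y)) y) \<le> K"
  proof (intro exI allI)
    fix y
    have "(1 + norm y) ^ N * norm (partial_derivs is (\<lambda>y. f (z - c *\<^sub>R y)) y)
      = c ^ length is * ((1 + norm y) ^ N * norm (partial_derivs is f (z - c *\<^sub>R y)))"
      unfolding partial_derivs_affine[OF sm] using c by (simp add: norm_mult norm_power)
    also have "\<dots> \<le> c ^ length is * (K * (1 + norm z) ^ N)"
      using c K by (intro mult_left_mono) auto
    finally show "(1 + norm y) ^ N * norm (partial_derivs is (\<lambda>y. f (z - c *\<^sub>R y)) y)
      \<le> c ^ length is * (K * (1 + norm z) ^ N)" .
  qed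
qed

lemma schwartz_lincomb:
  fixes f g :: "real^'n::finite \<Rightarrow> complex"
  assumes f: "f \<in> schwartz" and g: "g \<in> schwartz"
  shows "(\<lambda>y. a * f y + b * g y) \<in> schwartz"
proof (rule schwartzI_decay)
  have sm: "smooth f" "smooth g" using f g by (auto simp: schwartz_def)
  then show "smooth (\<lambda>y. a * f y + b * g y)" by (rule smooth_lincomb)
  fix "is" :: "'n list" and N
  obtain K where K: "0 \<le> K" "\<And>y. (1 + norm y) ^ N * norm (partial_derivs is f y) \<le> K"
    using schwartz_decay[OF f] by metis
  obtain L where L: "0 \<le> L" "\<And>y. (1 + norm y) ^ N * norm (partial_derivs is g y) \<le> L"
    using schwartz_decay[OF g] by metis
  show "\<exists>K. \<forall>y. (1 + norm y) ^ N * norm (partial_derivs is (\<lambda>y. a * f y + b * g y) y) \<le> K"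
  proof (intro exI allI)
    fix y
    have "(1 + norm y) ^ N * norm (a * partial_derivs is f y + b * partial_derivs is g y)
      \<le> (1 + norm y) ^ N * (norm a * norm (partial_derivs is f y) + norm b * norm (partial_derivs is g y))"
      by (intro mult_left_mono norm_triangle_le) (auto simp: norm_mult)
    also have "\<dots> = norm a * ((1 + norm y) ^ N * norm (partial_derivs is f y))
      + norm b * ((1 + norm y) ^ N * norm (partial_derivs is g y))"
      by (simp add: algebra_simps)
    also have "\<dots> \<le> norm a * K + norm b * L"
      by (intro add_mono mult_left_mono K L) auto
    finally show "(1 + norm y) ^ N * norm (partial_derivs is (\<lambda>y. a * f y + b * g y) y)
      \<le> norm a * K + norm b * L"
      unfolding partial_derivs_lincomb[OF sm] .
  qed
qed

lemma integrable_inverse_1_plus_square_real: "integrable lborel (\<lambda>t::real. inverse (1 + t\<^sup>2))"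
  using integrable_inverse_1_plus_square by (simp add: set_integrable_def)

text \<open>The majorant is a product over the coordinates of the integrable functions 1 / (1 +
  t^2). Each of the n denominators is at most (1 + |x|)^2, whence the exponent 2 n.\<close>

lemma integrable_decay:
  fixes f :: "real^'n::finite \<Rightarrow> complex"
  assumes [measurable]: "f \<in> borel_measurable borel"
    and K: "\<And>x. (1 + norm x) ^ (2 * CARD('n)) * norm (f x) \<le> K"
  shows "integrable lborel f"
proof -
  have i: "integrable lborel (\<lambda>x::real^'n. K * (\<Prod>b\<in>Basis. inverse (1 + (x \<bullet> b)\<^sup>2)))"
    by (intro integrable_mult_right integrable_lborel_prod integrable_inverse_1_plus_square_real)
  show ?thesis
  proof (rule Bochner_Integration.integrable_bound[OF i])
    show "AE x in lborel. norm (f x) \<le> norm (K * (\<Prod>b\<in>Basis. inverse (1 + (x \<bullet> b)\<^sup>2)))"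
    proof (rule AE_I2)
      fix x :: "real^'n"
      define P where "P = (\<Prod>b\<in>(Basis::(real^'n) set). 1 + (x \<bullet> b)\<^sup>2)"
      have P: "0 < P" unfolding P_def by (intro prod_pos) (auto intro: add_pos_nonneg)
      have "P \<le> (\<Prod>b\<in>(Basis::(real^'n) set). (1 + norm x)\<^sup>2)"
        unfolding P_def
      proof (intro prod_mono conjI)
        fix b :: "real^'n" assume b: "b \<in> Basis"
        have "(x \<bullet> b)\<^sup>2 \<le> (norm x)\<^sup>2"
          using Basis_le_norm[OF b, of x] abs_le_square_iff[of "x \<bullet> b" "norm x"] by simp
        then have "(x \<bullet> b)\<^sup>2 \<le> (norm x)\<^sup>2 + 2 * norm x"
          using norm_ge_zero[of x] by linarith
        then show "1 + (x \<bullet> b)\<^sup>2 \<le> (1 + norm x)\<^sup>2" by (simp add: power2_sum)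
      qed auto
      also have "\<dots> = (1 + norm x) ^ (2 * CARD('n))" by (simp add: power_mult)
      finally have "P * norm (f x) \<le> (1 + norm x) ^ (2 * CARD('n)) * norm (f x)"
        by (intro mult_right_mono) auto
      also have "\<dots> \<le> K" by (rule K)
      finally have "norm (f x) \<le> K * inverse P" using P by (simp add: field_simps)
      also have "\<dots> \<le> norm (K * (\<Prod>b\<in>Basis. inverse (1 + (x \<bullet> b)\<^sup>2)))"
        using prod_inversef[of "\<lambda>b. 1 + (x \<bullet> b)\<^sup>2" "Basis :: (real^'n) set"]
        by (simp add: P_def o_def)
      finally show "norm (f x) \<le> norm (K * (\<Prod>b\<in>Basis. inverse (1 + (x \<bullet> b)\<^sup>2)))" .
    qed
  qed simp
qed

lemma schwartz_measurable: "f \<in> schwartz \<Longrightarrow> f \<in> borel_measurable borel"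
  using smooth_continuous[of f "[]"] by (auto simp: schwartz_def intro: borel_measurable_continuous_onI)

lemma schwartz_monomial_integrable:
  fixes f :: "real^'n::finite \<Rightarrow> complex"
  assumes f: "f \<in> schwartz"
  shows "integrable lborel (\<lambda>x. f x * of_real (monomial \<gamma> x))"
proof -
  have [measurable]: "f \<in> borel_measurable borel" using f by (rule schwartz_measurable)
  define N where "N = 2 * CARD('n) + sum \<gamma> UNIV"
  obtain K where K: "0 \<le> K" "\<And>y. (1 + norm y) ^ N * norm (partial_derivs [] f y) \<le> K"
    using schwartz_decay[OF f] by metis
  show ?thesis
  proof (rule integrable_decay)
    fix x :: "real^'n"
    have "\<bar>monomial \<gamma> x\<bar> \<le> (1 + norm x) ^ sum \<gamma> UNIV"
      by (rule order_trans[OF abs_monomial_le]) (auto intro: power_mono)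
    then have "(1 + norm x) ^ (2 * CARD('n)) * (norm (f x) * \<bar>monomial \<gamma> x\<bar>)
      \<le> (1 + norm x) ^ (2 * CARD('n)) * (norm (f x) * (1 + norm x) ^ sum \<gamma> UNIV)"
      by (intro mult_left_mono) auto
    also have "\<dots> = (1 + norm x) ^ N * norm (partial_derivs [] f x)" by (simp add: N_def power_add)
    also have "\<dots> \<le> K" by (rule K)
    finally show "(1 + norm x) ^ (2 * CARD('n)) * norm (f x * of_real (monomial \<gamma> x)) \<le> K"
      by (simp add: norm_mult)
  qed simp
qed

lemma schwartz_integrable: "f \<in> schwartz \<Longrightarrow> integrable lborel f"
  using schwartz_monomial_integrable[of f "\<lambda>_. 0"] by (simp add: monomial_def)

subsection \<open>Vanishing moments and band-limited functions\<close>

text \<open>The inverse Fourier transform without its factor (2 pi)^(-n). At the reflected point it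
  is the Fourier transform itself, so one set of facts serves both directions.\<close>

definition ift :: "(real^'n::finite \<Rightarrow> complex) \<Rightarrow> real^'n \<Rightarrow> complex" where
  "ift m x = (LINT \<xi>|lborel. iexp (x \<bullet> \<xi>) * m \<xi>)"

lemma fourier_eq_ift: "fourier g \<xi> = ift g (- \<xi>)"
  by (simp add: fourier_def ift_def inner_commute)

lemma norm_iexp_minus_1_le: "norm (iexp t - 1) \<le> \<bar>t\<bar>"
  using iexp_approx1[of t 0] by simp

lemma integrable_iexp_mult:
  assumes "integrable lborel m"
  shows "integrable lborel (\<lambda>\<xi>::real^'n::finite. iexp (x \<bullet> \<xi>) * m \<xi>)"
  by (rule Bochner_Integration.integrable_bound[OF assms]) (use assms in \<open>auto simp: norm_mult\<close>)

text \<open>Differentiation under the integral by dominated convergence: since |exp(i t) - 1| \<le>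
  |t|, every difference quotient is dominated by |\<xi>_i m(\<xi>)|.\<close>

lemma ift_difference_quotient:
  fixes m :: "real^'n::finite \<Rightarrow> complex"
  assumes m: "integrable lborel m" and xm: "integrable lborel (\<lambda>\<xi>. of_real (\<xi> $ i) * m \<xi>)"
  shows "(\<lambda>k. real (Suc k) *\<^sub>R (ift m (x + (1 / real (Suc k)) *\<^sub>R axis i 1) - ift m x))
    \<longlonglongrightarrow> ift (\<lambda>\<xi>. \<i> * of_real (\<xi> $ i) * m \<xi>) x"
proof -
  have [measurable]: "m \<in> borel_measurable borel" using m by auto
  define d where "d k \<xi> = real (Suc k) *\<^sub>R (iexp ((1 / real (Suc k)) * (\<xi> $ i)) - 1) * (iexp (x \<bullet> \<xi>) * m \<xi>)"
    for k and \<xi> :: "real^'n"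
  have eq: "real (Suc k) *\<^sub>R (ift m (x + (1 / real (Suc k)) *\<^sub>R axis i 1) - ift m x) = (LINT \<xi>|lborel. d k \<xi>)" for k
  proof -
    have "ift m (x + (1 / real (Suc k)) *\<^sub>R axis i 1) - ift m x =
      (LINT \<xi>|lborel. iexp ((x + (1 / real (Suc k)) *\<^sub>R axis i 1) \<bullet> \<xi>) * m \<xi> - iexp (x \<bullet> \<xi>) * m \<xi>)"
      unfolding ift_def by (intro Bochner_Integration.integral_diff[symmetric] integrable_iexp_mult m)
    also have "\<dots> = (LINT \<xi>|lborel. (iexp ((1 / real (Suc k)) * (\<xi> $ i)) - 1) * (iexp (x \<bullet> \<xi>) * m \<xi>))"
      by (intro Bochner_Integration.integral_cong refl)
         (simp add: inner_add_left inner_axis' exp_add algebra_simps)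
    finally show ?thesis
      by (simp add: d_def scaleR_conv_of_real mult.assoc del: of_nat_Suc)
  qed
  have "(\<lambda>k. LINT \<xi>|lborel. d k \<xi>) \<longlonglongrightarrow> (LINT \<xi>|lborel. iexp (x \<bullet> \<xi>) * (\<i> * of_real (\<xi> $ i) * m \<xi>))"
  proof (rule integral_dominated_convergence[where w="\<lambda>\<xi>. norm (of_real (\<xi> $ i) * m \<xi>)"])
    show "AE \<xi> in lborel. (\<lambda>k. d k \<xi>) \<longlonglongrightarrow> iexp (x \<bullet> \<xi>) * (\<i> * of_real (\<xi> $ i) * m \<xi>)"
    proof (rule AE_I2)
      fix \<xi> :: "real^'n"
      have l: "((\<lambda>t::real. \<i> * of_real (t * (\<xi> $ i))) has_derivative (\<lambda>t. \<i> * of_real (t * (\<xi> $ i)))) (at 0)"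
        by (auto intro!: derivative_eq_intros)
      have e: "(exp has_derivative (*) 1) (at (\<i> * of_real (0 * (\<xi> $ i))))"
        using DERIV_exp[of "0::complex"] by (simp add: has_field_derivative_def)
      have "((\<lambda>t. iexp (t * (\<xi> $ i))) has_derivative (\<lambda>t. 1 * (\<i> * of_real (t * (\<xi> $ i))))) (at 0)"
        by (rule has_derivative_compose[OF l e])
      from directional_difference_quotient[OF this, of 1]
      have "(\<lambda>k. real (Suc k) *\<^sub>R (iexp ((1 / real (Suc k)) * (\<xi> $ i)) - 1)) \<longlonglongrightarrow> \<i> * of_real (\<xi> $ i)"
        by simp
      from tendsto_mult[OF this tendsto_const[of "iexp (x \<bullet> \<xi>) * m \<xi>"]]
      show "(\<lambda>k. d k \<xi>) \<longlonglongrightarrow> iexp (x \<bullet> \<xi>) * (\<i> * of_real (\<xi> $ i) * m \<xi>)"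
        unfolding d_def by (simp add: mult_ac)
    qed
    show "AE \<xi> in lborel. norm (d k \<xi>) \<le> norm (of_real (\<xi> $ i) * m \<xi>)" for k
    proof (rule AE_I2)
      fix \<xi> :: "real^'n"
      have "norm (iexp ((1 / real (Suc k)) * (\<xi> $ i)) - 1) \<le> \<bar>(1 / real (Suc k)) * (\<xi> $ i)\<bar>"
        by (rule norm_iexp_minus_1_le)
      then have "real (Suc k) * norm (iexp ((1 / real (Suc k)) * (\<xi> $ i)) - 1)
          \<le> real (Suc k) * \<bar>(1 / real (Suc k)) * (\<xi> $ i)\<bar>"
        by (rule mult_left_mono) simp
      also have "\<dots> = \<bar>\<xi> $ i\<bar>" by (simp add: abs_mult del: of_nat_Suc)
      finally have "real (Suc k) * norm (iexp ((1 / real (Suc k)) * (\<xi> $ i)) - 1) * norm (m \<xi>)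
          \<le> \<bar>\<xi> $ i\<bar> * norm (m \<xi>)" by (rule mult_right_mono) simp
      then show "norm (d k \<xi>) \<le> norm (of_real (\<xi> $ i) * m \<xi>)"
        unfolding d_def norm_mult norm_scaleR by (simp add: mult_ac del: of_nat_Suc)
    qed
    show "integrable lborel (\<lambda>\<xi>. norm (of_real (\<xi> $ i) * m \<xi>))" by (intro integrable_norm xm)
  qed (unfold d_def, measurable)
  then show ?thesis unfolding eq unfolding ift_def .
qed

text \<open>Moments are derivatives of the transform at 0, up to powers of the imaginary unit. The
  claim covers the whole open ball so that it survives induction on the order: near each of its
  points the transform of lower order is already 0, hence so are its difference quotients and their
  limit.\<close>

lemma moments_vanish_near_0:
  fixes g :: "real^'n::finite \<Rightarrow> complex"
  assumes g: "g \<in> schwartz" and z: "\<And>\<xi>. norm \<xi> < r \<Longrightarrow> fourier g \<xi> = 0"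
  shows "norm x < r \<Longrightarrow> ift (\<lambda>y. g y * of_real (monomial \<gamma> y)) x = 0"
proof (induction "sum \<gamma> UNIV" arbitrary: \<gamma> x)
  case 0
  then have "\<gamma> i = 0" for i by simp
  then show ?case using z[of "- x"] 0 by (simp add: monomial_def fourier_eq_ift)
next
  case (Suc k)
  then obtain i where i: "\<gamma> i > 0" by (metis gr0I sum.neutral nat.distinct(1))
  define \<gamma>' where "\<gamma>' = \<gamma>(i := \<gamma> i - 1)"
  define m where "m = (\<lambda>y. g y * of_real (monomial \<gamma>' y))"
  have mono: "monomial \<gamma> y = y $ i * monomial \<gamma>' y" for y
  proof -
    have "monomial \<gamma> y = (y $ i) ^ \<gamma> i * (\<Prod>j\<in>UNIV - {i}. (y $ j) ^ \<gamma> j)"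
      unfolding monomial_def by (subst prod.remove[of _ i]) auto
    moreover have "monomial \<gamma>' y = (y $ i) ^ (\<gamma> i - 1) * (\<Prod>j\<in>UNIV - {i}. (y $ j) ^ \<gamma> j)"
      unfolding monomial_def \<gamma>'_def by (subst prod.remove[of _ i]) auto
    ultimately show ?thesis using i by (cases "\<gamma> i") auto
  qed
  have "sum \<gamma> UNIV = \<gamma> i + sum \<gamma> (UNIV - {i})" "sum \<gamma>' UNIV = \<gamma>' i + sum \<gamma>' (UNIV - {i})"
    by (simp_all add: sum.remove)
  moreover have "sum \<gamma>' (UNIV - {i}) = sum \<gamma> (UNIV - {i})" by (intro sum.cong) (auto simp: \<gamma>'_def)
  ultimately have k: "k = sum \<gamma>' UNIV" using Suc.hyps(2) i by (simp add: \<gamma>'_def)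
  have "integrable lborel m" unfolding m_def by (intro schwartz_monomial_integrable g)
  moreover have "integrable lborel (\<lambda>y. of_real (y $ i) * m y)"
    using schwartz_monomial_integrable[OF g, of \<gamma>] by (simp add: m_def mono mult_ac)
  ultimately have lim: "(\<lambda>k. real (Suc k) *\<^sub>R (ift m (x + (1 / real (Suc k)) *\<^sub>R axis i 1) - ift m x))
    \<longlonglongrightarrow> ift (\<lambda>\<xi>. \<i> * of_real (\<xi> $ i) * m \<xi>) x" by (rule ift_difference_quotient)
  have "(\<lambda>k. norm (x + (1 / real (Suc k)) *\<^sub>R axis i 1)) \<longlonglongrightarrow> norm (x + 0 *\<^sub>R axis i 1)"
    using LIMSEQ_inverse_real_of_nat by (intro tendsto_intros) (simp add: divide_inverse)
  then have "\<forall>\<^sub>F k in sequentially. norm (x + (1 / real (Suc k)) *\<^sub>R axis i 1) < r"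
    using Suc.prems by (auto dest: order_tendstoD)
  then have "\<forall>\<^sub>F k in sequentially.
      real (Suc k) *\<^sub>R (ift m (x + (1 / real (Suc k)) *\<^sub>R axis i 1) - ift m x) = 0"
    by eventually_elim (use Suc.hyps(1)[OF k] Suc.prems in \<open>simp add: m_def\<close>)
  then have "(\<lambda>k. real (Suc k) *\<^sub>R (ift m (x + (1 / real (Suc k)) *\<^sub>R axis i 1) - ift m x)) \<longlonglongrightarrow> 0"
    by (rule tendsto_eventually)
  with lim have "ift (\<lambda>\<xi>. \<i> * of_real (\<xi> $ i) * m \<xi>) x = 0" by (rule LIMSEQ_unique)
  also have "ift (\<lambda>\<xi>. \<i> * of_real (\<xi> $ i) * m \<xi>) x = (LINT \<xi>|lborel. \<i> * (iexp (x \<bullet> \<xi>) * (g \<xi> * of_real (monomial \<gamma> \<xi>))))"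
    unfolding ift_def by (intro Bochner_Integration.integral_cong refl) (simp add: m_def mono mult_ac)
  also have "\<dots> = \<i> * ift (\<lambda>y. g y * of_real (monomial \<gamma> y)) x"
    unfolding ift_def by (rule integral_mult_right_zero)
  finally show ?case by simp
qed

lemma schwartz_infI:
  fixes g :: "real^'n::finite \<Rightarrow> complex"
  assumes g: "g \<in> schwartz" and r: "0 < r" and z: "\<And>\<xi>. norm \<xi> < r \<Longrightarrow> fourier g \<xi> = 0"
  shows "g \<in> schwartz_inf"
  unfolding schwartz_inf_def
  using g r moments_vanish_near_0[OF g z, where x=0] by (auto simp: ift_def)

text \<open>By the substitution w = z - c y, the transform at \<open>\<xi>\<close> is a phase times
  c^(-n) times the transform of \<open>\<phi>\<close> at - \<xi> / c.\<close>

lemma fourier_affine_eq_0: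
  fixes \<phi> :: "real^'n::finite \<Rightarrow> complex"
  assumes [measurable]: "\<phi> \<in> borel_measurable borel" and c: "0 < c"
    and z: "fourier \<phi> ((- 1 / c) *\<^sub>R \<xi>) = 0"
  shows "fourier (\<lambda>y. \<phi> (z - c *\<^sub>R y)) \<xi> = 0"
proof -
  have "fourier (\<lambda>y. \<phi> (z - c *\<^sub>R y)) \<xi> = \<bar>- 1 / c\<bar> ^ DIM(real^'n) *\<^sub>R
    (LINT w|lborel. exp (- (\<i> * of_real (((1 / c) *\<^sub>R z + (- 1 / c) *\<^sub>R w) \<bullet> \<xi>))) *
      \<phi> (z - c *\<^sub>R ((1 / c) *\<^sub>R z + (- 1 / c) *\<^sub>R w)))"
    unfolding fourier_def using c by (intro integral_lborel_affine) auto
  also have "(LINT w|lborel. exp (- (\<i> * of_real (((1 / c) *\<^sub>R z + (- 1 / c) *\<^sub>R w) \<bullet> \<xi>))) *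
      \<phi> (z - c *\<^sub>R ((1 / c) *\<^sub>R z + (- 1 / c) *\<^sub>R w))) =
    (LINT w|lborel. exp (- (\<i> * of_real (((1 / c) *\<^sub>R z) \<bullet> \<xi>))) *
       (exp (- (\<i> * of_real (w \<bullet> ((- 1 / c) *\<^sub>R \<xi>)))) * \<phi> w))"
  proof (intro Bochner_Integration.integral_cong refl)
    fix w :: "real^'n"
    have "exp (- (\<i> * of_real (((1 / c) *\<^sub>R z + (- 1 / c) *\<^sub>R w) \<bullet> \<xi>))) =
      exp (- (\<i> * of_real (((1 / c) *\<^sub>R z) \<bullet> \<xi>))) * exp (- (\<i> * of_real (w \<bullet> ((- 1 / c) *\<^sub>R \<xi>))))"
      unfolding exp_add[symmetric] by (simp add: inner_diff_left algebra_simps)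
    then show "exp (- (\<i> * of_real (((1 / c) *\<^sub>R z + (- 1 / c) *\<^sub>R w) \<bullet> \<xi>))) *
      \<phi> (z - c *\<^sub>R ((1 / c) *\<^sub>R z + (- 1 / c) *\<^sub>R w)) =
      exp (- (\<i> * of_real (((1 / c) *\<^sub>R z) \<bullet> \<xi>))) *
       (exp (- (\<i> * of_real (w \<bullet> ((- 1 / c) *\<^sub>R \<xi>)))) * \<phi> w)"
      using c by (simp add: scaleR_diff_right)
  qed
  also have "\<dots> = exp (- (\<i> * of_real (((1 / c) *\<^sub>R z) \<bullet> \<xi>))) * fourier \<phi> ((- 1 / c) *\<^sub>R \<xi>)"
    unfolding fourier_def by (rule integral_mult_right_zero)
  finally show ?thesis using z by simp
qed

lemma schwartz_inf_affine:
  fixes \<phi> :: "real^'n::finite \<Rightarrow> complex"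
  assumes \<phi>: "\<phi> \<in> schwartz" and c: "0 < c" and r: "0 < r" "\<And>\<xi>. norm \<xi> < r \<Longrightarrow> fourier \<phi> \<xi> = 0"
  shows "(\<lambda>y. \<phi> (z - c *\<^sub>R y)) \<in> schwartz_inf"
proof (rule schwartz_infI[where r="c * r"])
  fix \<xi> :: "real^'n" assume "norm \<xi> < c * r"
  then have "norm ((- 1 / c) *\<^sub>R \<xi>) < r" using c by (simp add: field_simps)
  then show "fourier (\<lambda>y. \<phi> (z - c *\<^sub>R y)) \<xi> = 0"
    by (intro fourier_affine_eq_0 schwartz_measurable \<phi> c r)
qed (use c r schwartz_affine[OF \<phi>] in auto)

lemma schwartz_inf_lincomb:
  fixes f g :: "real^'n::finite \<Rightarrow> complex"
  assumes f: "f \<in> schwartz_inf" and g: "g \<in> schwartz_inf"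
  shows "(\<lambda>y. a * f y + b * g y) \<in> schwartz_inf"
proof -
  have s: "f \<in> schwartz" "g \<in> schwartz" using f g by (auto simp: schwartz_inf_def)
  have "(LINT x|lborel. (a * f x + b * g x) * of_real (monomial \<gamma> x)) = 0" for \<gamma>
  proof -
    have "(LINT x|lborel. (a * f x + b * g x) * of_real (monomial \<gamma> x)) =
      (LINT x|lborel. a * (f x * of_real (monomial \<gamma> x)) + b * (g x * of_real (monomial \<gamma> x)))"
      by (intro Bochner_Integration.integral_cong refl) (simp add: algebra_simps)
    also have "\<dots> = a * (LINT x|lborel. f x * of_real (monomial \<gamma> x)) + b * (LINT x|lborel. g x * of_real (monomial \<gamma> x))"
      using s by (subst Bochner_Integration.integral_add)
        (auto intro!: integrable_mult_right schwartz_monomial_integrable)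
    finally show ?thesis using f g by (simp add: schwartz_inf_def)
  qed
  then show ?thesis using schwartz_lincomb[OF s] by (simp add: schwartz_inf_def)
qed

text \<open>The condition asks for some bounded density with support in a ball instead of speaking
  of \<open>fourier g\<close>. Such densities are integrable, and multiplying them by a coordinate,
  which is what a derivative does, gives another one.\<close>

definition band_limited :: "real \<Rightarrow> (real^'n::finite \<Rightarrow> complex) \<Rightarrow> bool" where
  "band_limited R g \<longleftrightarrow> (\<exists>m B. m \<in> borel_measurable borel \<and> (\<forall>\<xi>. norm (m \<xi>) \<le> B) \<and>
     (\<forall>\<xi>. R < norm \<xi> \<longrightarrow> m \<xi> = 0) \<and> g = ift m)"

lemma integrable_bounded_support:
  fixes m :: "real^'n::finite \<Rightarrow> complex"
  assumes [measurable]: "m \<in> borel_measurable borel" and B: "\<And>\<xi>. norm (m \<xi>) \<le> B"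
    and R: "\<And>\<xi>. R < norm \<xi> \<Longrightarrow> m \<xi> = 0"
  shows "integrable lborel m"
proof (rule Bochner_Integration.integrable_bound)
  have "emeasure lborel (cball (0::real^'n) R) < \<infinity>" by (intro emeasure_lborel_cball_finite)
  then show "integrable lborel (\<lambda>\<xi>. B * indicator (cball (0::real^'n) R) \<xi>)"
    by (intro integrable_mult_right) auto
  have "0 \<le> B" using B[of 0] norm_ge_zero order_trans by blast
  then show "AE \<xi> in lborel. norm (m \<xi>) \<le> norm (B * indicator (cball (0::real^'n) R) \<xi>)"
    using B R by (intro AE_I2) (auto simp: indicator_def)
qed simp

text \<open>The density m becomes i \<xi>_i m, still bounded since |\<xi>_i| \<le> |R| on the
  support. The derivative and the new transform are limits of the same difference quotients.\<close>

lemma band_limited_partial_deriv: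
  fixes g :: "real^'n::finite \<Rightarrow> complex"
  assumes g: "band_limited R g" and d: "g differentiable_on UNIV"
  shows "band_limited R (partial_deriv i g)"
proof -
  obtain m B where [measurable]: "m \<in> borel_measurable borel" and B: "\<And>\<xi>. norm (m \<xi>) \<le> B"
    and R: "\<And>\<xi>. R < norm \<xi> \<Longrightarrow> m \<xi> = 0" and gm: "g = ift m"
    using g unfolding band_limited_def by blast
  have B': "norm (of_real (\<xi> $ i) * m \<xi>) \<le> \<bar>R\<bar> * B" for \<xi>
  proof (cases "R < norm \<xi>")
    case True
    then show ?thesis using R B[of \<xi>] by simp
  next
    case False
    then have "\<bar>\<xi> $ i\<bar> \<le> \<bar>R\<bar>" using component_le_norm_cart[of \<xi> i] by linarith
    then show ?thesis using B[of \<xi>] by (simp add: norm_mult mult_mono)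
  qed
  have "integrable lborel m"
    by (rule integrable_bounded_support[OF _ B R]) simp_all
  moreover have "integrable lborel (\<lambda>\<xi>. of_real (\<xi> $ i) * m \<xi>)"
    by (rule integrable_bounded_support[OF _ B', where R=R]) (simp_all add: R)
  ultimately have i: "integrable lborel m" "integrable lborel (\<lambda>\<xi>. of_real (\<xi> $ i) * m \<xi>)" by auto
  have "partial_deriv i g x = ift (\<lambda>\<xi>. \<i> * of_real (\<xi> $ i) * m \<xi>) x" for x
  proof (rule LIMSEQ_unique)
    show "(\<lambda>k. real (Suc k) *\<^sub>R (g (x + (1 / real (Suc k)) *\<^sub>R axis i 1) - g x)) \<longlonglongrightarrow> partial_deriv i g x"
      unfolding partial_deriv_def using d
      by (intro directional_difference_quotient) (auto simp: differentiable_on_def frechet_derivative_works)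
    show "(\<lambda>k. real (Suc k) *\<^sub>R (g (x + (1 / real (Suc k)) *\<^sub>R axis i 1) - g x))
      \<longlonglongrightarrow> ift (\<lambda>\<xi>. \<i> * of_real (\<xi> $ i) * m \<xi>) x"
      unfolding gm by (rule ift_difference_quotient[OF i])
  qed
  then have "partial_deriv i g = ift (\<lambda>\<xi>. \<i> * of_real (\<xi> $ i) * m \<xi>)" by auto
  moreover have "norm (\<i> * of_real (\<xi> $ i) * m \<xi>) \<le> \<bar>R\<bar> * B" for \<xi>
    using B'[of \<xi>] by (simp add: norm_mult)
  ultimately show ?thesis
    unfolding band_limited_def using R
    by (intro exI[of _ "\<lambda>\<xi>. \<i> * of_real (\<xi> $ i) * m \<xi>"] exI[of _ "\<bar>R\<bar> * B"]) auto
qed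

lemma band_limited_partial_derivs:
  "smooth g \<Longrightarrow> band_limited R g \<Longrightarrow> band_limited R (partial_derivs is g)"
  by (induction "is") (auto intro: band_limited_partial_deriv simp: smooth_def)

lemma fourier_measurable:
  assumes [measurable]: "f \<in> borel_measurable borel"
  shows "fourier f \<in> borel_measurable borel"
  unfolding fourier_def by measurable

text \<open>Inversion needs an integrable transform; here it is bounded with bounded support. The
  density is the transform divided by (2 pi)^n.\<close>

lemma schwartz_band_limited:
  fixes \<phi> :: "real^'n::finite \<Rightarrow> complex"
  assumes \<phi>: "\<phi> \<in> schwartz" and R: "\<And>\<xi>. R < norm \<xi> \<Longrightarrow> fourier \<phi> \<xi> = 0"
  shows "band_limited R \<phi>"
proof -
  define \<kappa> where "\<kappa> = (2 * pi) ^ CARD('n)"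
  have \<kappa>: "0 < \<kappa>" by (simp add: \<kappa>_def)
  have int: "integrable lborel \<phi>" using \<phi> by (rule schwartz_integrable)
  have [measurable]: "fourier \<phi> \<in> borel_measurable borel"
    by (intro fourier_measurable schwartz_measurable \<phi>)
  have B: "norm (fourier \<phi> \<xi>) \<le> (LINT x|lborel. norm (\<phi> x))" for \<xi>
    unfolding fourier_def
    by (rule order_trans[OF integral_norm_bound]) (simp add: norm_mult)
  have F: "integrable lborel (fourier \<phi>)"
    using R B by (intro integrable_bounded_support) auto
  obtain K where K: "\<And>x. (1 + norm x) ^ 0 * norm (partial_derivs [] \<phi> x) \<le> K"
    using schwartz_decay[OF \<phi>] by metis
  have "smooth \<phi>" using \<phi> by (simp add: schwartz_def)
  then have cont: "continuous_on UNIV \<phi>" using smooth_continuous[of \<phi> "[]"] by simp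
  have "of_real \<kappa> * \<phi> x = ift (fourier \<phi>) x" for x
    unfolding \<kappa>_def ift_def using K by (intro fourier_inversion int cont F) auto
  then have "\<phi> x = ift (\<lambda>\<xi>. fourier \<phi> \<xi> / of_real \<kappa>) x" for x
    using \<kappa> by (simp add: ift_def field_simps)
  then have "\<phi> = ift (\<lambda>\<xi>. fourier \<phi> \<xi> / of_real \<kappa>)" by auto
  then show ?thesis unfolding band_limited_def using R B \<kappa>
    by (intro exI[of _ "\<lambda>\<xi>. fourier \<phi> \<xi> / of_real \<kappa>"] exI[of _ "(LINT x|lborel. norm (\<phi> x)) / \<kappa>"])
       (auto simp: norm_divide intro!: divide_right_mono)
qed

subsection \<open>Sampling band-limited functions\<close>

text \<open>Finite linear combinations of point evaluations. In this inductive form, commutation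
  with integrals, with partial derivatives and with a linear \<open>f\<close> takes one short
  induction each.\<close>

inductive fin_comb :: "(('a \<Rightarrow> complex) \<Rightarrow> complex) \<Rightarrow> bool" where
  fin_comb_eval: "fin_comb (\<lambda>F. F x)"
| fin_comb_lin: "fin_comb S \<Longrightarrow> fin_comb T \<Longrightarrow> fin_comb (\<lambda>F. a * S F + b * T F)"

lemma fin_comb_zero: "fin_comb (\<lambda>F. 0)"
  using fin_comb_lin[OF fin_comb_eval fin_comb_eval, of 0 _ 0] by simp

lemma fin_comb_diff: "fin_comb S \<Longrightarrow> fin_comb T \<Longrightarrow> fin_comb (\<lambda>F. S F - T F)"
  using fin_comb_lin[of S T 1 "-1"] by simp

lemma fin_comb_sum:
  fixes M :: nat
  assumes "\<And>n. fin_comb (T n)"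
  shows "fin_comb (\<lambda>F. \<Sum>n<M. c n * T n F)"
proof (induction M)
  case (Suc M)
  from fin_comb_lin[OF this assms[of M], of 1 "c M"] show ?case by simp
qed (simp add: fin_comb_zero)

lemma fin_comb_mult: "fin_comb T \<Longrightarrow> T (\<lambda>x. c * F x) = c * T F"
  by (induction rule: fin_comb.induct) (auto simp: algebra_simps)

lemma fin_comb_const_0: "fin_comb T \<Longrightarrow> T (\<lambda>x. 0) = 0"
  using fin_comb_mult[of T 0 "\<lambda>_. 0"] by simp

lemma fin_comb_integral:
  assumes "fin_comb T" and G: "\<And>x. integrable N (\<lambda>t. G t x)"
  shows "integrable N (\<lambda>t. T (G t)) \<and> T (\<lambda>x. LINT t|N. G t x) = (LINT t|N. T (G t))"
  using assms(1) by (induction rule: fin_comb.induct) (auto simp: G)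

text \<open>\<open>T\<close> acts on the parameter z of the family \<open>E\<close>, while
  \<open>f\<close> and the derivatives act on y. The three claims go through one induction because
  linearity of \<open>f\<close> and of the derivatives is available only for members of
  \<open>schwartz_inf\<close>.\<close>

lemma fin_comb_schwartz_inf:
  assumes "fin_comb T" and E: "\<And>z. E z \<in> schwartz_inf"
    and lin: "\<And>g h a b. g \<in> schwartz_inf \<Longrightarrow> h \<in> schwartz_inf \<Longrightarrow>
      f (\<lambda>x. a * g x + b * h x) = a * f g + b * f h"
  shows "(\<lambda>y. T (\<lambda>z. E z y)) \<in> schwartz_inf \<and> f (\<lambda>y. T (\<lambda>z. E z y)) = T (\<lambda>z. f (E z)) \<and>
    (\<forall>is. partial_derivs is (\<lambda>y. T (\<lambda>z. E z y)) = (\<lambda>y. T (\<lambda>z. partial_derivs is (E z) y)))"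
  using assms(1)
proof (induction rule: fin_comb.induct)
  case (fin_comb_lin S T a b)
  then have "smooth (\<lambda>y. S (\<lambda>z. E z y))" "smooth (\<lambda>y. T (\<lambda>z. E z y))"
    by (auto simp: schwartz_inf_def schwartz_def)
  then have "partial_derivs is (\<lambda>y. a * S (\<lambda>z. E z y) + b * T (\<lambda>z. E z y)) =
      (\<lambda>y. a * partial_derivs is (\<lambda>y. S (\<lambda>z. E z y)) y + b * partial_derivs is (\<lambda>y. T (\<lambda>z. E z y)) y)" for "is"
    by (rule partial_derivs_lincomb)
  with fin_comb_lin.IH show ?case
    by (simp add: schwartz_inf_lincomb lin)
qed (use E in auto)

text \<open>The factor 1/(2 i) makes exponentials of frequency \<omega> eigenfunctions with
  eigenvalue sin (v \<bullet> \<omega>), so that iterates of this operator realise powers of the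
  sine; it also makes the operator a contraction for the supremum norm.\<close>

definition sdiff :: "'a::real_vector \<Rightarrow> ('a \<Rightarrow> complex) \<Rightarrow> 'a \<Rightarrow> complex" where
  "sdiff v F x = (F (x + v) - F (x - v)) / (2 * \<i>)"

lemma sdiff_pow_Suc:
  "(sdiff v ^^ Suc n) F x = ((sdiff v ^^ n) F (x + v) - (sdiff v ^^ n) F (x - v)) / (2 * \<i>)"
  by (simp add: sdiff_def[of v "(sdiff v ^^ n) F"])

lemma fin_comb_sdiff_pow: "fin_comb (\<lambda>F. (sdiff v ^^ n) F x)"
proof (induction n arbitrary: x)
  case (Suc n)
  have "(\<lambda>F. (sdiff v ^^ Suc n) F x) = (\<lambda>F. 1 / (2 * \<i>) * (sdiff v ^^ n) F (x + v) + - 1 / (2 * \<i>) * (sdiff v ^^ n) F (x - v))"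
    by (rule ext, simp only: sdiff_pow_Suc) (simp add: field_simps)
  moreover have "fin_comb (\<lambda>F. 1 / (2 * \<i>) * (sdiff v ^^ n) F (x + v) + - 1 / (2 * \<i>) * (sdiff v ^^ n) F (x - v))"
    by (intro fin_comb_lin Suc)
  ultimately show ?case by (simp only:)
qed (simp add: fin_comb_eval)

lemma norm_sdiff_pow_le:
  assumes "\<And>x. norm (F x) \<le> A"
  shows "norm ((sdiff v ^^ n) F x) \<le> A"
proof (induction n arbitrary: x)
  case (Suc n)
  have "norm ((sdiff v ^^ n) F (x + v) - (sdiff v ^^ n) F (x - v)) \<le> A + A"
    by (intro order_trans[OF norm_triangle_ineq4] add_mono Suc)
  then show ?case unfolding sdiff_pow_Suc by (simp add: norm_divide norm_mult)
qed (use assms in simp)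

lemma sdiff_pow_iexp:
  fixes v x \<omega> :: "'a::real_inner"
  shows "(sdiff v ^^ n) (\<lambda>x. iexp (x \<bullet> \<omega>)) x = of_real (sin (v \<bullet> \<omega>) ^ n) * iexp (x \<bullet> \<omega>)"
proof (induction n arbitrary: x)
  case (Suc n)
  have "sin (of_real (v \<bullet> \<omega>) :: complex) = (iexp (v \<bullet> \<omega>) - iexp (- (v \<bullet> \<omega>))) / (2 * \<i>)"
    by (simp add: sin_exp_eq)
  moreover have "iexp ((x + v) \<bullet> \<omega>) = iexp (x \<bullet> \<omega>) * iexp (v \<bullet> \<omega>)"
    "iexp ((x - v) \<bullet> \<omega>) = iexp (x \<bullet> \<omega>) * iexp (- (v \<bullet> \<omega>))"
    unfolding exp_add[symmetric] by (simp_all add: inner_add_left inner_diff_left algebra_simps)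
  ultimately have "(iexp ((x + v) \<bullet> \<omega>) - iexp ((x - v) \<bullet> \<omega>)) / (2 * \<i>)
      = sin (of_real (v \<bullet> \<omega>)) * iexp (x \<bullet> \<omega>)"
    by (simp add: right_diff_distrib mult.commute)
  moreover have "(of_real (sin (v \<bullet> \<omega>) ^ n) * iexp ((x + v) \<bullet> \<omega>) - of_real (sin (v \<bullet> \<omega>) ^ n) * iexp ((x - v) \<bullet> \<omega>)) / (2 * \<i>)
     = of_real (sin (v \<bullet> \<omega>) ^ n) * ((iexp ((x + v) \<bullet> \<omega>) - iexp ((x - v) \<bullet> \<omega>)) / (2 * \<i>))"
    by (simp only: right_diff_distrib times_divide_eq_right)
  ultimately show ?case
    unfolding sdiff_pow_Suc Suc by (simp add: sin_of_real mult_ac)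
qed simp

text \<open>On frequency \<omega> this is multiplication by sin (\<beta> \<theta>) minus the partial
  sum of its expansion in powers of sin \<theta>, with \<theta> = v \<bullet> \<omega>.\<close>

definition sampling_error :: "real \<Rightarrow> 'a::real_vector \<Rightarrow> nat \<Rightarrow> 'a \<Rightarrow> ('a \<Rightarrow> complex) \<Rightarrow> complex" where
  "sampling_error \<beta> v M x F = sdiff (\<beta> *\<^sub>R v) F x -
     (\<Sum>n<M. of_real (sin_mult_coeff \<beta> n) * (sdiff v ^^ n) F x)"

definition coeff_tail :: "real \<Rightarrow> nat \<Rightarrow> real" where
  "coeff_tail \<beta> M = (\<Sum>n. sin_mult_coeff \<beta> (n + M))"

lemma fin_comb_sampling_error: "fin_comb (sampling_error \<beta> v M x)"
proof -
  have "fin_comb (\<lambda>F. sdiff (\<beta> *\<^sub>R v) F x)" using fin_comb_sdiff_pow[where v="\<beta> *\<^sub>R v" and n=1] by simp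
  from fin_comb_diff[OF this fin_comb_sum[where T="\<lambda>n F. (sdiff v ^^ n) F x",
      OF fin_comb_sdiff_pow, of "\<lambda>n. of_real (sin_mult_coeff \<beta> n)" M]]
  show ?thesis unfolding sampling_error_def[abs_def] .
qed

text \<open>Every M is included: large M allow the constant to be improved, and M = 0, where the
  series is empty, yields the Bernstein inequality. The condition constrains finite combinations of
  values only, so it passes through integrals over frequencies and through \<open>f\<close>.\<close>

definition sampled :: "real \<Rightarrow> 'a::real_vector \<Rightarrow> real \<Rightarrow> ('a \<Rightarrow> complex) \<Rightarrow> bool" where
  "sampled \<beta> v A F \<longleftrightarrow> (\<forall>M x. norm (sampling_error \<beta> v M x F) \<le> A * coeff_tail \<beta> M)"

context
  fixes \<beta> :: real
  assumes \<beta>: "0 \<le> \<beta>" "\<beta> \<le> 1"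
begin

lemma coeff_tail_nonneg: "0 \<le> coeff_tail \<beta> M"
  unfolding coeff_tail_def
  using sin_mult_coeff_bounds[OF \<beta>] sin_mult_coeff_abs_summable[OF \<beta>]
  by (intro suminf_nonneg) (auto simp: summable_iff_shift)

lemma coeff_tail_split: "coeff_tail \<beta> 0 = (\<Sum>n<M. sin_mult_coeff \<beta> n) + coeff_tail \<beta> M"
  unfolding coeff_tail_def
  using suminf_split_initial_segment[OF sin_mult_coeff_abs_summable[OF \<beta>], of M] by simp

lemma coeff_tail_tendsto: "coeff_tail \<beta> \<longlonglongrightarrow> 0"
  unfolding coeff_tail_def[abs_def]
  using suminf_exist_split2[OF sin_mult_coeff_abs_summable[OF \<beta>]] .

lemma coeff_tail_0_le: "coeff_tail \<beta> 0 \<le> \<beta> * (pi / 2)"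
proof -
  have "suminf (sin_mult_coeff \<beta>) \<le> \<beta> * (pi / 2)"
    using sin_mult_coeff_sum_le[OF \<beta>] sin_mult_coeff_abs_summable[OF \<beta>]
    by (intro suminf_le_const) auto
  then show ?thesis by (simp add: coeff_tail_def)
qed

lemma sampled_mult: "sampled \<beta> v A F \<Longrightarrow> sampled \<beta> v (norm c * A) (\<lambda>x. c * F x)"
  unfolding sampled_def fin_comb_mult[OF fin_comb_sampling_error]
  by (auto simp: norm_mult mult.assoc intro!: mult_left_mono)

text \<open>The error is the remainder of the sine expansion times a unimodular factor, and |sin
  \<theta>| \<le> 1 bounds the remainder by the tail. The restriction \<bar>\<theta>\<bar> < pi/2 of
  the expansion ties the step v to the bandwidth.\<close>

lemma sampled_iexp:
  fixes v \<omega> :: "'a::real_inner"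
  assumes "\<bar>v \<bullet> \<omega>\<bar> < pi / 2"
  shows "sampled \<beta> v 1 (\<lambda>x. iexp (x \<bullet> \<omega>))"
  unfolding sampled_def
proof (intro allI)
  fix M x
  let ?c = "sin_mult_coeff \<beta>" and ?s = "sin (v \<bullet> \<omega>)"
  have s: "(\<lambda>n. ?c n * ?s ^ n) sums sin (\<beta> * (v \<bullet> \<omega>))"
    using assms by (intro sin_mult_coeff_sums \<beta>)
  have "sin (\<beta> * (v \<bullet> \<omega>)) - (\<Sum>n<M. ?c n * ?s ^ n) = (\<Sum>n. ?c (n + M) * ?s ^ (n + M))"
    using suminf_split_initial_segment[OF sums_summable[OF s], of M] sums_unique[OF s] by simp
  also have "\<bar>\<dots>\<bar> \<le> coeff_tail \<beta> M"
    unfolding coeff_tail_def real_norm_def[symmetric]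
  proof (rule norm_suminf_le)
    show "norm (?c (n + M) * ?s ^ (n + M)) \<le> ?c (n + M)" for n
      using sin_mult_coeff_bounds[OF \<beta>, of "n + M"]
      by (auto simp: abs_mult power_abs intro!: mult_right_le_one_le power_le_one)
    show "summable (\<lambda>n. ?c (n + M))"
      using sin_mult_coeff_abs_summable[OF \<beta>] by (simp add: summable_iff_shift)
  qed
  finally have le: "\<bar>sin (\<beta> * (v \<bullet> \<omega>)) - (\<Sum>n<M. ?c n * ?s ^ n)\<bar> \<le> coeff_tail \<beta> M" .
  have "sampling_error \<beta> v M x (\<lambda>x. iexp (x \<bullet> \<omega>)) =
    of_real (sin (\<beta> * (v \<bullet> \<omega>)) - (\<Sum>n<M. ?c n * ?s ^ n)) * iexp (x \<bullet> \<omega>)"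
  proof -
    have "sdiff (\<beta> *\<^sub>R v) (\<lambda>x. iexp (x \<bullet> \<omega>)) x = of_real (sin (\<beta> * (v \<bullet> \<omega>))) * iexp (x \<bullet> \<omega>)"
      using sdiff_pow_iexp[where v="\<beta> *\<^sub>R v" and n=1 and \<omega>=\<omega> and x=x] by simp
    then show ?thesis
      unfolding sampling_error_def sdiff_pow_iexp
      by (simp add: algebra_simps sum_distrib_left)
  qed
  then show "norm (sampling_error \<beta> v M x (\<lambda>x. iexp (x \<bullet> \<omega>))) \<le> 1 * coeff_tail \<beta> M"
    using le by (simp add: norm_mult del: of_real_diff)
qed

lemma sampled_integral:
  assumes G: "\<And>x. integrable N (\<lambda>t. G t x)" and w: "integrable N w"
    and s: "\<And>t. sampled \<beta> v (w t) (G t)"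
  shows "sampled \<beta> v (LINT t|N. w t) (\<lambda>x. LINT t|N. G t x)"
  unfolding sampled_def
proof (intro allI)
  fix M x
  have "integrable N (\<lambda>t. sampling_error \<beta> v M x (G t))"
    and eq: "sampling_error \<beta> v M x (\<lambda>x. LINT t|N. G t x) = (LINT t|N. sampling_error \<beta> v M x (G t))"
    using fin_comb_integral[OF fin_comb_sampling_error, where N=N and G=G, OF G] by auto
  then have "norm (LINT t|N. sampling_error \<beta> v M x (G t)) \<le> (LINT t|N. w t * coeff_tail \<beta> M)"
    using s w by (intro order_trans[OF integral_norm_bound integral_mono]) (auto simp: sampled_def)
  then show "norm (sampling_error \<beta> v M x (\<lambda>x. LINT t|N. G t x)) \<le> (LINT t|N. w t) * coeff_tail \<beta> M"
    unfolding eq by simp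
qed

text \<open>Pass from M to a later M'. The terms in between cost at most C times their coefficients,
  as \<open>sdiff\<close> does not increase the supremum; the remainder at M' carries the factor A
  but tends to 0 with the tail. Hence mere existence of some A is enough to obtain the constant
  C.\<close>

lemma sampled_sup_bound:
  assumes s: "sampled \<beta> v A F" and C: "\<And>x. norm (F x) \<le> C"
  shows "sampled \<beta> v C F"
  unfolding sampled_def
proof (intro allI)
  fix M x
  have "norm (sampling_error \<beta> v M x F) \<le> A * coeff_tail \<beta> M' + C * coeff_tail \<beta> M" if "M \<le> M'" for M'
  proof -
    have "sampling_error \<beta> v M x F = sampling_error \<beta> v M' x F +
      (\<Sum>n=M..<M'. of_real (sin_mult_coeff \<beta> n) * (sdiff v ^^ n) F x)"
      unfolding sampling_error_def lessThan_atLeast0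
      using sum.atLeastLessThan_concat[OF _ that, of 0 "\<lambda>n. of_real (sin_mult_coeff \<beta> n) * (sdiff v ^^ n) F x"]
      by (simp add: algebra_simps)
    also have "norm \<dots> \<le> A * coeff_tail \<beta> M' + norm (\<Sum>n=M..<M'. of_real (sin_mult_coeff \<beta> n) * (sdiff v ^^ n) F x)"
      using s by (intro norm_triangle_mono) (auto simp: sampled_def)
    also have "norm (\<Sum>n=M..<M'. of_real (sin_mult_coeff \<beta> n) * (sdiff v ^^ n) F x)
      \<le> (\<Sum>n=M..<M'. sin_mult_coeff \<beta> n * C)"
      using sin_mult_coeff_bounds[OF \<beta>] norm_sdiff_pow_le[of F C, OF C]
      by (intro sum_norm_le) (auto simp: norm_mult intro!: mult_left_mono)
    also have "\<dots> = C * (\<Sum>n=M..<M'. sin_mult_coeff \<beta> n)" by (simp add: sum_distrib_left mult.commute)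
    also have "\<dots> \<le> C * coeff_tail \<beta> M"
    proof (rule mult_left_mono)
      have "(\<Sum>n<M. sin_mult_coeff \<beta> n) + (\<Sum>n=M..<M'. sin_mult_coeff \<beta> n) = (\<Sum>n<M'. sin_mult_coeff \<beta> n)"
        unfolding lessThan_atLeast0 using that by (intro sum.atLeastLessThan_concat) auto
      then show "(\<Sum>n=M..<M'. sin_mult_coeff \<beta> n) \<le> coeff_tail \<beta> M"
        using coeff_tail_split[of M] coeff_tail_split[of M'] coeff_tail_nonneg[of M'] by linarith
      show "0 \<le> C" using C norm_ge_zero order_trans by blast
    qed
    finally show ?thesis by simp
  qed
  moreover have "(\<lambda>M'. A * coeff_tail \<beta> M' + C * coeff_tail \<beta> M) \<longlonglongrightarrow> A * 0 + C * coeff_tail \<beta> M"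
    by (intro tendsto_intros coeff_tail_tendsto)
  ultimately show "norm (sampling_error \<beta> v M x F) \<le> C * coeff_tail \<beta> M"
    by (intro tendsto_lowerbound[of _ "C * coeff_tail \<beta> M" sequentially])
       (auto simp: eventually_sequentially)
qed

text \<open>The Bernstein inequality in difference form: the case M = 0 with coefficient sum at most
  \<beta> pi/2, multiplied by the 2 from the denominator of \<open>sdiff\<close>.\<close>

lemma sampled_modulus:
  assumes s: "sampled \<beta> v A F" and C: "\<And>x. norm (F x) \<le> C"
  shows "norm (F (x + \<beta> *\<^sub>R v) - F (x - \<beta> *\<^sub>R v)) \<le> pi * \<beta> * C"
proof -
  have C0: "0 \<le> C" using C norm_ge_zero order_trans by blast
  have "norm (sdiff (\<beta> *\<^sub>R v) F x) \<le> C * coeff_tail \<beta> 0"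
  proof -
    have "norm (sampling_error \<beta> v 0 x F) \<le> C * coeff_tail \<beta> 0"
      using sampled_sup_bound[OF s C] unfolding sampled_def by blast
    then show ?thesis by (simp add: sampling_error_def)
  qed
  also have "\<dots> \<le> C * (\<beta> * (pi / 2))" using C0 coeff_tail_0_le by (rule mult_left_mono[rotated])
  finally show ?thesis by (simp add: sdiff_def norm_divide norm_mult field_simps)
qed

text \<open>The frequencies of \<open>z \<mapsto> \<phi> (a + \<epsilon> z) g (z - w)\<close> lie in the ball of radius
  \<open>\<epsilon> R + R\<close>, so that the bound for exponentials applies to each of them.\<close>

lemma sampled_band_limited_product:
  fixes \<phi> g :: "real^'n::finite \<Rightarrow> complex"
  assumes \<phi>: "band_limited R \<phi>" and g: "band_limited R g" and R: "0 \<le> R"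
    and \<epsilon>: "0 \<le> \<epsilon>" "\<epsilon> \<le> 1" and v: "norm v * (2 * R) < pi / 2"
  shows "\<exists>A. sampled \<beta> v A (\<lambda>z. \<phi> (a + \<epsilon> *\<^sub>R z) * g (z - w))"
proof -
  obtain m1 B1 where m1 [measurable]: "m1 \<in> borel_measurable borel" and B1: "\<And>\<xi>. norm (m1 \<xi>) \<le> B1"
    and R1: "\<And>\<xi>. R < norm \<xi> \<Longrightarrow> m1 \<xi> = 0" and \<phi>m: "\<phi> = ift m1"
    using \<phi> unfolding band_limited_def by blast
  obtain m2 B2 where m2 [measurable]: "m2 \<in> borel_measurable borel" and B2: "\<And>\<xi>. norm (m2 \<xi>) \<le> B2"
    and R2: "\<And>\<xi>. R < norm \<xi> \<Longrightarrow> m2 \<xi> = 0" and gm: "g = ift m2"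
    using g unfolding band_limited_def by blast
  have i1: "integrable lborel m1" using m1 B1 R1 by (rule integrable_bounded_support)
  have i2: "integrable lborel m2" using m2 B2 R2 by (rule integrable_bounded_support)
  define w2 where "w2 = (LINT \<xi>|lborel. norm (m2 \<xi>))"
  have inner: "sampled \<beta> v (norm (m1 \<zeta>) * w2) (\<lambda>z. iexp ((a + \<epsilon> *\<^sub>R z) \<bullet> \<zeta>) * m1 \<zeta> * g (z - w))" for \<zeta>
  proof (cases "R < norm \<zeta>")
    case True
    show ?thesis using True by (simp add: R1 sampled_def fin_comb_const_0[OF fin_comb_sampling_error])
  next
    case \<zeta>: False
    \<comment> \<open>Once \<open>\<phi>\<close> and \<open>g\<close> are both written as frequency
      integrals, fixed \<open>\<zeta>\<close> and \<open>\<xi>\<close> leave a constant times one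
      exponential in z, of frequency \<epsilon> \<zeta> + \<xi>. Integrating over
      \<open>\<xi>\<close> restores \<open>g\<close>, and then integrating over
      \<open>\<zeta>\<close> restores \<open>\<phi>\<close>.\<close>
    define G where "G \<xi> z = (iexp (a \<bullet> \<zeta>) * iexp (- (w \<bullet> \<xi>)) * m1 \<zeta> * m2 \<xi>) * iexp (z \<bullet> (\<epsilon> *\<^sub>R \<zeta> + \<xi>))" for \<xi> z
    have G: "iexp ((a + \<epsilon> *\<^sub>R z) \<bullet> \<zeta>) * m1 \<zeta> * (iexp ((z - w) \<bullet> \<xi>) * m2 \<xi>) = G \<xi> z" for \<xi> z
    proof -
      have "iexp ((a + \<epsilon> *\<^sub>R z) \<bullet> \<zeta>) * iexp ((z - w) \<bullet> \<xi>) =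
          iexp (a \<bullet> \<zeta>) * iexp (- (w \<bullet> \<xi>)) * iexp (z \<bullet> (\<epsilon> *\<^sub>R \<zeta> + \<xi>))"
        unfolding exp_add[symmetric] by (simp add: inner_add_left inner_diff_left inner_add_right algebra_simps)
      then show ?thesis unfolding G_def by (simp add: mult_ac)
    qed
    have "sampled \<beta> v (norm (m1 \<zeta>) * norm (m2 \<xi>)) (G \<xi>)" for \<xi>
    proof (cases "R < norm \<xi>")
      case True
      show ?thesis using True by (simp add: R2 G_def[abs_def] sampled_def fin_comb_const_0[OF fin_comb_sampling_error])
    next
      case False
      have "norm (\<epsilon> *\<^sub>R \<zeta> + \<xi>) \<le> \<epsilon> * norm \<zeta> + norm \<xi>"
        using \<epsilon> by (intro norm_triangle_le) simp
      also have "\<epsilon> * norm \<zeta> \<le> 1 * norm \<zeta>" using \<epsilon> by (intro mult_right_mono) auto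
      finally have "norm (\<epsilon> *\<^sub>R \<zeta> + \<xi>) \<le> 2 * R" using \<zeta> False by linarith
      then have "norm v * norm (\<epsilon> *\<^sub>R \<zeta> + \<xi>) \<le> norm v * (2 * R)" by (intro mult_left_mono) auto
      then have "\<bar>v \<bullet> (\<epsilon> *\<^sub>R \<zeta> + \<xi>)\<bar> < pi / 2"
        using v Cauchy_Schwarz_ineq2[of v "\<epsilon> *\<^sub>R \<zeta> + \<xi>"] by linarith
      from sampled_mult[OF sampled_iexp[OF this], of "iexp (a \<bullet> \<zeta>) * iexp (- (w \<bullet> \<xi>)) * m1 \<zeta> * m2 \<xi>"]
      show ?thesis unfolding G_def[abs_def] by (simp add: norm_mult)
    qed
    moreover have "integrable lborel (\<lambda>\<xi>. G \<xi> z)" for z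
      unfolding G[symmetric] by (intro integrable_mult_right integrable_iexp_mult i2)
    ultimately have "sampled \<beta> v (LINT \<xi>|lborel. norm (m1 \<zeta>) * norm (m2 \<xi>)) (\<lambda>z. LINT \<xi>|lborel. G \<xi> z)"
      using i2 by (intro sampled_integral integrable_mult_right integrable_norm)
    moreover have "(LINT \<xi>|lborel. G \<xi> z) = iexp ((a + \<epsilon> *\<^sub>R z) \<bullet> \<zeta>) * m1 \<zeta> * g (z - w)" for z
      unfolding G[symmetric] gm ift_def by (rule integral_mult_right_zero)
    ultimately show ?thesis unfolding w2_def by simp
  qed
  have "sampled \<beta> v (LINT \<zeta>|lborel. norm (m1 \<zeta>) * w2)
      (\<lambda>z. LINT \<zeta>|lborel. iexp ((a + \<epsilon> *\<^sub>R z) \<bullet> \<zeta>) * m1 \<zeta> * g (z - w))"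
    by (intro sampled_integral inner integrable_mult_left integrable_norm integrable_iexp_mult i1)
  moreover have "(LINT \<zeta>|lborel. iexp ((a + \<epsilon> *\<^sub>R z) \<bullet> \<zeta>) * m1 \<zeta> * g (z - w))
      = \<phi> (a + \<epsilon> *\<^sub>R z) * g (z - w)" for z
    unfolding \<phi>m ift_def by (rule integral_mult_left_zero)
  ultimately have "sampled \<beta> v (LINT \<zeta>|lborel. norm (m1 \<zeta>) * w2) (\<lambda>z. \<phi> (a + \<epsilon> *\<^sub>R z) * g (z - w))"
    by (simp only:)
  then show ?thesis ..
qed

end

subsection \<open>Functionals on Schwartz functions with vanishing moments\<close>

lemma partial_derivs_zero: "partial_derivs is (\<lambda>_. 0 :: complex) = (\<lambda>_. 0)"
  by (induction "is") (auto simp: partial_deriv_def frechet_derivative_const)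

lemma zero_in_schwartz: "(\<lambda>_. 0) \<in> schwartz"
  by (intro schwartzI_decay) (auto simp: smooth_def partial_derivs_zero)

lemma zero_in_schwartz_inf: "(\<lambda>_. 0) \<in> schwartz_inf"
  by (simp add: schwartz_inf_def zero_in_schwartz)

lemma schwartz_seminorm_upper:
  assumes "g \<in> schwartz"
  shows "norm (monomial \<gamma> x *\<^sub>R partial_derivs is g x) \<le> schwartz_seminorm \<gamma> is g"
proof -
  have "bounded (range (\<lambda>x. monomial \<gamma> x *\<^sub>R partial_derivs is g x))"
    using assms by (simp add: schwartz_def)
  then have "bdd_above (range (\<lambda>x. norm (monomial \<gamma> x *\<^sub>R partial_derivs is g x)))"
    by (auto simp: bounded_iff bdd_above_def)
  then show ?thesis unfolding schwartz_seminorm_def by (intro cSUP_upper) auto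
qed

lemma schwartz_seminorm_diff_le:
  assumes g: "g \<in> schwartz" and h: "h \<in> schwartz"
  shows "schwartz_seminorm \<gamma> is (\<lambda>x. g x - h x) \<le> schwartz_seminorm \<gamma> is g + schwartz_seminorm \<gamma> is (\<lambda>x. 0 - h x)"
proof -
  have h': "(\<lambda>x. 0 - h x) \<in> schwartz" using schwartz_lincomb[OF h h, of "-1" 0] by simp
  have "partial_derivs is (\<lambda>y. 1 * g y + 1 * (0 - h y)) =
      (\<lambda>y. 1 * partial_derivs is g y + 1 * partial_derivs is (\<lambda>y. 0 - h y) y)"
    using g h' by (intro partial_derivs_lincomb) (auto simp: schwartz_def)
  then have e: "partial_derivs is (\<lambda>y. g y - h y) =
      (\<lambda>y. partial_derivs is g y + partial_derivs is (\<lambda>y. 0 - h y) y)"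
    by simp
  have "norm (monomial \<gamma> x *\<^sub>R partial_derivs is (\<lambda>y. g y - h y) x) \<le>
      schwartz_seminorm \<gamma> is g + schwartz_seminorm \<gamma> is (\<lambda>x. 0 - h x)" for x
    unfolding e scaleR_add_right
    by (intro order_trans[OF norm_triangle_ineq] add_mono schwartz_seminorm_upper g h')
  then show ?thesis unfolding schwartz_seminorm_def[of _ _ "\<lambda>x. g x - h x"] by (intro cSUP_least) auto
qed

text \<open>The generating sets are seminorm balls about arbitrary centres h. If such a ball of
  radius e contains 0, then by the triangle inequality it contains the ball about 0 whose radius is
  e minus the seminorm of 0 - h. Intersections collect finitely many seminorms.\<close>

lemma schwartz_topology_neighbourhood_0:
  assumes "openin schwartz_topology U" "(\<lambda>_. 0) \<in> U"
  shows "\<exists>P d. finite P \<and> 0 < d \<and>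
    (\<forall>g\<in>schwartz. (\<forall>(\<gamma>, is)\<in>P. schwartz_seminorm \<gamma> is g < d) \<longrightarrow> g \<in> U)"
  using assms unfolding schwartz_topology_def openin_topology_generated_by_iff
proof (induction rule: generate_topology_on.induct)
  case (Int a b)
  then obtain P1 d1 P2 d2 where
    1: "finite P1" "0 < d1" "\<And>g. g \<in> schwartz \<Longrightarrow> (\<forall>(\<gamma>, is)\<in>P1. schwartz_seminorm \<gamma> is g < d1) \<Longrightarrow> g \<in> a" and
    2: "finite P2" "0 < d2" "\<And>g. g \<in> schwartz \<Longrightarrow> (\<forall>(\<gamma>, is)\<in>P2. schwartz_seminorm \<gamma> is g < d2) \<Longrightarrow> g \<in> b"
    by (auto 4 3)
  show ?case
  proof (intro exI[of _ "P1 \<union> P2"] exI[of _ "min d1 d2"] conjI ballI impI)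
    fix g assume "g \<in> schwartz" "\<forall>(\<gamma>, is)\<in>P1 \<union> P2. schwartz_seminorm \<gamma> is g < min d1 d2"
    then show "g \<in> a \<inter> b" by (intro IntI 1 2) auto
  qed (use 1 2 in auto)
next
  case (UN K)
  then obtain k where k: "k \<in> K" "(\<lambda>_. 0) \<in> k" by auto
  with UN.IH obtain P d where "finite P" "0 < d"
    "\<And>g. g \<in> schwartz \<Longrightarrow> (\<forall>(\<gamma>, is)\<in>P. schwartz_seminorm \<gamma> is g < d) \<Longrightarrow> g \<in> k" by metis
  with k show ?case by (intro exI[of _ P] exI[of _ d]) auto
next
  case (Basis s)
  then obtain h \<gamma> "is" e where s: "s = {g \<in> schwartz. schwartz_seminorm \<gamma> is (\<lambda>x. g x - h x) < e}"
    and h: "h \<in> schwartz" by auto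
  show ?case
  proof (intro exI[of _ "{(\<gamma>, is)}"] exI[of _ "e - schwartz_seminorm \<gamma> is (\<lambda>x. 0 - h x)"] conjI ballI impI)
    fix g assume g: "g \<in> schwartz" "\<forall>(\<gamma>', is')\<in>{(\<gamma>, is)}. schwartz_seminorm \<gamma>' is' g < e - schwartz_seminorm \<gamma> is (\<lambda>x. 0 - h x)"
    then show "g \<in> s" unfolding s using schwartz_seminorm_diff_le[OF g(1) h, of \<gamma> "is"] by auto
  qed (use Basis s in auto)
qed auto

lemma schwartz_inf_dual_linear:
  assumes "f \<in> schwartz_inf_dual" "g \<in> schwartz_inf" "h \<in> schwartz_inf"
  shows "f (\<lambda>x. a * g x + b * h x) = a * f g + b * f h"
  using assms by (auto simp: schwartz_inf_dual_def)

lemma schwartz_inf_dual_mult: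
  assumes "f \<in> schwartz_inf_dual" "g \<in> schwartz_inf"
  shows "f (\<lambda>x. a * g x) = a * f g"
  using schwartz_inf_dual_linear[OF assms assms(2), of a 0] by simp

lemma schwartz_inf_mult: "g \<in> schwartz_inf \<Longrightarrow> (\<lambda>x. a * g x) \<in> schwartz_inf"
  using schwartz_inf_lincomb[of g g a 0] by simp

lemma partial_derivs_mult: "smooth g \<Longrightarrow> partial_derivs is (\<lambda>x. a * g x) = (\<lambda>x. a * partial_derivs is g x)"
  using partial_derivs_lincomb[of g g "is" a 0] by simp

text \<open>Continuity at 0 gives |f| < 1 on a ball of finitely many seminorms, and homogeneity
  rescales it. The hypothesis is a pointwise bound instead of a bound on suprema, which suits test
  functions that are estimated at one y at a time.\<close>

lemma schwartz_inf_dual_bound: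
  fixes f :: "(real^'n::finite \<Rightarrow> complex) \<Rightarrow> complex"
  assumes f: "f \<in> schwartz_inf_dual"
  obtains P K where "finite P" "0 \<le> K"
    "\<And>g B. g \<in> schwartz_inf \<Longrightarrow> 0 \<le> B \<Longrightarrow>
      (\<And>\<gamma> is y. (\<gamma>, is) \<in> P \<Longrightarrow> \<bar>monomial \<gamma> y\<bar> * norm (partial_derivs is g y) \<le> B) \<Longrightarrow> norm (f g) \<le> K * B"
proof -
  let ?T = "schwartz_topology :: (real^'n \<Rightarrow> complex) topology"
  have 0: "(\<lambda>_. 0) \<in> topspace ?T"
    unfolding schwartz_topology_def topology_generated_by_topspace
  proof (rule UnionI)
    show "{g \<in> schwartz. schwartz_seminorm (\<lambda>_. 0) [] (\<lambda>x. g x - 0) < 1} \<in>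
      {{g \<in> schwartz. schwartz_seminorm \<gamma> is (\<lambda>x. g x - h x) < e} | h \<gamma> is e. h \<in> (schwartz :: (real^'n \<Rightarrow> complex) set) \<and> 0 < e}"
      using zero_in_schwartz by (intro CollectI exI[of _ "\<lambda>_. 0"] exI[of _ "[]"] exI[of _ "1::real"]) auto
    show "(\<lambda>_. 0) \<in> {g \<in> schwartz. schwartz_seminorm (\<lambda>_. 0) [] (\<lambda>x. g x - 0) < 1}"
      by (simp add: zero_in_schwartz schwartz_seminorm_def)
  qed
  have f0: "f (\<lambda>_. 0) = 0"
    using schwartz_inf_dual_mult[OF f zero_in_schwartz_inf, of 0] by simp
  have "continuous_map (subtopology ?T schwartz_inf) euclidean f"
    using f by (simp add: schwartz_inf_dual_def)
  then have "openin (subtopology ?T schwartz_inf)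
      {g \<in> topspace (subtopology ?T schwartz_inf). f g \<in> ball 0 1}"
    by (rule openin_continuous_map_preimage) simp
  then obtain U where U: "openin ?T U"
    "{g \<in> topspace (subtopology ?T schwartz_inf). f g \<in> ball 0 1} = U \<inter> schwartz_inf"
    by (auto simp: openin_subtopology)
  have "(\<lambda>_. 0) \<in> {g \<in> topspace (subtopology ?T schwartz_inf). f g \<in> ball 0 1}"
    using 0 f0 zero_in_schwartz_inf by simp
  then have "(\<lambda>_. 0) \<in> U" unfolding U(2) by (rule IntD1)
  from schwartz_topology_neighbourhood_0[OF U(1) this] obtain P d where P: "finite P" "0 < d"
    "\<forall>g\<in>schwartz. (\<forall>(\<gamma>, is)\<in>P. schwartz_seminorm \<gamma> is g < d) \<longrightarrow> g \<in> U"
    by (elim exE conjE)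
  show thesis
  proof (rule that[OF P(1), of "2 / d"])
    fix g and B :: real
    assume g: "g \<in> schwartz_inf" and B: "0 \<le> B"
      "\<And>\<gamma> is y. (\<gamma>, is) \<in> P \<Longrightarrow> \<bar>monomial \<gamma> y\<bar> * norm (partial_derivs is g y) \<le> B"
    have sm: "smooth g" using g by (simp add: schwartz_inf_def schwartz_def)
    \<comment> \<open>Scaling with t > B instead of B includes the case B = 0; the factor d / (2 t)
      brings all seminorms in P below d.\<close>
    have "norm (f g) * d / 2 \<le> t" if t: "B < t" for t
    proof -
      define a where "a = d / (2 * t)"
      have a: "0 < a" using t B P by (simp add: a_def)
      have ga: "(\<lambda>x. of_real a * g x) \<in> schwartz_inf" using g by (rule schwartz_inf_mult)
      have "schwartz_seminorm \<gamma> is (\<lambda>x. of_real a * g x) < d" if "(\<gamma>, is) \<in> P" for \<gamma> "is"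
      proof -
        have "norm (monomial \<gamma> x *\<^sub>R partial_derivs is (\<lambda>x. of_real a * g x) x) \<le> a * B" for x
          unfolding partial_derivs_mult[OF sm]
          using mult_left_mono[OF B(2)[OF that, of x], of a] a by (simp add: norm_mult mult_ac)
        then have "schwartz_seminorm \<gamma> is (\<lambda>x. of_real a * g x) \<le> a * B"
          unfolding schwartz_seminorm_def by (intro cSUP_least) auto
        also have "\<dots> \<le> a * t" using a t by (intro mult_left_mono) auto
        also have "\<dots> < d" using t B P by (simp add: a_def)
        finally show ?thesis .
      qed
      then have "(\<lambda>x. of_real a * g x) \<in> U" using ga by (intro P(3)[rule_format]) (auto simp: schwartz_inf_def)
      then have "f (\<lambda>x. of_real a * g x) \<in> ball 0 1" using U(2) ga by blast
      then have "a * norm (f g) < 1"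
        using a by (simp add: schwartz_inf_dual_mult[OF f g] norm_mult)
      then show ?thesis using t B P by (simp add: a_def field_simps)
    qed
    then have "norm (f g) * d / 2 \<le> B" by (rule dense_ge)
    then show "norm (f g) \<le> 2 / d * B" using P by (simp add: field_simps)
  qed (use P in auto)
qed

section \<open>The functions z \<mapsto> f (\<phi> (z - c \<cdot>)): cutoff, continuity and lower
  bound\<close>

context
  fixes \<phi> :: "real^'n::finite \<Rightarrow> complex"
  assumes \<phi>: "\<phi> \<in> schwartz"
    and outer: "\<forall>\<xi>. 2 < norm \<xi> \<longrightarrow> fourier \<phi> \<xi> = 0"
    and inner: "\<forall>\<xi>. norm \<xi> < 1/2 \<longrightarrow> fourier \<phi> \<xi> = 0"
begin

lemmas fourier_outer = outer[rule_format]
lemmas fourier_inner = inner[rule_format]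

lemma translate_in_schwartz_inf: "0 < c \<Longrightarrow> (\<lambda>y. \<phi> (z - c *\<^sub>R y)) \<in> schwartz_inf"
  by (rule schwartz_inf_affine[where r="1/2"]) (auto intro: \<phi> fourier_inner)

text \<open>The cutoff \<open>z \<mapsto> \<phi> (a + \<epsilon> z)\<close> is band-limited and decays rapidly, so it removes the
  polynomial growth of \<open>z \<mapsto> f (\<phi> (z - c \<cdot>))\<close> without leaving the class of band-limited functions.\<close>

lemma cutoff_sampled:
  fixes a :: "real^'n"
  assumes f: "f \<in> schwartz_inf_dual" and c: "0 < c" and \<epsilon>: "0 < \<epsilon>" "\<epsilon> \<le> 1"
  defines "V \<equiv> \<lambda>z. \<phi> (a + \<epsilon> *\<^sub>R z) * f (\<lambda>y. \<phi> (z - c *\<^sub>R y))"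
  shows "\<exists>A. (\<forall>z. norm (V z) \<le> A) \<and>
    (\<forall>\<beta> v. 0 \<le> \<beta> \<longrightarrow> \<beta> \<le> 1 \<longrightarrow> norm v \<le> 1 / 8 \<longrightarrow> sampled \<beta> v A V)"
proof -
  obtain P K where P: "finite P" "0 \<le> K"
    and bnd: "\<And>g B. g \<in> schwartz_inf \<Longrightarrow> 0 \<le> B \<Longrightarrow>
      (\<And>\<gamma> is y. (\<gamma>, is) \<in> P \<Longrightarrow> \<bar>monomial \<gamma> y\<bar> * norm (partial_derivs is g y) \<le> B) \<Longrightarrow> norm (f g) \<le> K * B"
    using schwartz_inf_dual_bound[OF f] by metis
  define E where "E z y = \<phi> (a + \<epsilon> *\<^sub>R z) * \<phi> (z - c *\<^sub>R y)" for z y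
  have sm: "smooth \<phi>" using \<phi> by (simp add: schwartz_def)
  have E: "E z \<in> schwartz_inf" for z
    unfolding E_def[abs_def] by (intro schwartz_inf_mult translate_in_schwartz_inf c)
  have fE: "f (E z) = V z" for z
    unfolding E_def[abs_def] V_def by (rule schwartz_inf_dual_mult[OF f translate_in_schwartz_inf[OF c]])
  have dE: "partial_derivs is (E z) y =
      of_real ((- c) ^ length is) * (\<phi> (a + \<epsilon> *\<^sub>R z) * partial_derivs is \<phi> (z - c *\<^sub>R y))" for "is" z y
    unfolding E_def[abs_def] partial_derivs_mult[OF smooth_affine[OF sm]] partial_derivs_affine[OF sm]
    by (simp add: mult_ac)
  have "\<exists>B\<ge>0. \<forall>z y. \<bar>monomial \<gamma> y\<bar> * norm (partial_derivs is (E z) y) \<le> B" for \<gamma> "is"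
  proof -
    define N where "N = sum \<gamma> UNIV"
    obtain K1 where K1: "0 \<le> K1" "\<And>z y. (1 + norm y) ^ N * norm (partial_derivs is \<phi> (z - c *\<^sub>R y)) \<le> K1 * (1 + norm z) ^ N"
      using affine_decay[OF \<phi> c] by metis
    \<comment> \<open>\<open>affine_decay\<close> is applied to the cutoff with \<open>a\<close> as
      the fixed point and -z as the variable: its decay in z cancels the factor (1 + |z|)^N left by
      K1, so the final bound is uniform in z.\<close>
    obtain K2 where K2: "0 \<le> K2" "\<And>z y. (1 + norm y) ^ N * norm (partial_derivs [] \<phi> (z - \<epsilon> *\<^sub>R y)) \<le> K2 * (1 + norm z) ^ N"
      using affine_decay[OF \<phi> \<epsilon>(1)] by metis
    have "\<bar>monomial \<gamma> y\<bar> * norm (partial_derivs is (E z) y) \<le> c ^ length is * (K1 * (K2 * (1 + norm a) ^ N))" for z y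
    proof -
      have "\<bar>monomial \<gamma> y\<bar> \<le> (1 + norm y) ^ N"
        unfolding N_def by (rule order_trans[OF abs_monomial_le]) (auto intro: power_mono)
      then have "\<bar>monomial \<gamma> y\<bar> * norm (partial_derivs is (E z) y) \<le> (1 + norm y) ^ N * norm (partial_derivs is (E z) y)"
        by (intro mult_right_mono) auto
      also have "\<dots> = c ^ length is * (norm (\<phi> (a + \<epsilon> *\<^sub>R z)) * ((1 + norm y) ^ N * norm (partial_derivs is \<phi> (z - c *\<^sub>R y))))"
        using c by (simp add: dE norm_mult norm_power)
      also have "\<dots> \<le> c ^ length is * (norm (\<phi> (a + \<epsilon> *\<^sub>R z)) * (K1 * (1 + norm z) ^ N))"
        using c by (intro mult_left_mono K1) auto
      also have "\<dots> = c ^ length is * (K1 * ((1 + norm (- z)) ^ N * norm (partial_derivs [] \<phi> (a - \<epsilon> *\<^sub>R (- z)))))"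
        by simp
      also have "\<dots> \<le> c ^ length is * (K1 * (K2 * (1 + norm a) ^ N))"
        using c K1(1) by (intro mult_left_mono K2) auto
      finally show ?thesis .
    qed
    then show ?thesis using c K1 K2
      by (intro exI[of _ "c ^ length is * (K1 * (K2 * (1 + norm a) ^ N))"]) auto
  qed
  then obtain Bf where Bf: "\<And>\<gamma> is. 0 \<le> Bf \<gamma> is"
    "\<And>\<gamma> is z y. \<bar>monomial \<gamma> y\<bar> * norm (partial_derivs is (E z) y) \<le> Bf \<gamma> is" by metis
  define B where "B = (\<Sum>(\<gamma>, is)\<in>P. Bf \<gamma> is)"
  have B0: "0 \<le> B" unfolding B_def using Bf(1) by (intro sum_nonneg) auto
  have B: "\<bar>monomial \<gamma> y\<bar> * norm (partial_derivs is (E z) y) \<le> B" if "(\<gamma>, is) \<in> P" for \<gamma> "is" z y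
  proof -
    have "Bf \<gamma> is \<le> B"
      unfolding B_def using member_le_sum[OF that, of "\<lambda>(\<gamma>, is). Bf \<gamma> is"] Bf(1) P(1) by auto
    then show ?thesis using Bf(2)[of \<gamma> y "is" z] by linarith
  qed
  have "norm (V z) \<le> K * B" for z
    unfolding fE[symmetric] by (intro bnd E B0 B)
  moreover have "sampled \<beta> v (K * B) V" if \<beta>: "0 \<le> \<beta>" "\<beta> \<le> 1" and v: "norm v \<le> 1 / 8" for \<beta> v
    unfolding sampled_def
  proof (intro allI)
    fix M x
    let ?T = "sampling_error \<beta> v M x"
    note comb = fin_comb_schwartz_inf[where T="?T" and E=E and f=f,
      OF fin_comb_sampling_error E schwartz_inf_dual_linear[OF f], unfolded fE]
    note g1 = comb[THEN conjunct1]
    have g2: "f (\<lambda>y. ?T (\<lambda>z. E z y)) = ?T V"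
      by (rule comb[THEN conjunct2, THEN conjunct1])
    have g3: "partial_derivs is (\<lambda>y. ?T (\<lambda>z. E z y)) y = ?T (\<lambda>z. partial_derivs is (E z) y)" for "is" y
      by (rule fun_cong[OF comb[THEN conjunct2, THEN conjunct2, THEN spec]])
    have "norm (f (\<lambda>y. ?T (\<lambda>z. E z y))) \<le> K * (B * coeff_tail \<beta> M)"
    proof (rule bnd[OF g1])
      show "0 \<le> B * coeff_tail \<beta> M" using B0 coeff_tail_nonneg[OF \<beta>] by simp
      \<comment> \<open>The seminorm of the combined test function is estimated for each y
        separately. As a function of z the weighted derivative at y is a band-limited product, hence
        \<open>sampled\<close> with some constant depending on y. Since it is also bounded by B for
        all z, that constant can be exchanged for B, and the estimate becomes uniform in y.\<close>
      fix \<gamma> "is" y assume in_P: "(\<gamma>, is) \<in> P"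
      \<comment> \<open>Both factors have frequencies of size at most 2, their product at most 4,
        and 4 / 8 < pi / 2.\<close>
      have "norm v * (2 * 2) < pi / 2" using v pi_ge_two by simp
      from sampled_band_limited_product[OF \<beta> schwartz_band_limited[OF \<phi> fourier_outer]
        band_limited_partial_derivs[OF sm schwartz_band_limited[OF \<phi> fourier_outer]] _ less_imp_le[OF \<epsilon>(1)] \<epsilon>(2) this,
        where a=a and w="c *\<^sub>R y"]
      obtain A where "sampled \<beta> v A (\<lambda>z. \<phi> (a + \<epsilon> *\<^sub>R z) * partial_derivs is \<phi> (z - c *\<^sub>R y))"
        by auto
      from sampled_mult[OF \<beta> this, of "of_real (monomial \<gamma> y) * of_real ((- c) ^ length is)"]
      have "sampled \<beta> v (norm (of_real (monomial \<gamma> y) * of_real ((- c) ^ length is) :: complex) * A)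
         (\<lambda>z. of_real (monomial \<gamma> y) * partial_derivs is (E z) y)"
        by (simp only: dE mult.assoc)
      from sampled_sup_bound[OF \<beta> this, of B]
      have "sampled \<beta> v B (\<lambda>z. of_real (monomial \<gamma> y) * partial_derivs is (E z) y)"
        using B[OF in_P] by (simp add: norm_mult)
      then have "norm (?T (\<lambda>z. of_real (monomial \<gamma> y) * partial_derivs is (E z) y)) \<le> B * coeff_tail \<beta> M"
        by (simp add: sampled_def)
      then show "\<bar>monomial \<gamma> y\<bar> * norm (partial_derivs is (\<lambda>y. ?T (\<lambda>z. E z y)) y) \<le> B * coeff_tail \<beta> M"
        by (simp only: g3 fin_comb_mult[OF fin_comb_sampling_error]) (simp add: norm_mult)
    qed
    then show "norm (?T V) \<le> K * B * coeff_tail \<beta> M" by (simp only: g2 mult.assoc)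
  qed
  ultimately show ?thesis by blast
qed

text \<open>The path from x to z changes one coordinate at a time, whence the factor n. A step t
  along an axis is the symmetric difference about its midpoint with |v| = 1/8 and \<beta> = 4 |t|;
  the condition \<beta> \<le> 1 is the origin of r \<le> 1/4.\<close>

lemma cutoff_modulus:
  fixes a :: "real^'n"
  assumes f: "f \<in> schwartz_inf_dual" and c: "0 < c" and \<epsilon>: "0 < \<epsilon>" "\<epsilon> \<le> 1"
  defines "V \<equiv> \<lambda>z. \<phi> (a + \<epsilon> *\<^sub>R z) * f (\<lambda>y. \<phi> (z - c *\<^sub>R y))"
  assumes A: "\<And>z. norm (V z) \<le> A" and r: "r \<le> 1/4" and zx: "\<And>i. \<bar>z $ i - x $ i\<bar> \<le> r"
  shows "norm (V z - V x) \<le> real CARD('n) * (4 * pi * r * A)"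
proof -
  have A0: "0 \<le> A" using A norm_ge_zero order_trans by blast
  have r0: "0 \<le> r" using zx[of undefined] by simp
  from cutoff_sampled[OF f c \<epsilon>, of a, folded V_def]
  obtain A' where A': "\<And>\<beta> v. 0 \<le> \<beta> \<Longrightarrow> \<beta> \<le> 1 \<Longrightarrow> norm v \<le> 1 / 8 \<Longrightarrow> sampled \<beta> v A' V"
    by blast
  have step: "norm (V (w + t *\<^sub>R axis i 1) - V w) \<le> 4 * pi * r * A" if t: "\<bar>t\<bar> \<le> r" for w t i
  proof -
    define v :: "real^'n" where "v = (sgn t / 8) *\<^sub>R axis i 1"
    have \<beta>: "0 \<le> 4 * \<bar>t\<bar>" "4 * \<bar>t\<bar> \<le> 1" using t r by auto
    have "norm v \<le> 1 / 8" by (simp add: v_def sgn_real_def)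
    from sampled_modulus[OF \<beta> A'[OF \<beta> this] A, of "w + (t / 2) *\<^sub>R axis i 1"]
    have "norm (V (w + (t / 2) *\<^sub>R axis i 1 + (4 * \<bar>t\<bar>) *\<^sub>R v) - V (w + (t / 2) *\<^sub>R axis i 1 - (4 * \<bar>t\<bar>) *\<^sub>R v))
      \<le> pi * (4 * \<bar>t\<bar>) * A" .
    also have "(4 * \<bar>t\<bar>) *\<^sub>R v = (t / 2) *\<^sub>R axis i 1"
      by (simp add: v_def sgn_real_def)
    also have "w + (t / 2) *\<^sub>R axis i 1 + (t / 2) *\<^sub>R axis i 1 = w + t *\<^sub>R axis i 1"
      by (simp add: add.assoc flip: scaleR_add_left)
    also have "pi * (4 * \<bar>t\<bar>) * A \<le> pi * (4 * r) * A"
      using t A0 by (intro mult_right_mono mult_left_mono) auto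
    finally show ?thesis by (simp add: mult_ac)
  qed
  define X where "X J = (\<chi> i. if i \<in> J then z $ i else x $ i)" for J
  have "norm (V (X J) - V x) \<le> real (card J) * (4 * pi * r * A)" if "finite J" for J
    using that
  proof (induction J)
    case empty
    have "X {} = x" by (simp add: X_def vec_eq_iff)
    then show ?case by simp
  next
    case (insert i J)
    have "X (insert i J) = X J + (z $ i - x $ i) *\<^sub>R axis i 1"
      using insert.hyps by (auto simp: X_def vec_eq_iff axis_def)
    then have "norm (V (X (insert i J)) - V (X J)) \<le> 4 * pi * r * A"
      using step[OF zx] by simp
    moreover have "norm (V (X (insert i J)) - V x) \<le> norm (V (X (insert i J)) - V (X J)) + norm (V (X J) - V x)"
      using norm_triangle_ineq[of "V (X (insert i J)) - V (X J)" "V (X J) - V x"] by simp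
    ultimately show ?case using insert by (simp add: algebra_simps)
  qed
  from this[of UNIV] show ?thesis by (simp add: X_def)
qed

lemma isCont_phi: "isCont \<phi> x"
  using smooth_continuous[of \<phi> "[]"] \<phi> by (auto simp: schwartz_def continuous_on_eq_continuous_at)

lemma cutoff_continuous:
  assumes f: "f \<in> schwartz_inf_dual" and c: "0 < c" and \<epsilon>: "0 < \<epsilon>" "\<epsilon> \<le> 1"
  shows "continuous_on UNIV (\<lambda>z. \<phi> (a + \<epsilon> *\<^sub>R z) * f (\<lambda>y. \<phi> (z - c *\<^sub>R y)))"
proof -
  define V where "V = (\<lambda>z. \<phi> (a + \<epsilon> *\<^sub>R z) * f (\<lambda>y. \<phi> (z - c *\<^sub>R y)))"
  obtain A where A: "\<And>z. norm (V z) \<le> A"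
    using cutoff_sampled[OF f c \<epsilon>, of a] unfolding V_def by metis
  have "isCont V x" for x
    unfolding isCont_def
  proof (rule LIM_zero_cancel, rule Lim_null_comparison)
    have "\<forall>\<^sub>F z in at x. norm (z - x) < 1 / 4"
      by (auto simp: eventually_at dist_norm intro!: exI[of _ "1/4"])
    then show "\<forall>\<^sub>F z in at x. norm (V z - V x) \<le> real CARD('n) * (4 * pi * norm (z - x) * A)"
    proof eventually_elim
      case (elim z)
      have "\<bar>z $ i - x $ i\<bar> \<le> norm (z - x)" for i using component_le_norm_cart[of "z - x" i] by simp
      then show ?case
        using elim A cutoff_modulus[OF f c \<epsilon>, of a A "norm (z - x)" z x] unfolding V_def by auto
    qed
    have "((\<lambda>z. real CARD('n) * (4 * pi * norm (z - x) * A)) \<longlongrightarrow> real CARD('n) * (4 * pi * norm (x - x) * A)) (at x)"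
      by (intro tendsto_intros)
    then show "((\<lambda>z. real CARD('n) * (4 * pi * norm (z - x) * A)) \<longlongrightarrow> 0) (at x)" by simp
  qed
  then show ?thesis unfolding V_def by (simp add: continuous_on_eq_continuous_at)
qed

context
  fixes a assumes a: "\<phi> a \<noteq> 0"
begin

text \<open>As \<epsilon> \<rightarrow> 0 the continuous products with the cutoff converge pointwise
  to \<open>\<phi> a\<close> times the function, and \<open>\<phi> a\<close> can be divided
  out.\<close>

lemma convolution_measurable:
  assumes f: "f \<in> schwartz_inf_dual" and c: "0 < c"
  shows "(\<lambda>z. f (\<lambda>y. \<phi> (z - c *\<^sub>R y))) \<in> borel_measurable borel"
proof -
  define T where "T m = inverse (real (Suc m))" for m
  have T: "T \<longlonglongrightarrow> 0" "\<And>m. 0 < T m" "\<And>m. T m \<le> 1"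
    unfolding T_def using LIMSEQ_inverse_real_of_nat by (auto simp: field_simps)
  have "(\<lambda>z. \<phi> a * f (\<lambda>y. \<phi> (z - c *\<^sub>R y))) \<in> borel_measurable borel"
  proof (rule borel_measurable_LIMSEQ_metric)
    show "(\<lambda>z. \<phi> (a + T m *\<^sub>R z) * f (\<lambda>y. \<phi> (z - c *\<^sub>R y))) \<in> borel_measurable borel" for m
      by (intro borel_measurable_continuous_onI cutoff_continuous f c T)
    show "(\<lambda>m. \<phi> (a + T m *\<^sub>R z) * f (\<lambda>y. \<phi> (z - c *\<^sub>R y))) \<longlonglongrightarrow> \<phi> a * f (\<lambda>y. \<phi> (z - c *\<^sub>R y))" for z
    proof -
      have "(\<lambda>m. a + T m *\<^sub>R z) \<longlonglongrightarrow> a + 0 *\<^sub>R z" by (intro tendsto_intros T)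
      then have "(\<lambda>m. \<phi> (a + T m *\<^sub>R z)) \<longlonglongrightarrow> \<phi> a"
        using isCont_phi by (intro isCont_tendsto_compose[of a \<phi>]) auto
      then show ?thesis by (intro tendsto_intros)
    qed
  qed
  then have "(\<lambda>z. inverse (\<phi> a) * (\<phi> a * f (\<lambda>y. \<phi> (z - c *\<^sub>R y)))) \<in> borel_measurable borel"
    by measurable
  then show ?thesis using a by (simp add: mult.assoc[symmetric])
qed

text \<open>The order of quantifiers is the content: \<open>\<kappa>\<close> and \<open>r\<close>
  are fixed before \<open>f\<close>, \<open>c\<close> and \<open>z0\<close>. The parameter
  \<epsilon> of the cutoff may depend on \<open>z0\<close>, because it enters neither constant. The
  centre \<open>x0\<close> depends on everything and need not be near \<open>z0\<close>.\<close>

lemma convolution_lower_bound_on_box: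
  "\<exists>\<kappa> r. 0 < \<kappa> \<and> 0 < r \<and> r \<le> 1/4 \<and>
    (\<forall>f\<in>schwartz_inf_dual. \<forall>c>0. \<forall>z0. \<exists>x0. \<forall>z. (\<forall>i. \<bar>z $ i - x0 $ i\<bar> \<le> r) \<longrightarrow>
      \<kappa> * norm (f (\<lambda>y. \<phi> (z0 - c *\<^sub>R y))) \<le> norm (f (\<lambda>y. \<phi> (z - c *\<^sub>R y))))"
proof -
  obtain S where S: "\<And>x. (1 + norm x) ^ 0 * norm (partial_derivs [] \<phi> x) \<le> S"
    using schwartz_decay[OF \<phi>] by metis
  then have S: "norm (\<phi> x) \<le> S" for x by simp
  have S0: "0 < S" using S[of a] a by (metis less_le_trans zero_less_norm_iff)
  \<comment> \<open>With A the supremum of |V|, the chain is |\<phi> a| / 2 * |U z0| \<le> |V z0|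
    \<le> A, then A / 4 \<le> |V z| on the box, and |V z| \<le> S |U z|. The choice of
    \<open>r\<close> below makes the oscillation n 4 pi r A of V equal to A / 4.\<close>
  define \<kappa> where "\<kappa> = norm (\<phi> a) / (8 * S)"
  define r where "r = 1 / (16 * pi * real CARD('n))"
  have n: "real CARD('n) \<ge> 1" by (simp add: Suc_leI)
  have "4 * 1 \<le> (16 * pi) * real CARD('n)" using n pi_ge_two by (intro mult_mono) auto
  then have r: "0 < r" "r \<le> 1/4" "real CARD('n) * (4 * pi * r * A) = A / 4" for A
    using n by (auto simp: r_def field_simps)
  show ?thesis
  proof (rule exI[of _ \<kappa>], rule exI[of _ r], intro conjI ballI allI impI r(1,2))
    show "0 < \<kappa>" using a S0 by (simp add: \<kappa>_def)
    fix f :: "(real^'n \<Rightarrow> complex) \<Rightarrow> complex" and c :: real and z0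
    assume f: "f \<in> schwartz_inf_dual" and c: "0 < c"
    define U where "U = (\<lambda>z. f (\<lambda>y. \<phi> (z - c *\<^sub>R y)))"
    show "\<exists>x0. \<forall>z. (\<forall>i. \<bar>z $ i - x0 $ i\<bar> \<le> r) \<longrightarrow>
      \<kappa> * norm (f (\<lambda>y. \<phi> (z0 - c *\<^sub>R y))) \<le> norm (f (\<lambda>y. \<phi> (z - c *\<^sub>R y)))"
    proof (cases "U z0 = 0")
      case True
      then show ?thesis by (simp add: U_def)
    next
      case False
      \<comment> \<open>Continuity of \<open>\<phi>\<close> at \<open>a\<close> lets a small
        \<epsilon> keep at least half of |\<phi> a| in the cutoff at the given point
        \<open>z0\<close>.\<close>
      have "((\<lambda>\<epsilon>. norm (\<phi> (a + \<epsilon> *\<^sub>R z0))) \<longlongrightarrow> norm (\<phi> (a + 0 *\<^sub>R z0))) (at_right 0)"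
        using isCont_phi[of a] by (intro tendsto_norm isCont_tendsto_compose[of _ \<phi>] tendsto_intros) auto
      from order_tendstoD(1)[OF this, of "norm (\<phi> a) / 2"]
      have "\<forall>\<^sub>F \<epsilon> in at_right 0. norm (\<phi> a) / 2 < norm (\<phi> (a + \<epsilon> *\<^sub>R z0))"
        using a by simp
      moreover have "\<forall>\<^sub>F \<epsilon> in at_right (0::real). \<epsilon> \<in> {0<..<1}" by (rule eventually_at_right_real) simp
      ultimately have "\<forall>\<^sub>F \<epsilon> in at_right (0::real). \<epsilon> \<in> {0<..<1} \<and> norm (\<phi> a) / 2 < norm (\<phi> (a + \<epsilon> *\<^sub>R z0))"
        by eventually_elim auto
      from eventually_happens'[OF trivial_limit_at_right_real this]
      obtain \<epsilon> where \<epsilon>: "0 < \<epsilon>" "\<epsilon> \<le> 1" and \<epsilon>a: "norm (\<phi> a) / 2 < norm (\<phi> (a + \<epsilon> *\<^sub>R z0))"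
        by auto
      define V where "V z = \<phi> (a + \<epsilon> *\<^sub>R z) * U z" for z
      from cutoff_sampled[OF f c \<epsilon>, of a] obtain A' where A': "\<And>z. norm (V z) \<le> A'"
        unfolding V_def U_def by blast
      define A where "A = (SUP z. norm (V z))"
      have bdd: "bdd_above (range (\<lambda>z. norm (V z)))" using A' by (auto simp: bdd_above_def)
      have A: "norm (V z) \<le> A" for z unfolding A_def by (intro cSUP_upper bdd) auto
      have "norm (\<phi> a) / 2 * norm (U z0) \<le> norm (V z0)"
        unfolding V_def norm_mult using \<epsilon>a by (intro mult_right_mono) auto
      then have Alow: "norm (\<phi> a) / 2 * norm (U z0) \<le> A" using A[of z0] by linarith
      have "0 < norm (\<phi> a) / 2 * norm (U z0)" using a False by simp
      then have A0: "0 < A" using Alow by linarith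
      \<comment> \<open>The supremum may not be attained; since A > 0, some value exceeds A / 2, and
        losing A / 4 on the box leaves A / 4.\<close>
      then obtain x0 where x0: "A / 2 < norm (V x0)"
        using less_cSUP_iff[OF _ bdd, of "A / 2"] unfolding A_def by auto
      have "\<kappa> * norm (U z0) \<le> norm (U z)" if z: "\<forall>i. \<bar>z $ i - x0 $ i\<bar> \<le> r" for z
      proof -
        have "norm (V z - V x0) \<le> A / 4"
          using cutoff_modulus[OF f c \<epsilon>, of a A r z x0] A r z unfolding V_def U_def by simp
        then have "A / 4 \<le> norm (V z)" using x0 norm_triangle_ineq2[of "V x0" "V z"]
          by (simp add: norm_minus_commute)
        also have "\<dots> \<le> S * norm (U z)" unfolding V_def norm_mult by (intro mult_right_mono S) auto
        finally have "norm (\<phi> a) / 2 * norm (U z0) / 4 \<le> S * norm (U z)" using Alow by linarith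
        then show ?thesis unfolding \<kappa>_def using S0 by (simp add: field_simps)
      qed
      then show ?thesis unfolding U_def by blast
    qed
  qed
qed

end

end

subsection \<open>Comparison of the quasi-norms\<close>

lemma ennreal_powr_ennreal: "0 \<le> x \<Longrightarrow> ennreal_powr (ennreal x) r = ennreal (x powr r)"
  by (simp add: ennreal_powr_def)

lemma ennreal_powr_mono:
  assumes "a \<le> b" "0 \<le> r"
  shows "ennreal_powr a r \<le> ennreal_powr b r"
proof (cases "b = \<infinity>")
  case False
  with assms have "a \<noteq> \<infinity>" by (auto simp: top_unique)
  with False assms show ?thesis
    by (auto simp: ennreal_powr_def less_top intro!: ennreal_leI powr_mono2 enn2real_mono)
qed (auto simp: ennreal_powr_def)

lemma exponent_pos:
  assumes "0 < (p :: ennreal)" "p \<noteq> \<infinity>"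
  shows "0 < enn2real p"
  using assms by (simp add: enn2real_positive_iff less_top)

text \<open>Restrict the integral to A and use monotonicity only, which is valid for p < 1 as well.
  For p = \<infinity>, if c exceeded the essential supremum then A would be a null set.\<close>

lemma Lp_qnorm_lower:
  fixes A P :: "(real^'n::finite) set"
  assumes p: "0 < p" and [measurable]: "A \<in> sets borel" "P \<in> sets borel" and AP: "A \<subseteq> P"
    and m: "emeasure lborel A = ennreal m" "0 < m" and c: "0 \<le> c" and g: "\<And>x. x \<in> A \<Longrightarrow> ennreal c \<le> g x"
  shows "ennreal (c * m powr recip p) \<le> Lp_qnorm p P g"
proof (cases "p = \<infinity>")
  case True
  let ?e = "esssup (restrict_space lborel P) g"
  have ae: "AE x in lborel. x \<in> P \<longrightarrow> g x \<le> ?e"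
    using esssup_AE[of g "restrict_space lborel P"] by (subst (asm) AE_restrict_space_iff) auto
  have "ennreal c \<le> ?e"
  proof (rule ccontr)
    assume n: "\<not> ennreal c \<le> ?e"
    have "AE x in lborel. x \<notin> A"
      using ae by (rule AE_mp) (use n g AP in \<open>auto intro!: AE_I2 dest: order_trans\<close>)
    then have "emeasure lborel A = 0" by (simp add: AE_iff_measurable[OF _ refl])
    then show False using m by simp
  qed
  then show ?thesis using True m by (simp add: Lp_qnorm_def recip_def)
next
  case False
  define r where "r = enn2real p"
  have r: "0 < r" unfolding r_def using p False by (rule exponent_pos)
  have "ennreal (c powr r * m) = (\<integral>\<^sup>+x\<in>A. ennreal (c powr r) \<partial>lborel)"
    using m by (simp add: nn_integral_cmult_indicator ennreal_mult)
  also have "\<dots> \<le> (\<integral>\<^sup>+x\<in>P. ennreal_powr (g x) r \<partial>lborel)"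
  proof (intro nn_integral_mono)
    fix x
    have "ennreal (c powr r) \<le> ennreal_powr (g x) r" if "x \<in> A"
      using ennreal_powr_mono[OF g[OF that], of r] r c by (simp add: ennreal_powr_ennreal)
    then show "ennreal (c powr r) * indicator A x \<le> ennreal_powr (g x) r * indicator P x"
      using AP by (auto simp: indicator_def)
  qed
  finally have "ennreal_powr (ennreal (c powr r * m)) (1 / r) \<le>
      ennreal_powr (\<integral>\<^sup>+x\<in>P. ennreal_powr (g x) r \<partial>lborel) (1 / r)"
    using r by (intro ennreal_powr_mono) auto
  moreover have "(c powr r * m) powr (1 / r) = c * m powr (1 / r)"
    using r c m by (simp add: powr_mult powr_powr)
  ultimately show ?thesis
    using False m c by (simp add: Lp_qnorm_def recip_def ennreal_powr_ennreal r_def)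
qed

text \<open>Measurability enters for p = \<infinity> because \<open>esssup\<close> takes the value
  top on functions that are not measurable.\<close>

lemma Lp_qnorm_upper:
  fixes P :: "(real^'n::finite) set"
  assumes p: "0 < p" and [measurable]: "P \<in> sets borel"
    and m: "emeasure lborel P = ennreal m" "0 < m" and c: "0 \<le> c"
    and g: "AE x in lborel. x \<in> P \<longrightarrow> g x \<le> ennreal c"
    and meas: "p = \<infinity> \<Longrightarrow> g \<in> borel_measurable (restrict_space lborel P)"
  shows "Lp_qnorm p P g \<le> ennreal (c * m powr recip p)"
proof (cases "p = \<infinity>")
  case True
  have "esssup (restrict_space lborel P) g \<le> ennreal c"
    by (intro esssup_I meas True, subst AE_restrict_space_iff) (use g in auto)
  then show ?thesis using True m by (simp add: Lp_qnorm_def recip_def)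
next
  case False
  define r where "r = enn2real p"
  have r: "0 < r" unfolding r_def using p False by (rule exponent_pos)
  have "(\<integral>\<^sup>+x\<in>P. ennreal_powr (g x) r \<partial>lborel) \<le> (\<integral>\<^sup>+x\<in>P. ennreal (c powr r) \<partial>lborel)"
  proof (intro nn_integral_mono_AE, use g in eventually_elim)
    fix x assume "x \<in> P \<longrightarrow> g x \<le> ennreal c"
    then show "ennreal_powr (g x) r * indicator P x \<le> ennreal (c powr r) * indicator P x"
      using ennreal_powr_mono[of "g x" "ennreal c" r] r c by (auto simp: indicator_def ennreal_powr_ennreal)
  qed
  also have "\<dots> = ennreal (c powr r * m)"
    using m by (simp add: nn_integral_cmult_indicator ennreal_mult)
  finally have "ennreal_powr (\<integral>\<^sup>+x\<in>P. ennreal_powr (g x) r \<partial>lborel) (1 / r) \<le>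
      ennreal_powr (ennreal (c powr r * m)) (1 / r)"
    using r by (intro ennreal_powr_mono) auto
  moreover have "(c powr r * m) powr (1 / r) = c * m powr (1 / r)"
    using r c m by (simp add: powr_mult powr_powr)
  ultimately show ?thesis
    using False m c by (simp add: Lp_qnorm_def recip_def ennreal_powr_ennreal r_def)
qed

lemma lq_qnorm_lower:
  assumes q: "0 < q" and j: "j \<in> J"
  shows "a j \<le> lq_qnorm q J a"
proof (cases "q = \<infinity>")
  case True
  then show ?thesis using j by (simp add: lq_qnorm_def SUP_upper)
next
  case False
  define r where "r = enn2real q"
  have r: "0 < r" unfolding r_def using q False by (rule exponent_pos)
  have "ennreal_powr (a j) r = (\<Sum>\<^sub>\<infinity>j\<in>{j}. ennreal_powr (a j) r)" by simp
  also have "\<dots> \<le> (\<Sum>\<^sub>\<infinity>j\<in>J. ennreal_powr (a j) r)"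
    by (intro infsum_mono_neutral nonneg_summable_on_complete) (use j in auto)
  finally have "ennreal_powr (ennreal_powr (a j) r) (1 / r) \<le> ennreal_powr (\<Sum>\<^sub>\<infinity>j\<in>J. ennreal_powr (a j) r) (1 / r)"
    using r by (intro ennreal_powr_mono) auto
  moreover have "ennreal_powr (ennreal_powr (a j) r) (1 / r) = a j"
    using r by (cases "a j") (auto simp: ennreal_powr_def powr_powr)
  ultimately show ?thesis using False by (simp add: lq_qnorm_def r_def)
qed

text \<open>The two ranges of \<tau> in the theorem separate here. For finite q the powers form a
  geometric series of ratio y = 2^(-d q), which is below 1 exactly when d > 0, and G = (1 / (1 -
  y))^(1/q). For q = \<infinity> the majorant is nonincreasing in j as soon as d \<ge> 0, so its
  first term is the supremum and G = 1.\<close>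

lemma lq_qnorm_geometric:
  assumes q: "0 < q" and d: "q = \<infinity> \<and> 0 \<le> d \<or> q < \<infinity> \<and> 0 < d"
  obtains G where "0 < G"
    "\<And>i c a. 0 \<le> c \<Longrightarrow> (\<And>j. i \<le> j \<Longrightarrow> a j \<le> ennreal (c * 2 powr (- (of_int j * d)))) \<Longrightarrow>
      lq_qnorm q {i..} a \<le> ennreal (c * G * 2 powr (- (of_int i * d)))"
proof (cases "q = \<infinity>")
  case True
  show thesis
  proof (rule that[of 1])
    fix i and c :: real and a
    assume c: "0 \<le> c" and a: "\<And>j. i \<le> j \<Longrightarrow> a j \<le> ennreal (c * 2 powr (- (of_int j * d)))"
    have "a j \<le> ennreal (c * 2 powr (- (of_int i * d)))" if "i \<le> j" for j
    proof -
      have "real_of_int i * d \<le> of_int j * d" using that d True by (intro mult_right_mono) auto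
      then have "c * 2 powr (- (of_int j * d)) \<le> c * 2 powr (- (of_int i * d))"
        using c by (intro mult_left_mono powr_mono) auto
      then show ?thesis using a[OF that] by (meson ennreal_leI order_trans)
    qed
    then show "lq_qnorm q {i..} a \<le> ennreal (c * 1 * 2 powr (- (of_int i * d)))"
      using True by (auto simp: lq_qnorm_def intro!: SUP_least)
  qed simp
next
  case False
  define r where "r = enn2real q"
  have r: "0 < r" unfolding r_def using q False by (rule exponent_pos)
  have d: "0 < d" using d False by auto
  define y where "y = 2 powr (- (d * r))"
  have y: "0 < y" "y < 1" using d r by (auto simp: y_def powr_less_one)
  show thesis
  proof (rule that[of "(1 / (1 - y)) powr (1 / r)"])
    fix i and c :: real and a
    assume c: "0 \<le> c" and a: "\<And>j. i \<le> j \<Longrightarrow> a j \<le> ennreal (c * 2 powr (- (of_int j * d)))"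
    define b where "b = c powr r * 2 powr (- (of_int i * d * r))"
    have b0: "0 \<le> b" by (simp add: b_def)
    have ab: "ennreal_powr (a j) r \<le> ennreal (b * y ^ nat (j - i))" if "i \<le> j" for j
    proof -
      have "ennreal_powr (a j) r \<le> ennreal ((c * 2 powr (- (of_int j * d))) powr r)"
        using ennreal_powr_mono[OF a[OF that], of r] r c by (simp add: ennreal_powr_ennreal)
      also have "(c * 2 powr (- (of_int j * d))) powr r = c powr r * 2 powr (- (of_int j * d * r))"
        using c by (simp add: powr_mult powr_powr)
      also have "2 powr (- (of_int j * d * r)) = 2 powr (- (of_int i * d * r)) * y ^ nat (j - i)"
      proof -
        have "y ^ nat (j - i) = 2 powr (- (d * r) * of_int (j - i))"
          using that y by (simp add: y_def powr_power mult.commute)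
        then show ?thesis by (simp add: algebra_simps flip: powr_add)
      qed
      finally show ?thesis by (simp add: b_def mult_ac)
    qed
    have "(\<Sum>\<^sub>\<infinity>j\<in>{i..}. ennreal_powr (a j) r) \<le> ennreal (b * (1 / (1 - y)))"
    proof (rule infsum_le_finite_sums)
      fix F assume F: "finite F" "F \<subseteq> {i..}"
      have "(\<Sum>j\<in>F. ennreal_powr (a j) r) \<le> (\<Sum>j\<in>F. ennreal (b * y ^ nat (j - i)))"
        using F by (intro sum_mono ab) auto
      also have "\<dots> = ennreal (\<Sum>j\<in>F. b * y ^ nat (j - i))"
        using b0 y by (intro sum_ennreal) auto
      also have "(\<Sum>j\<in>F. b * y ^ nat (j - i)) = b * (\<Sum>n\<in>(\<lambda>j. nat (j - i)) ` F. y ^ n)"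
      proof -
        have "inj_on (\<lambda>j. nat (j - i)) F" using F by (auto simp: inj_on_def subset_iff eq_nat_nat_iff)
        then show ?thesis by (simp add: sum.reindex sum_distrib_left)
      qed
      also have "(\<Sum>n\<in>(\<lambda>j. nat (j - i)) ` F. y ^ n) \<le> (\<Sum>n. y ^ n)"
        using y F by (intro sum_le_suminf summable_geometric) auto
      also have "(\<Sum>n. y ^ n) = 1 / (1 - y)" using y by (intro suminf_geometric) auto
      finally show "(\<Sum>j\<in>F. ennreal_powr (a j) r) \<le> ennreal (b * (1 / (1 - y)))"
        using b0 by (simp add: ennreal_leI mult_left_mono)
    qed (auto intro: nonneg_summable_on_complete)
    then have "ennreal_powr (\<Sum>\<^sub>\<infinity>j\<in>{i..}. ennreal_powr (a j) r) (1 / r) \<le> ennreal ((b * (1 / (1 - y))) powr (1 / r))"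
      using ennreal_powr_mono[of _ "ennreal (b * (1 / (1 - y)))" "1 / r"] r b0 y
      by (simp add: ennreal_powr_ennreal)
    also have "(b * (1 / (1 - y))) powr (1 / r) = b powr (1 / r) * (1 / (1 - y)) powr (1 / r)"
      by (rule powr_mult)
    also have "b powr (1 / r) = c * 2 powr (- (of_int i * d))"
      using c r by (simp add: b_def powr_mult powr_powr)
    finally show "lq_qnorm q {i..} a \<le> ennreal (c * (1 / (1 - y)) powr (1 / r) * 2 powr (- (of_int i * d)))"
      using False by (simp add: lq_qnorm_def r_def mult_ac)
  qed (use y in auto)
qed

section \<open>Dyadic cubes and boxes inside them\<close>

lemma mem_dyadic_cube:
  "x \<in> dyadic_cube i k \<longleftrightarrow> (\<forall>l. of_int (k $ l) \<le> 2 powr of_int i * x $ l \<and> 2 powr of_int i * x $ l < of_int (k $ l) + 1)"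
proof -
  have pos: "0 < (2::real) powi i" and inv: "(2::real) powi (- i) = inverse (2 powi i)"
    by (simp_all add: power_int_minus)
  have "x \<in> dyadic_cube i k \<longleftrightarrow> (\<forall>l. of_int (k $ l) \<le> 2 powi i * x $ l \<and> 2 powi i * x $ l < of_int (k $ l) + 1)"
  proof
    assume "x \<in> dyadic_cube i k"
    then obtain u where u: "x = 2 powi (- i) *\<^sub>R (u + (\<chi> i. of_int (k $ i)))" "\<And>l. 0 \<le> u $ l" "\<And>l. u $ l < 1"
      by (auto simp: dyadic_cube_def)
    have "2 powi i * x $ l = (2 powi i * inverse (2 powi i)) * (u $ l + of_int (k $ l))" for l
      by (simp only: u(1) inv vector_scaleR_component vector_add_component vec_lambda_beta
          real_scaleR_def mult.assoc)
    then have "2 powi i * x $ l = u $ l + of_int (k $ l)" for l using pos by simp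
    then show "\<forall>l. of_int (k $ l) \<le> 2 powi i * x $ l \<and> 2 powi i * x $ l < of_int (k $ l) + 1"
      using u(2,3) by simp
  next
    assume r: "\<forall>l. of_int (k $ l) \<le> 2 powi i * x $ l \<and> 2 powi i * x $ l < of_int (k $ l) + 1"
    show "x \<in> dyadic_cube i k"
      unfolding dyadic_cube_def
    proof (rule image_eqI[of _ _ "2 powi i *\<^sub>R x - (\<chi> l. of_int (k $ l))"])
      show "x = 2 powi (- i) *\<^sub>R (2 powi i *\<^sub>R x - (\<chi> l. of_int (k $ l)) + (\<chi> l. of_int (k $ l)))"
        using pos by (simp add: inv)
      show "2 powi i *\<^sub>R x - (\<chi> l. of_int (k $ l)) \<in> {x. \<forall>i. 0 \<le> x $ i \<and> x $ i < 1}"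
        using r by (auto simp: algebra_simps)
    qed
  qed
  then show ?thesis by (simp add: powr_real_of_int')
qed

lemma dyadic_cube_measurable [measurable]: "dyadic_cube i k \<in> sets borel"
proof -
  have "dyadic_cube i k = {x \<in> space borel. \<forall>l. of_int (k $ l) \<le> 2 powr of_int i * x $ l \<and> 2 powr of_int i * x $ l < of_int (k $ l) + 1}"
    by (auto simp: mem_dyadic_cube)
  also have "\<dots> \<in> sets borel" by measurable
  finally show ?thesis .
qed

lemma emeasure_box_cart_const:
  fixes a :: "real^'n::finite"
  assumes h: "0 \<le> h"
  shows "emeasure lborel (box a (\<chi> l. a $ l + h)) = ennreal (h ^ CARD('n))"
    and "emeasure lborel (cbox a (\<chi> l. a $ l + h)) = ennreal (h ^ CARD('n))"
proof -
  have e: "((\<chi> l. a $ l + h) - a) \<bullet> b = h" if "b \<in> Basis" for b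
    using that by (auto simp: Basis_vec_def inner_axis)
  have le: "a \<bullet> b \<le> (\<chi> l. a $ l + h) \<bullet> b" if "b \<in> Basis" for b
    using e[OF that] h by (simp add: inner_diff_left)
  show "emeasure lborel (box a (\<chi> l. a $ l + h)) = ennreal (h ^ CARD('n))"
    using le by (simp add: e)
  show "emeasure lborel (cbox a (\<chi> l. a $ l + h)) = ennreal (h ^ CARD('n))"
    using le by (simp add: e emeasure_lborel_cbox)
qed

text \<open>The half-open cube is squeezed between an open and a closed box of the same
  measure.\<close>

lemma emeasure_dyadic_cube:
  "emeasure lborel (dyadic_cube i k :: (real^'n::finite) set) = ennreal (2 powr (- (of_int i * real CARD('n))))"
proof -
  define h where "h = 2 powr (- real_of_int i)"
  have h: "0 < h" "2 powr real_of_int i = 1 / h" by (auto simp: h_def powr_minus field_simps)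
  define a :: "real^'n" where "a = (\<chi> l. of_int (k $ l) * h)"
  have hn: "2 powr (- (of_int i * real CARD('n))) = h ^ CARD('n)"
    by (simp add: h_def powr_power mult.commute)
  have "box a (\<chi> l. a $ l + h) \<subseteq> dyadic_cube i k"
  proof
    fix x assume "x \<in> box a (\<chi> l. a $ l + h)"
    then have "of_int (k $ l) * h < x $ l" "x $ l < (of_int (k $ l) + 1) * h" for l
      by (auto simp: a_def mem_box_cart algebra_simps)
    then show "x \<in> dyadic_cube i k"
      unfolding mem_dyadic_cube h(2) using h(1)
      by (simp add: pos_le_divide_eq pos_divide_less_eq less_imp_le)
  qed
  then have "emeasure lborel (box a (\<chi> l. a $ l + h)) \<le> emeasure lborel (dyadic_cube i k)"
    by (intro emeasure_mono) auto
  moreover have "dyadic_cube i k \<subseteq> cbox a (\<chi> l. a $ l + h)"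
  proof
    fix x :: "real^'n" assume "x \<in> dyadic_cube i k"
    then have "of_int (k $ l) * h \<le> x $ l" "x $ l < (of_int (k $ l) + 1) * h" for l
      unfolding mem_dyadic_cube h(2) using h(1)
      by (simp_all add: pos_le_divide_eq pos_divide_less_eq)
    then show "x \<in> cbox a (\<chi> l. a $ l + h)"
      by (simp add: a_def mem_box_cart algebra_simps less_imp_le)
  qed
  then have "emeasure lborel (dyadic_cube i k) \<le> emeasure lborel (cbox a (\<chi> l. a $ l + h))"
    by (intro emeasure_mono) auto
  ultimately show ?thesis
    using h by (simp add: emeasure_box_cart_const hn)
qed

lemma measure_dyadic_cube_powr:
  "measure lborel (dyadic_cube i k :: (real^'n::finite) set) powr \<tau> = 2 powr (- (of_int i * real CARD('n) * \<tau>))"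
  by (simp add: measure_def emeasure_dyadic_cube powr_powr)

text \<open>After scaling by 2^i the cubes are unit cubes with integer corners. A box centred at
  \<open>x0\<close> could straddle several of them, so in each coordinate only one side of
  \<open>x0\<close> is kept.\<close>

lemma box_in_dyadic_cube:
  fixes x0 :: "real^'n::finite"
  assumes r: "0 < r" "r \<le> 1/2"
  shows "\<exists>k A. A \<in> sets borel \<and> A \<subseteq> dyadic_cube i k \<and>
    emeasure lborel A = ennreal (r ^ CARD('n) * 2 powr (- (of_int i * real CARD('n)))) \<and>
    (\<forall>x\<in>A. \<forall>l. \<bar>2 powr of_int i * x $ l - x0 $ l\<bar> \<le> r)"
proof -
  define h where "h = 2 powr (- real_of_int i)"
  have h: "0 < h" "2 powr real_of_int i = 1 / h" by (auto simp: h_def powr_minus field_simps)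
  define k :: "int^'n" where "k = (\<chi> l. \<lfloor>x0 $ l\<rfloor>)"
  \<comment> \<open>The left end of an interval of length r that has \<open>x0\<close> as an end
    point: it extends to the right unless that would pass the next integer, and then the left side
    fits because 2 r \<le> 1.\<close>
  define b where "b l = (if x0 $ l + r \<le> of_int (k $ l) + 1 then x0 $ l else x0 $ l - r)" for l
  have b: "of_int (k $ l) \<le> b l" "b l + r \<le> of_int (k $ l) + 1" "x0 $ l - r \<le> b l" "b l \<le> x0 $ l" for l
    using r floor_correct[of "x0 $ l"] unfolding b_def k_def by auto
  define a :: "real^'n" where "a = (\<chi> l. b l * h)"
  define A where "A = box a (\<chi> l. a $ l + r * h)"
  have A: "b l < 2 powr real_of_int i * x $ l" "2 powr real_of_int i * x $ l < b l + r" if "x \<in> A" for x l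
  proof -
    have "b l * h < x $ l" "x $ l < (b l + r) * h"
      using that by (auto simp: A_def a_def mem_box_cart algebra_simps)
    then show "b l < 2 powr real_of_int i * x $ l" "2 powr real_of_int i * x $ l < b l + r"
      unfolding h(2) using h(1) by (simp_all add: pos_less_divide_eq pos_divide_less_eq)
  qed
  show ?thesis
  proof (rule exI[of _ k], rule exI[of _ A], intro conjI ballI allI)
    show "A \<in> sets borel" by (simp add: A_def)
    show "A \<subseteq> dyadic_cube i k"
    proof
      fix x assume x: "x \<in> A"
      have "of_int (k $ l) \<le> 2 powr of_int i * x $ l \<and> 2 powr of_int i * x $ l < of_int (k $ l) + 1" for l
        using A[OF x, of l] b[of l] by linarith
      then show "x \<in> dyadic_cube i k" by (simp add: mem_dyadic_cube)
    qed
    have "emeasure lborel A = ennreal ((r * h) ^ CARD('n))"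
      unfolding A_def using r h by (intro emeasure_box_cart_const) auto
    then show "emeasure lborel A = ennreal (r ^ CARD('n) * 2 powr (- (of_int i * real CARD('n))))"
      by (simp add: power_mult_distrib h_def powr_power mult.commute)
    show "\<bar>2 powr of_int i * x $ l - x0 $ l\<bar> \<le> r" if "x \<in> A" for x l
      using A[OF that, of l] b[of l] r by linarith
  qed
qed

section \<open>The quasi-norm with both indices infinite\<close>

lemma restrict_space_UNIV_lborel: "restrict_space lborel UNIV = lborel"
  by (intro measure_eqI) (auto simp: sets_restrict_space emeasure_restrict_space)

text \<open>Bounds at every point pass to the essential supremum, for which measurability is
  supplied; the weight is positive and finite, so it can be moved across even when N is
  infinite.\<close>

lemma inf_inf_norm_le:
  fixes \<phi> :: "real^'n::finite \<Rightarrow> complex"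
  assumes c: "0 < c" and meas: "\<And>j. conv (dilate \<phi> j) f \<in> borel_measurable borel"
    and bnd: "\<And>j x. ennreal (c * 2 powr (of_int j * \<sigma>) * norm (conv (dilate \<phi> j) f x)) \<le> N"
  shows "ennreal c * inf_inf_norm \<phi> \<sigma> f \<le> N"
proof -
  have "ennreal c * (ennreal (2 powr (of_int j * \<sigma>)) *
     Lp_qnorm \<infinity> UNIV (\<lambda>x. ennreal (norm (conv (dilate \<phi> j) f x)))) \<le> N" for j
  proof -
    define w where "w = c * 2 powr (of_int j * \<sigma>)"
    have w: "0 < w" using c by (simp add: w_def)
    have [measurable]: "conv (dilate \<phi> j) f \<in> borel_measurable borel" by (rule meas)
    have "ennreal (norm (conv (dilate \<phi> j) f x)) \<le> N / ennreal w" for x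
    proof -
      have "ennreal (norm (conv (dilate \<phi> j) f x)) = ennreal w * ennreal (norm (conv (dilate \<phi> j) f x)) / ennreal w"
        using w by (subst mult.commute) (simp add: mult_divide_eq_ennreal)
      also have "\<dots> \<le> N / ennreal w"
        using bnd[of j x] w by (intro divide_right_mono_ennreal) (simp add: w_def ennreal_mult)
      finally show ?thesis .
    qed
    then have "Lp_qnorm \<infinity> UNIV (\<lambda>x. ennreal (norm (conv (dilate \<phi> j) f x))) \<le> N / ennreal w"
      by (auto simp: Lp_qnorm_def restrict_space_UNIV_lborel intro!: esssup_I)
    then have "ennreal w * Lp_qnorm \<infinity> UNIV (\<lambda>x. ennreal (norm (conv (dilate \<phi> j) f x))) \<le> ennreal w * (N / ennreal w)"
      by (rule mult_left_mono) simp
    also have "\<dots> = N" using w by (simp add: ennreal_times_divide mult.commute[of _ N] mult_divide_eq_ennreal)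
    finally show ?thesis using c by (simp add: w_def ennreal_mult mult.assoc)
  qed
  then show ?thesis unfolding inf_inf_norm_def SUP_mult_left_ennreal by (rule SUP_least)
qed

text \<open>There are countably many levels j, so one null set serves all of them. This is what the
  Triebel-Lizorkin-type quasi-norm requires, since its inner sum involves all j \<ge> j_P at the
  same point x.\<close>

lemma inf_inf_norm_AE:
  fixes \<phi> :: "real^'n::finite \<Rightarrow> complex"
  assumes "inf_inf_norm \<phi> \<sigma> f \<le> ennreal m" and m: "0 \<le> m"
  shows "AE x in lborel. \<forall>j. norm (conv (dilate \<phi> j) f x) \<le> m * 2 powr (- (of_int j * \<sigma>))"
proof (subst AE_all_countable, rule allI)
  fix j
  let ?e = "Lp_qnorm \<infinity> UNIV (\<lambda>x. ennreal (norm (conv (dilate \<phi> j) f x)))"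
  have "ennreal (2 powr (of_int j * \<sigma>)) * ?e \<le> ennreal m"
    using assms(1) unfolding inf_inf_norm_def by (rule order_trans[rotated]) (rule SUP_upper, simp)
  then have "ennreal (2 powr (- (of_int j * \<sigma>))) * (ennreal (2 powr (of_int j * \<sigma>)) * ?e) \<le> ennreal (2 powr (- (of_int j * \<sigma>))) * ennreal m"
    by (rule mult_left_mono) simp
  also have "ennreal (2 powr (- (of_int j * \<sigma>))) * (ennreal (2 powr (of_int j * \<sigma>)) * ?e) = ?e"
  proof -
    have "ennreal (2 powr (- (of_int j * \<sigma>))) * ennreal (2 powr (of_int j * \<sigma>)) = 1"
      by (simp flip: ennreal_mult powr_add)
    then show ?thesis by (simp add: mult.assoc[symmetric])
  qed
  finally have e: "?e \<le> ennreal (m * 2 powr (- (of_int j * \<sigma>)))"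
    using m by (simp add: ennreal_mult mult.commute)
  have "AE x in lborel. ennreal (norm (conv (dilate \<phi> j) f x)) \<le> ?e"
    using esssup_AE[of "\<lambda>x. ennreal (norm (conv (dilate \<phi> j) f x))" lborel]
    by (simp add: Lp_qnorm_def restrict_space_UNIV_lborel)
  then show "AE x in lborel. norm (conv (dilate \<phi> j) f x) \<le> m * 2 powr (- (of_int j * \<sigma>))"
  proof eventually_elim
    case (elim x)
    from order_trans[OF this e] m show ?case by simp
  qed
qed

text \<open>The two estimates are assumed on the whole dual with infinite values allowed, so they
  also show that both quasi-norms are finite on the same functionals.\<close>

lemma equal_with_equivalent_normsI:
  assumes c: "0 < c" and C: "0 < C"
    and 1: "\<And>f. f \<in> schwartz_inf_dual \<Longrightarrow> ennreal c * M f \<le> N f"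
    and 2: "\<And>f. f \<in> schwartz_inf_dual \<Longrightarrow> N f \<le> ennreal C * M f"
  shows "equal_with_equivalent_norms N M"
proof -
  have 3: "M f \<le> ennreal (1 / c) * N f" if "f \<in> schwartz_inf_dual" for f
  proof -
    have "ennreal (1 / c) * (ennreal c * M f) \<le> ennreal (1 / c) * N f"
      using 1[OF that] by (rule mult_left_mono) simp
    moreover have "ennreal (1 / c) * ennreal c = 1" using c by (simp flip: ennreal_mult)
    ultimately show ?thesis by (simp add: mult.assoc[symmetric])
  qed
  have 4: "ennreal (1 / C) * N f \<le> M f" if "f \<in> schwartz_inf_dual" for f
  proof -
    have "ennreal (1 / C) * N f \<le> ennreal (1 / C) * (ennreal C * M f)"
      using 2[OF that] by (rule mult_left_mono) simp
    moreover have "ennreal (1 / C) * ennreal C = 1" using C by (simp flip: ennreal_mult)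
    ultimately show ?thesis by (simp add: mult.assoc[symmetric])
  qed
  have "space_of N = space_of M"
    unfolding space_of_def
  proof (intro Collect_cong conj_cong refl)
    fix f :: "(real^'a \<Rightarrow> complex) \<Rightarrow> complex" assume f: "f \<in> schwartz_inf_dual"
    show "N f < \<infinity> \<longleftrightarrow> M f < \<infinity>"
      using 2[OF f] 3[OF f] by (auto simp: ennreal_mult_less_top intro: le_less_trans)
  qed
  moreover have "equivalent_on (space_of N) N M"
    unfolding equivalent_on_def using 3 4 c C
    by (intro exI[of _ "1 / C"] exI[of _ "1 / c"]) (auto simp: space_of_def)
  ultimately show ?thesis by (simp add: equal_with_equivalent_norms_def)
qed

section \<open>The two estimates between the quasi-norms and their combination\<close>

context
  fixes \<phi> :: "real^'n::finite \<Rightarrow> complex"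
  assumes \<phi>: "\<phi> \<in> schwartz"
    and outer: "\<forall>\<xi>. 2 < norm \<xi> \<longrightarrow> fourier \<phi> \<xi> = 0"
    and inner: "\<forall>\<xi>. norm \<xi> < 1/2 \<longrightarrow> fourier \<phi> \<xi> = 0"
begin

text \<open>Every level j is reduced to c = 2^j and z = 2^j x. The prefactor 2^(j n) is the same at
  all points, so it cancels when values at two points are compared.\<close>

lemma conv_dilate_eq:
  assumes f: "f \<in> schwartz_inf_dual"
  shows "conv (dilate \<phi> j) f x = of_real (2 powr (of_int j * real CARD('n))) *
    f (\<lambda>y. \<phi> ((2 powr of_int j) *\<^sub>R x - (2 powr of_int j) *\<^sub>R y))"
proof -
  have "2 powi (j * int CARD('n)) = 2 powr (of_int j * real CARD('n))"
    by (subst powr_real_of_int'[symmetric]) auto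
  then have "conv (dilate \<phi> j) f x = f (\<lambda>y. of_real (2 powr (of_int j * real CARD('n))) *
    \<phi> ((2 powr of_int j) *\<^sub>R x - (2 powr of_int j) *\<^sub>R y))"
    by (simp add: conv_def dilate_def powr_real_of_int' scaleR_diff_right
        scaleR_conv_of_real[where 'a=complex])
  then show ?thesis
    using schwartz_inf_dual_mult[OF f translate_in_schwartz_inf[OF \<phi> outer inner]] by simp
qed

context
  fixes a assumes a: "\<phi> a \<noteq> 0"
begin

lemma conv_dilate_measurable:
  assumes f: "f \<in> schwartz_inf_dual"
  shows "conv (dilate \<phi> j) f \<in> borel_measurable borel"
proof -
  have [measurable]: "(\<lambda>z. f (\<lambda>y. \<phi> (z - (2 powr of_int j) *\<^sub>R y))) \<in> borel_measurable borel"
    by (rule convolution_measurable[OF \<phi> outer inner a f]) auto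
  have "(\<lambda>x. of_real (2 powr (of_int j * real CARD('n))) *
    f (\<lambda>y. \<phi> ((2 powr of_int j) *\<^sub>R x - (2 powr of_int j) *\<^sub>R y))) \<in> borel_measurable borel"
    by measurable
  then show ?thesis by (simp add: conv_dilate_eq[OF f, abs_def])
qed

text \<open>A box of side r in the variable 2^j x has side r 2^(-j) in x, that is, it occupies the
  fixed fraction r^n of a dyadic cube of level j.\<close>

lemma conv_dilate_lower_bound:
  "\<exists>\<kappa> r. 0 < \<kappa> \<and> 0 < r \<and> (\<forall>f\<in>schwartz_inf_dual. \<forall>j x. \<exists>k A. A \<in> sets borel \<and> A \<subseteq> dyadic_cube j k \<and>
      emeasure lborel A = ennreal (r ^ CARD('n) * 2 powr (- (of_int j * real CARD('n)))) \<and>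
      (\<forall>y\<in>A. \<kappa> * norm (conv (dilate \<phi> j) f x) \<le> norm (conv (dilate \<phi> j) f y)))"
proof -
  from convolution_lower_bound_on_box[OF \<phi> outer inner a] obtain \<kappa> r :: real
    where \<kappa>: "0 < \<kappa>" and r: "0 < r" "r \<le> 1/4"
    and low: "\<forall>f\<in>schwartz_inf_dual. \<forall>c>0. \<forall>z0. \<exists>x0. \<forall>z. (\<forall>i. \<bar>z $ i - x0 $ i\<bar> \<le> r) \<longrightarrow>
      \<kappa> * norm (f (\<lambda>y. \<phi> (z0 - c *\<^sub>R y))) \<le> norm (f (\<lambda>y. \<phi> (z - c *\<^sub>R y)))"
    by (elim exE conjE)
  show ?thesis
  proof (rule exI[of _ \<kappa>], rule exI[of _ r], intro conjI ballI allI \<kappa> r(1))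
    fix f :: "(real^'n \<Rightarrow> complex) \<Rightarrow> complex" and j :: int and x :: "real^'n"
    assume f: "f \<in> schwartz_inf_dual"
    define c where "c = 2 powr real_of_int j"
    have c: "0 < c" by (simp add: c_def)
    from low[rule_format, OF f c, of "c *\<^sub>R x"] obtain x0 where
      x0: "\<And>z. (\<And>i. \<bar>z $ i - x0 $ i\<bar> \<le> r) \<Longrightarrow>
      \<kappa> * norm (f (\<lambda>y. \<phi> (c *\<^sub>R x - c *\<^sub>R y))) \<le> norm (f (\<lambda>y. \<phi> (z - c *\<^sub>R y)))" by blast
    have r2: "r \<le> 1/2" using r by simp
    from box_in_dyadic_cube[OF r(1) r2, of j x0, folded c_def] obtain k A where A: "A \<in> sets borel" "A \<subseteq> dyadic_cube j k"
      "emeasure lborel A = ennreal (r ^ CARD('n) * 2 powr (- (of_int j * real CARD('n))))"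
      "\<forall>x\<in>A. \<forall>l. \<bar>c * x $ l - x0 $ l\<bar> \<le> r"
      by (elim exE conjE)
    have "\<kappa> * norm (conv (dilate \<phi> j) f x) \<le> norm (conv (dilate \<phi> j) f y)" if y: "y \<in> A" for y
    proof -
      have "\<kappa> * norm (f (\<lambda>y. \<phi> (c *\<^sub>R x - c *\<^sub>R y))) \<le> norm (f (\<lambda>w. \<phi> (c *\<^sub>R y - c *\<^sub>R w)))"
        by (rule x0) (use A(4) y in simp)
      then show ?thesis
        unfolding conv_dilate_eq[OF f] c_def norm_mult
        by (simp add: mult.left_commute[of \<kappa>])
    qed
    then show "\<exists>k A. A \<in> sets borel \<and> A \<subseteq> dyadic_cube j k \<and>
      emeasure lborel A = ennreal (r ^ CARD('n) * 2 powr (- (of_int j * real CARD('n)))) \<and>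
      (\<forall>y\<in>A. \<kappa> * norm (conv (dilate \<phi> j) f x) \<le> norm (conv (dilate \<phi> j) f y))"
      by (intro exI[of _ k] exI[of _ A] conjI ballI A)
  qed
qed

context
  fixes s \<tau> d :: real and p q :: ennreal
  assumes d: "d = real CARD('n) * (\<tau> - recip p)" and p: "0 < p" and q: "0 < q"
    and \<tau>: "q < \<infinity> \<and> recip p < \<tau> \<or> q = \<infinity> \<and> recip p \<le> \<tau>"
begin

lemma norms_lower:
  "\<exists>c>0. \<forall>f\<in>schwartz_inf_dual.
    ennreal c * inf_inf_norm \<phi> (s + d) f \<le> F_norm \<phi> s \<tau> p q f \<and>
    ennreal c * inf_inf_norm \<phi> (s + d) f \<le> B_norm \<phi> s \<tau> p q f"
proof -
  from conv_dilate_lower_bound obtain \<kappa> r :: real where \<kappa>: "0 < \<kappa>" and r: "0 < r"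
    and low: "\<forall>f\<in>schwartz_inf_dual. \<forall>j x. \<exists>k A. A \<in> sets borel \<and> A \<subseteq> dyadic_cube j k \<and>
      emeasure lborel A = ennreal (r ^ CARD('n) * 2 powr (- (of_int j * real CARD('n)))) \<and>
      (\<forall>y\<in>A. \<kappa> * norm (conv (dilate \<phi> j) f x) \<le> norm (conv (dilate \<phi> j) f y))"
    by (elim exE conjE)
  define c where "c = \<kappa> * (r ^ CARD('n)) powr recip p"
  have c: "0 < c" using \<kappa> r by (simp add: c_def)
  \<comment> \<open>For |P| = 2^(-j n) the quotient |P|^(1/p) / |P|^\<tau> is 2^(j d): the shift of
    the smoothness index.\<close>
  have scale: "t * (r ^ CARD('n) * 2 powr (- (of_int j * real CARD('n)))) powr recip p /
      2 powr (- (of_int j * real CARD('n) * \<tau>)) =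
      t * (r ^ CARD('n)) powr recip p * 2 powr (of_int j * d)" for t j
  proof -
    have "(2 powr (- (of_int j * real CARD('n)))) powr recip p / 2 powr (- (of_int j * real CARD('n) * \<tau>))
       = 2 powr (of_int j * d)"
      unfolding powr_powr powr_diff[symmetric] by (simp add: d algebra_simps)
    moreover have "(r ^ CARD('n) * 2 powr (- (of_int j * real CARD('n)))) powr recip p =
      (r ^ CARD('n)) powr recip p * (2 powr (- (of_int j * real CARD('n)))) powr recip p"
      by (rule powr_mult)
    ultimately show ?thesis by (simp only: mult.assoc times_divide_eq_right[symmetric])
  qed
  have pointwise: "ennreal (c * 2 powr (of_int j * (s + d)) * norm (conv (dilate \<phi> j) f x)) \<le> F_norm \<phi> s \<tau> p q f"
      "ennreal (c * 2 powr (of_int j * (s + d)) * norm (conv (dilate \<phi> j) f x)) \<le> B_norm \<phi> s \<tau> p q f"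
    if f: "f \<in> schwartz_inf_dual" for f j x
  proof -
    define u where "u = (\<lambda>j y. norm (conv (dilate \<phi> j) f y))"
    from low[rule_format, OF f, of j x] obtain k A where A: "A \<in> sets borel" "A \<subseteq> dyadic_cube j k"
      "emeasure lborel A = ennreal (r ^ CARD('n) * 2 powr (- (of_int j * real CARD('n))))"
      "\<And>y. y \<in> A \<Longrightarrow> \<kappa> * u j x \<le> u j y" unfolding u_def by blast
    define m where "m = r ^ CARD('n) * 2 powr (- (of_int j * real CARD('n)))"
    have m: "0 < m" using r by (simp add: m_def)
    have u0: "0 \<le> u j y" for j y by (simp add: u_def)
    define v where "v = measure lborel (dyadic_cube j k :: (real^'n) set) powr \<tau>"
    have v: "v = 2 powr (- (of_int j * real CARD('n) * \<tau>))" "0 < v"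
      by (simp_all add: v_def measure_dyadic_cube_powr)
    have e: "(2 powr (of_int j * s) * (\<kappa> * u j x)) * m powr recip p / v = c * 2 powr (of_int j * (s + d)) * u j x"
      unfolding m_def v(1) scale c_def by (simp add: distrib_left powr_add mult_ac)
    have "ennreal (c * 2 powr (of_int j * (s + d)) * u j x) =
        ennreal ((2 powr (of_int j * s) * (\<kappa> * u j x)) * m powr recip p) / ennreal v"
      unfolding e[symmetric] using \<kappa> v u0 by (intro divide_ennreal[symmetric]) auto
    \<comment> \<open>For every y in the box A the inner quasi-norm is at least its single term of
      index j = j_P, and A lies in the cube; this term already carries the full bound.\<close>
    also have "\<dots> \<le> Lp_qnorm p (dyadic_cube j k)
        (\<lambda>x. lq_qnorm q {j..} (\<lambda>j. ennreal (2 powr (of_int j * s) * u j x))) / ennreal v"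
    proof (intro divide_right_mono_ennreal Lp_qnorm_lower[OF p A(1) _ A(2)])
      fix y assume y: "y \<in> A"
      have "ennreal (2 powr (of_int j * s) * (\<kappa> * u j x)) \<le> ennreal (2 powr (of_int j * s) * u j y)"
        using A(4)[OF y] by (intro ennreal_leI mult_left_mono) auto
      also have "\<dots> \<le> lq_qnorm q {j..} (\<lambda>j. ennreal (2 powr (of_int j * s) * u j y))"
        by (rule lq_qnorm_lower[OF q, where a="\<lambda>j. ennreal (2 powr (of_int j * s) * u j y)"]) simp
      finally show "ennreal (2 powr (of_int j * s) * (\<kappa> * u j x)) \<le> lq_qnorm q {j..} (\<lambda>j. ennreal (2 powr (of_int j * s) * u j y))" .
    qed (use A(3) m \<kappa> u0 in \<open>auto simp: m_def\<close>)
    also have "\<dots> \<le> F_norm \<phi> s \<tau> p q f"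
      unfolding F_norm_def u_def v_def 
      by (rule order_trans[OF _ SUP_upper[of j UNIV, OF UNIV_I]], rule order_trans[OF _ SUP_upper[of k UNIV, OF UNIV_I]]) simp
    finally show "ennreal (c * 2 powr (of_int j * (s + d)) * norm (conv (dilate \<phi> j) f x)) \<le> F_norm \<phi> s \<tau> p q f"
      by (simp only: u_def)
    have "ennreal (c * 2 powr (of_int j * (s + d)) * u j x) =
        ennreal (2 powr (of_int j * s)) * ennreal (\<kappa> * u j x * m powr recip p) / ennreal v"
      unfolding e[symmetric] using \<kappa> v u0
      by (subst ennreal_mult[symmetric], simp, simp, subst divide_ennreal) (auto simp: mult.assoc)
    also have "\<dots> \<le> ennreal (2 powr (of_int j * s)) *
        Lp_qnorm p (dyadic_cube j k) (\<lambda>x. ennreal (u j x)) / ennreal v"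
    proof (intro divide_right_mono_ennreal mult_left_mono Lp_qnorm_lower[OF p A(1) _ A(2)])
      show "ennreal (\<kappa> * u j x) \<le> ennreal (u j y)" if "y \<in> A" for y
        using A(4)[OF that] by (rule ennreal_leI)
    qed (use A(3) m \<kappa> u0 in \<open>auto simp: m_def\<close>)
    also have "\<dots> \<le> lq_qnorm q {j..} (\<lambda>i. ennreal (2 powr (of_int i * s)) *
        Lp_qnorm p (dyadic_cube j k) (\<lambda>x. ennreal (u i x))) / ennreal v"
      by (intro divide_right_mono_ennreal
          lq_qnorm_lower[OF q, where a="\<lambda>i. ennreal (2 powr (of_int i * s)) *
            Lp_qnorm p (dyadic_cube j k) (\<lambda>x. ennreal (u i x))"]) simp
    also have "\<dots> \<le> B_norm \<phi> s \<tau> p q f"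
      unfolding B_norm_def u_def v_def 
      by (rule order_trans[OF _ SUP_upper[of j UNIV, OF UNIV_I]], rule order_trans[OF _ SUP_upper[of k UNIV, OF UNIV_I]]) simp
    finally show "ennreal (c * 2 powr (of_int j * (s + d)) * norm (conv (dilate \<phi> j) f x)) \<le> B_norm \<phi> s \<tau> p q f"
      by (simp only: u_def)
  qed
  show ?thesis
  proof (rule exI[of _ c], intro conjI ballI c)
    fix f :: "(real^'n \<Rightarrow> complex) \<Rightarrow> complex" assume f: "f \<in> schwartz_inf_dual"
    note le = inf_inf_norm_le[OF c conv_dilate_measurable[OF f]]
    show "ennreal c * inf_inf_norm \<phi> (s + d) f \<le> F_norm \<phi> s \<tau> p q f"
      by (rule le) (rule pointwise(1)[OF f])
    show "ennreal c * inf_inf_norm \<phi> (s + d) f \<le> B_norm \<phi> s \<tau> p q f"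
      by (rule le) (rule pointwise(2)[OF f])
  qed
qed

text \<open>If the right-hand quasi-norm is m, then |\<phi>_j * f| \<le> m 2^(-j (s + d)) almost
  everywhere. The weight 2^(j s) leaves m 2^(-j d), summing over j \<ge> i gives a multiple of 2^(-i
  d), and this is cancelled by |P|^(1/p - \<tau>) = 2^(i d). For the Triebel-Lizorkin-type
  quasi-norm, p < \<infinity> avoids the measurability condition of \<open>Lp_qnorm_upper\<close> on
  the inner quasi-norm.\<close>

lemma norms_upper:
  "\<exists>C>0. \<forall>f\<in>schwartz_inf_dual.
    (p < \<infinity> \<longrightarrow> F_norm \<phi> s \<tau> p q f \<le> ennreal C * inf_inf_norm \<phi> (s + d) f) \<and>
    B_norm \<phi> s \<tau> p q f \<le> ennreal C * inf_inf_norm \<phi> (s + d) f"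
proof -
  have "q = \<infinity> \<and> 0 \<le> d \<or> q < \<infinity> \<and> 0 < d" using \<tau> by (auto simp: d)
  from lq_qnorm_geometric[OF q this] obtain G where G: "0 < G"
    and lq: "\<And>i c a. 0 \<le> c \<Longrightarrow> (\<And>j. i \<le> j \<Longrightarrow> a j \<le> ennreal (c * 2 powr (- (of_int j * d)))) \<Longrightarrow>
      lq_qnorm q {i..} a \<le> ennreal (c * G * 2 powr (- (of_int i * d)))" by metis
  have main: "(p < \<infinity> \<longrightarrow> F_norm \<phi> s \<tau> p q f \<le> ennreal (G * m)) \<and> B_norm \<phi> s \<tau> p q f \<le> ennreal (G * m)"
    if f: "f \<in> schwartz_inf_dual" and M: "inf_inf_norm \<phi> (s + d) f = ennreal m" and m: "0 \<le> m" for f m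
  proof -
    define u where "u = (\<lambda>j y. norm (conv (dilate \<phi> j) f y))"
    have meas: "(\<lambda>x. ennreal (u j x)) \<in> borel_measurable borel" for j
      unfolding u_def using conv_dilate_measurable[OF f, of j] by measurable
    have ae: "AE x in lborel. \<forall>j. u j x \<le> m * 2 powr (- (of_int j * (s + d)))"
      unfolding u_def using M m by (intro inf_inf_norm_AE) auto
    have sd: "2 powr (of_int j * s) * (m * 2 powr (- (of_int j * (s + d)))) = m * 2 powr (- (of_int j * d))" for j :: int
    proof -
      have "2 powr (of_int j * s) * 2 powr (- (of_int j * (s + d))) = 2 powr (- (of_int j * d))"
        unfolding powr_add[symmetric] by (simp add: algebra_simps)
      then show ?thesis by (simp add: mult.left_commute[of _ m])
    qed
    have v: "measure lborel (dyadic_cube i k :: (real^'n) set) powr \<tau> = 2 powr (- (of_int i * real CARD('n) * \<tau>))" for i k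
      by (rule measure_dyadic_cube_powr)
    have cancel: "(m * G * 2 powr (- (of_int i * d))) * (2 powr (- (of_int i * real CARD('n)))) powr recip p /
        2 powr (- (of_int i * real CARD('n) * \<tau>)) = G * m" for i :: int
    proof -
      have "2 powr (- (of_int i * d)) * (2 powr (- (of_int i * real CARD('n)))) powr recip p /
        2 powr (- (of_int i * real CARD('n) * \<tau>)) = 1"
        unfolding powr_powr powr_diff[symmetric] powr_add[symmetric] by (simp add: d algebra_simps)
      moreover have "(m * G * A) * B / E = (G * m) * (A * B / E)" for A B E :: real by simp
      ultimately show ?thesis by simp
    qed
    have F: "F_norm \<phi> s \<tau> p q f \<le> ennreal (G * m)" if "p < \<infinity>"
      unfolding F_norm_def
    proof (intro SUP_least)
      fix i and k :: "int^'n"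
      let ?P = "dyadic_cube i k"
      have "Lp_qnorm p ?P (\<lambda>x. lq_qnorm q {i..} (\<lambda>j. ennreal (2 powr (of_int j * s) * u j x)))
        \<le> ennreal ((m * G * 2 powr (- (of_int i * d))) * (2 powr (- (of_int i * real CARD('n)))) powr recip p)"
      proof (rule Lp_qnorm_upper[OF p])
        show "AE x in lborel. x \<in> ?P \<longrightarrow> lq_qnorm q {i..} (\<lambda>j. ennreal (2 powr (of_int j * s) * u j x))
          \<le> ennreal (m * G * 2 powr (- (of_int i * d)))"
          using ae
        proof eventually_elim
          case (elim x)
          have le: "ennreal (2 powr (of_int j * s) * u j x) \<le> ennreal (m * 2 powr (- (of_int j * d)))" for j
            unfolding sd[symmetric] using elim by (intro ennreal_leI mult_left_mono) auto
          show ?case by (intro impI lq[OF m] le)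
        qed
      qed (use that G m emeasure_dyadic_cube in auto)
      then have "Lp_qnorm p ?P (\<lambda>x. lq_qnorm q {i..} (\<lambda>j. ennreal (2 powr (of_int j * s) * u j x)))
          / ennreal (measure lborel ?P powr \<tau>)
        \<le> ennreal ((m * G * 2 powr (- (of_int i * d))) * (2 powr (- (of_int i * real CARD('n)))) powr recip p)
          / ennreal (measure lborel ?P powr \<tau>)"
        by (rule divide_right_mono_ennreal)
      also have "\<dots> = ennreal (G * m)"
        unfolding v by (subst divide_ennreal) (use G m cancel in auto)
      finally show "Lp_qnorm p ?P (\<lambda>x. lq_qnorm q {i..} (\<lambda>j. ennreal (2 powr (of_int j * s) * norm (conv (dilate \<phi> j) f x))))
          / ennreal (measure lborel ?P powr \<tau>) \<le> ennreal (G * m)" unfolding u_def .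
    qed
    have B: "B_norm \<phi> s \<tau> p q f \<le> ennreal (G * m)"
      unfolding B_norm_def
    proof (intro SUP_least)
      fix i and k :: "int^'n"
      let ?P = "dyadic_cube i k"
      define V where "V = (2 powr (- (of_int i * real CARD('n)))) powr recip p"
      have "ennreal (2 powr (of_int j * s)) * Lp_qnorm p ?P (\<lambda>x. ennreal (u j x)) \<le> ennreal ((m * V) * 2 powr (- (of_int j * d)))" for j
      proof -
        have "Lp_qnorm p ?P (\<lambda>x. ennreal (u j x)) \<le> ennreal ((m * 2 powr (- (of_int j * (s + d)))) * V)"
          unfolding V_def
        proof (rule Lp_qnorm_upper[OF p])
          show "AE x in lborel. x \<in> ?P \<longrightarrow> ennreal (u j x) \<le> ennreal (m * 2 powr (- (of_int j * (s + d))))"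
            using ae by eventually_elim (auto intro: ennreal_leI)
          show "(\<lambda>x. ennreal (u j x)) \<in> borel_measurable (restrict_space lborel ?P)"
            using meas by (intro measurable_restrict_space1) simp
        qed (use m emeasure_dyadic_cube in auto)
        then have "ennreal (2 powr (of_int j * s)) * Lp_qnorm p ?P (\<lambda>x. ennreal (u j x)) \<le>
          ennreal (2 powr (of_int j * s)) * ennreal ((m * 2 powr (- (of_int j * (s + d)))) * V)"
          by (rule mult_left_mono) simp
        also have "\<dots> = ennreal (2 powr (of_int j * s) * ((m * 2 powr (- (of_int j * (s + d)))) * V))"
          using m by (intro ennreal_mult[symmetric]) (auto simp: V_def)
        also have "2 powr (of_int j * s) * ((m * 2 powr (- (of_int j * (s + d)))) * V) = (m * V) * 2 powr (- (of_int j * d))"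
        proof -
          have "2 powr (of_int j * s) * ((m * 2 powr (- (of_int j * (s + d)))) * V) =
            (2 powr (of_int j * s) * (m * 2 powr (- (of_int j * (s + d))))) * V" by (simp only: mult.assoc)
          also have "\<dots> = (m * V) * 2 powr (- (of_int j * d))" unfolding sd by (simp only: mult_ac)
          finally show ?thesis .
        qed
        finally show ?thesis .
      qed
      then have "lq_qnorm q {i..} (\<lambda>j. ennreal (2 powr (of_int j * s)) * Lp_qnorm p ?P (\<lambda>x. ennreal (u j x)))
        \<le> ennreal ((m * V) * G * 2 powr (- (of_int i * d)))"
        using m by (intro lq) (auto simp: V_def)
      also have "(m * V) * G * 2 powr (- (of_int i * d)) = (m * G * 2 powr (- (of_int i * d))) * V"
        by (simp only: mult_ac)
      finally have "lq_qnorm q {i..} (\<lambda>j. ennreal (2 powr (of_int j * s)) * Lp_qnorm p ?P (\<lambda>x. ennreal (u j x)))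
          / ennreal (measure lborel ?P powr \<tau>)
        \<le> ennreal ((m * G * 2 powr (- (of_int i * d))) * V) / ennreal (measure lborel ?P powr \<tau>)"
        by (rule divide_right_mono_ennreal)
      also have "\<dots> = ennreal (G * m)"
        unfolding v V_def by (subst divide_ennreal) (use G m cancel in auto)
      finally show "lq_qnorm q {i..} (\<lambda>j. ennreal (2 powr (of_int j * s)) * Lp_qnorm p ?P (\<lambda>x. ennreal (norm (conv (dilate \<phi> j) f x))))
          / ennreal (measure lborel ?P powr \<tau>) \<le> ennreal (G * m)" unfolding u_def .
    qed
    from F B show ?thesis by blast
  qed
  have "(p < \<infinity> \<longrightarrow> F_norm \<phi> s \<tau> p q f \<le> ennreal G * inf_inf_norm \<phi> (s + d) f) \<and>
      B_norm \<phi> s \<tau> p q f \<le> ennreal G * inf_inf_norm \<phi> (s + d) f"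
    if f: "f \<in> schwartz_inf_dual" for f
  proof (cases "inf_inf_norm \<phi> (s + d) f")
    case (real m)
    then show ?thesis using main[OF f real(2,1)] G by (simp add: ennreal_mult)
  next
    \<comment> \<open>Here G > 0 is essential, since 0 * \<infinity> = 0 in
      \<open>ennreal\<close>.\<close>
    case top
    then show ?thesis using G by (simp add: ennreal_mult_top)
  qed
  then show ?thesis using G by blast
qed

lemma norms_equivalent:
  shows "p < \<infinity> \<Longrightarrow> equal_with_equivalent_norms (F_norm \<phi> s \<tau> p q) (inf_inf_norm \<phi> (s + d))"
    and "equal_with_equivalent_norms (B_norm \<phi> s \<tau> p q) (inf_inf_norm \<phi> (s + d))"
proof -
  obtain c where c: "0 < c"
    "\<forall>f\<in>schwartz_inf_dual. ennreal c * inf_inf_norm \<phi> (s + d) f \<le> F_norm \<phi> s \<tau> p q f \<and>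
      ennreal c * inf_inf_norm \<phi> (s + d) f \<le> B_norm \<phi> s \<tau> p q f"
    using norms_lower by blast
  obtain C where C: "0 < C"
    "\<forall>f\<in>schwartz_inf_dual.
      (p < \<infinity> \<longrightarrow> F_norm \<phi> s \<tau> p q f \<le> ennreal C * inf_inf_norm \<phi> (s + d) f) \<and>
      B_norm \<phi> s \<tau> p q f \<le> ennreal C * inf_inf_norm \<phi> (s + d) f"
    using norms_upper by blast
  show "p < \<infinity> \<Longrightarrow> equal_with_equivalent_norms (F_norm \<phi> s \<tau> p q) (inf_inf_norm \<phi> (s + d))"
    using c C by (intro equal_with_equivalent_normsI[of c C]) auto
  show "equal_with_equivalent_norms (B_norm \<phi> s \<tau> p q) (inf_inf_norm \<phi> (s + d))"
    using c C by (intro equal_with_equivalent_normsI[of c C]) auto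
qed

end

end

end

theorem theorem1:
  fixes \<phi> :: "real^'n::finite \<Rightarrow> complex" and C s :: real and q :: ennreal
  assumes "\<phi> \<in> schwartz"
    and "closure {\<xi>. fourier \<phi> \<xi> \<noteq> 0} \<subseteq> {\<xi>. 1/2 \<le> norm \<xi> \<and> norm \<xi> \<le> 2}"
    and "0 < C"
    and "\<forall>\<xi>. 3/5 \<le> norm \<xi> \<and> norm \<xi> \<le> 5/3 \<longrightarrow> C \<le> norm (fourier \<phi> \<xi>)"
    and "0 < q"
  shows "(\<forall>p \<tau>. 0 < p \<and> p < \<infinity> \<and> (q < \<infinity> \<and> recip p < \<tau> \<or> q = \<infinity> \<and> recip p \<le> \<tau>) \<longrightarrow>
            equal_with_equivalent_norms (F_norm \<phi> s \<tau> p q)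
              (inf_inf_norm \<phi> (s + real CARD('n) * (\<tau> - recip p)))) \<and>
         (\<forall>p \<tau>. 0 < p \<and> (q < \<infinity> \<and> recip p < \<tau> \<or> q = \<infinity> \<and> recip p \<le> \<tau>) \<longrightarrow>
            equal_with_equivalent_norms (B_norm \<phi> s \<tau> p q)
              (inf_inf_norm \<phi> (s + real CARD('n) * (\<tau> - recip p))))"
proof -
  have supp: "1/2 \<le> norm \<xi> \<and> norm \<xi> \<le> 2" if "fourier \<phi> \<xi> \<noteq> 0" for \<xi>
    using assms(2) closure_subset[of "{\<xi>. fourier \<phi> \<xi> \<noteq> 0}"] that by blast
  then have outer: "\<forall>\<xi>. 2 < norm \<xi> \<longrightarrow> fourier \<phi> \<xi> = 0"
    and inner: "\<forall>\<xi>. norm \<xi> < 1/2 \<longrightarrow> fourier \<phi> \<xi> = 0" by fastforce+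
  \<comment> \<open>If \<open>\<phi>\<close> were identically 0, so would be its transform; but a
    unit vector lies in the annulus from 3/5 to 5/3, where the transform is at least C > 0 in
    modulus.\<close>
  obtain a where a: "\<phi> a \<noteq> 0"
  proof (rule ccontr)
    assume "\<not> thesis"
    then have "\<phi> = (\<lambda>_. 0)" using that by auto
    then have "fourier \<phi> (axis undefined 1) = 0" by (simp add: fourier_def)
    then show False using assms(3,4) by (auto dest: spec[of _ "axis undefined 1"])
  qed
  show ?thesis
  proof (intro conjI allI impI)
    fix p :: ennreal and \<tau> :: real
    assume h: "0 < p \<and> p < \<infinity> \<and> (q < \<infinity> \<and> recip p < \<tau> \<or> q = \<infinity> \<and> recip p \<le> \<tau>)"
    show "equal_with_equivalent_norms (F_norm \<phi> s \<tau> p q)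
      (inf_inf_norm \<phi> (s + real CARD('n) * (\<tau> - recip p)))"
      by (rule norms_equivalent(1)[OF assms(1) outer inner a refl _ assms(5)]) (use h in simp_all)
  next
    fix p :: ennreal and \<tau> :: real
    assume h: "0 < p \<and> (q < \<infinity> \<and> recip p < \<tau> \<or> q = \<infinity> \<and> recip p \<le> \<tau>)"
    show "equal_with_equivalent_norms (B_norm \<phi> s \<tau> p q)
      (inf_inf_norm \<phi> (s + real CARD('n) * (\<tau> - recip p)))"
      by (rule norms_equivalent(2)[OF assms(1) outer inner a refl _ assms(5)]) (use h in simp_all)
  qed
qed

end
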